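(* Let $\Omega\subseteq\mathbb{R}^n$ be open and bounded and let $X_1,\dots,X_m$ be vector fields whose coefficient matrix $\sigma=(\sigma_{ij})$ ($n\times m$, the $j$-th column $\sigma^j$ being the coefficients of $X_j$) has entries in $C^{1,1}(\overline\Omega)$. Assume that $K:\overline\Omega\times\mathbb{R}\times\mathbb{R}^n\times S^n\to\mathbb{R}$ satisfies the structure conditions on $S^n$, and consider the equation $$(E)\qquad-\log\det(D^2_{\mathcal X}u)+K(x,u,Du,D^2u)=0\quad\text{in }\Omega .$$ (i) Let $u:\overline\Omega\to\mathbb{R}$ be a bounded, uniformly $\mathcal X$-convex viscosity subsolution of $(E)$ and let $v:\overline\Omega\to\mathbb{R}$ be a bounded, lower semicontinuous viscosity supersolution of $(E)$. Put $M:=\max\{\|u\|_\infty,\|v\|_\infty\}$ and assume that for some $C>0$ $$K(x,r,p,X)-K(x,s,p,X)\ge C(r-s)\quad\text{whenever }-M\le s\le r\le M,\ x\in\overline\Omega,\ p\in\mathbb{R}^n,\ X\in S^n .$$ Then $\sup_\Omega(u-v)\le\max_{\partial\Omega}(u-v)^+$. (ii) There is at most one uniformly $\mathcal X$-convex viscosity solution of $(E)$ with prescribed continuous boundary data, in the following sense: if $u_1,u_2$ are uniformly $\mathcal X$-convex viscosity solutions of $(E)$ with $u_1=u_2$ on $\partial\Omega$, and if, with $M:=\max\{\|u_1\|_\infty,\|u_2\|_\infty\}$, there is some $C>0$ such that $$K(x,r,p,X)-K(x,s,p,X)\ge C(r-s)\quad\text{whenever }-M\le s\le r\le M,\ x\in\overline\Omega,\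 p\in\mathbb{R}^n,\ X\in S^n,$$ then $u_1=u_2$ in $\overline\Omega$.
   Context: $S^n$ is the space of real symmetric $n\times n$ matrices with the usual partial order. $(\cdot)^+=\max\{\cdot,0\}$. A modulus is a nondecreasing continuous $\omega:[0,\infty)\to[0,\infty)$ with $\omega(0)=0$. For $\varphi\in C^2(\Omega)$, $D^2_{\mathcal X}\varphi$ is the symmetric $m\times m$ matrix with entries $(X_iX_j\varphi+X_jX_i\varphi)/2$; equivalently $D^2_{\mathcal X}\varphi(x)=\sigma^T(x)D^2\varphi(x)\sigma(x)+Q(x,D\varphi(x))$ with $Q_{ij}(x,p)=[D\sigma^j\,\sigma^i+D\sigma^i\,\sigma^j](x)\cdot\frac p2$. Structure conditions on $S^n$: $K$ is continuous, nondecreasing in the second entry, nonincreasing in the last entry, and for some modulus $\omega$ $$K\Big(y,r,\tfrac{x-y}{\epsilon},Y\Big)-K\Big(x,r,\tfrac{x-y}{\epsilon},X\Big)\le\omega\Big(|x-y|\big(1+\tfrac{|x-y|}{\epsilon}\big)\Big)$$ for all $\epsilon>0$, $x,y\in\overline\Omega$, $r\in\mathbb{R}$, $X,Y\in S^n$ satisfying $$-\frac3\epsilon\begin{pmatrix}I&0\\0&I\end{pmatrix}\le\begin{pmatrix}X&0\\0&-Y\end{pmatrix}\le\frac3\epsilon\begin{pmatrix}I&-I\\-I&I\end{pmatrix}.$$ Uniform $\mathcal X$-convexity: $u:\overline\Omega\to\mathbb{R}$ is uniformly $\mathcal X$-convex if it is upper semicontinuous and for some $\gamma>0$ one has $D^2_{\mathcal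 X}\varphi(x)\ge\gamma I$ for all $\varphi\in C^2(\Omega)$ and all local maximum points $x\in\Omega$ of $u-\varphi$. Subsolution (for uniformly $\mathcal X$-convex $u$): $-\log\det(D^2_{\mathcal X}\varphi(x))+K(x,u(x),D\varphi(x),D^2\varphi(x))\le0$ for all $\varphi\in C^2(\Omega)$ and all local maximum points $x\in\Omega$ of $u-\varphi$. Supersolution: $-\log\det(D^2_{\mathcal X}\varphi(x))+K(x,v(x),D\varphi(x),D^2\varphi(x))\ge0$ for all $\varphi\in C^2(\Omega)$ and all local minimum points $x\in\Omega$ of $v-\varphi$ at which $D^2_{\mathcal X}\varphi(x)$ is positive definite. A viscosity solution is a function continuous on $\overline\Omega$ that is both a viscosity subsolution and a viscosity supersolution. *)

theory Defs
  imports "HOL-Analysis.Analysis"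
begin

section \<open>Symmetric matrices and their partial order\<close>

definition sym_mats :: "(real^'n^'n) set" where
  "sym_mats = {A. transpose A = A}"

text \<open>The usual partial order on symmetric matrices. It must not be confused with the
  library order \<open>\<le>\<close> on vectors and matrices, which is componentwise.\<close>

definition loewner_le :: "real^'n^'n \<Rightarrow> real^'n^'n \<Rightarrow> bool" (infix "\<preceq>" 50) where
  "A \<preceq> B \<longleftrightarrow> (\<forall>\<xi>. \<xi> \<bullet> (A *v \<xi>) \<le> \<xi> \<bullet> (B *v \<xi>))"

definition pos_definite :: "real^'n^'n \<Rightarrow> bool" where
  "pos_definite A \<longleftrightarrow> A \<in> sym_mats \<and> (\<forall>\<xi>. \<xi> \<noteq> 0 \<longrightarrow> 0 < \<xi> \<bullet> (A *v \<xi>))"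

definition block_mat ::
  "real^'n^'n \<Rightarrow> real^'n^'n \<Rightarrow> real^'n^'n \<Rightarrow> real^'n^'n \<Rightarrow> real^('n + 'n)^('n + 'n)" where
  "block_mat A B C D = (\<chi> i j. case (i, j) of
      (Inl a, Inl b) \<Rightarrow> A $ a $ b
    | (Inl a, Inr b) \<Rightarrow> B $ a $ b
    | (Inr a, Inl b) \<Rightarrow> C $ a $ b
    | (Inr a, Inr b) \<Rightarrow> D $ a $ b)"


section \<open>Semicontinuity, sup norm, differentiability classes\<close>

definition usc_on :: "'a::topological_space set \<Rightarrow> ('a \<Rightarrow> real) \<Rightarrow> bool" where
  "usc_on S u \<longleftrightarrow> (\<forall>x\<in>S. \<forall>c>u x. \<forall>\<^sub>F y in at x within S. u y < c)"

definition lsc_on :: "'a::topological_space set \<Rightarrow> ('a \<Rightarrow> real) \<Rightarrow> bool" where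
  "lsc_on S u \<longleftrightarrow> (\<forall>x\<in>S. \<forall>c<u x. \<forall>\<^sub>F y in at x within S. c < u y)"

definition sup_norm_on :: "'a set \<Rightarrow> ('a \<Rightarrow> real) \<Rightarrow> real" where
  "sup_norm_on S u = (SUP x\<in>S. \<bar>u x\<bar>)"

definition grad :: "(real^'n \<Rightarrow> real) \<Rightarrow> real^'n \<Rightarrow> real^'n" where
  "grad \<phi> x = (\<chi> i. frechet_derivative \<phi> (at x) (axis i 1))"

definition hessian :: "(real^'n \<Rightarrow> real) \<Rightarrow> real^'n \<Rightarrow> real^'n^'n" where
  "hessian \<phi> x = jacobian (grad \<phi>) (at x)"

text \<open>Functions on \<open>\<Omega>\<close> are represented by total functions. For open \<open>\<Omega>\<close> the notions below
  do not depend on the values outside of \<open>\<Omega>\<close> (respectively its closure).\<close>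

definition C2_on :: "(real^'n) set \<Rightarrow> (real^'n \<Rightarrow> real) \<Rightarrow> bool" where
  "C2_on \<Omega> \<phi> \<longleftrightarrow>
     (\<forall>x\<in>\<Omega>. \<phi> differentiable (at x)) \<and>
     (\<forall>x\<in>\<Omega>. grad \<phi> differentiable (at x)) \<and>
     continuous_on \<Omega> (hessian \<phi>)"

text \<open>\<open>C\<close>-1-1 up to the boundary of a bounded open set: the function is continuous up to the
  boundary and its gradient is Lipschitz in the interior; the gradient is then bounded and
  extends continuously to the closure.\<close>

definition C11_closure :: "(real^'n) set \<Rightarrow> (real^'n \<Rightarrow> real) \<Rightarrow> bool" where
  "C11_closure \<Omega> f \<longleftrightarrow>
     continuous_on (closure \<Omega>) f \<and>
     (\<forall>x\<in>\<Omega>. f differentiable (at x)) \<and>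
     (\<exists>L. L-lipschitz_on \<Omega> (grad f))"

definition loc_max_pt :: "(real^'n) set \<Rightarrow> (real^'n \<Rightarrow> real) \<Rightarrow> real^'n \<Rightarrow> bool" where
  "loc_max_pt \<Omega> f x \<longleftrightarrow> x \<in> \<Omega> \<and> (\<forall>\<^sub>F y in at x within \<Omega>. f y \<le> f x)"

definition loc_min_pt :: "(real^'n) set \<Rightarrow> (real^'n \<Rightarrow> real) \<Rightarrow> real^'n \<Rightarrow> bool" where
  "loc_min_pt \<Omega> f x \<longleftrightarrow> x \<in> \<Omega> \<and> (\<forall>\<^sub>F y in at x within \<Omega>. f x \<le> f y)"


section \<open>Vector fields and the horizontal Hessian\<close>

text \<open>The vector fields are the columns of \<open>\<sigma>\<close>: the rows of \<open>\<sigma> x\<close> are indexed by the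
  coordinates \<open>'n\<close>, its columns by the fields \<open>'m\<close>.\<close>

definition vfield ::
  "(real^'n \<Rightarrow> real^'m^'n) \<Rightarrow> 'm \<Rightarrow> (real^'n \<Rightarrow> real) \<Rightarrow> real^'n \<Rightarrow> real" where
  "vfield \<sigma> j \<phi> x = frechet_derivative \<phi> (at x) (column j (\<sigma> x))"

definition D2X :: "(real^'n \<Rightarrow> real^'m^'n) \<Rightarrow> (real^'n \<Rightarrow> real) \<Rightarrow> real^'n \<Rightarrow> real^'m^'m" where
  "D2X \<sigma> \<phi> x = (\<chi> i j.
     (vfield \<sigma> i (vfield \<sigma> j \<phi>) x + vfield \<sigma> j (vfield \<sigma> i \<phi>) x) / 2)"


section \<open>Structure conditions, convexity, viscosity solutions\<close>

definition modulus :: "(real \<Rightarrow> real) \<Rightarrow> bool" where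
  "modulus \<omega> \<longleftrightarrow> mono_on {0..} \<omega> \<and> continuous_on {0..} \<omega> \<and> (\<forall>t\<ge>0. 0 \<le> \<omega> t) \<and> \<omega> 0 = 0"

definition structure_conditions ::
  "(real^'n) set \<Rightarrow> (real^'n \<Rightarrow> real \<Rightarrow> real^'n \<Rightarrow> real^'n^'n \<Rightarrow> real) \<Rightarrow> bool" where
  "structure_conditions \<Omega> K \<longleftrightarrow>
     continuous_on (closure \<Omega> \<times> UNIV \<times> UNIV \<times> sym_mats) (\<lambda>(x, r, p, X). K x r p X) \<and>
     (\<forall>x\<in>closure \<Omega>. \<forall>r s p. \<forall>X\<in>sym_mats. s \<le> r \<longrightarrow> K x s p X \<le> K x r p X) \<and>
     (\<forall>x\<in>closure \<Omega>. \<forall>r p. \<forall>X\<in>sym_mats. \<forall>Y\<in>sym_mats. X \<preceq> Y \<longrightarrow> K x r p Y \<le> K x r p X) \<and>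
     (\<exists>\<omega>. modulus \<omega> \<and>
       (\<forall>\<epsilon>>0. \<forall>x\<in>closure \<Omega>. \<forall>y\<in>closure \<Omega>. \<forall>r. \<forall>X\<in>sym_mats. \<forall>Y\<in>sym_mats.
          (- (3 / \<epsilon>)) *\<^sub>R block_mat (mat 1) 0 0 (mat 1) \<preceq> block_mat X 0 0 (- Y) \<and>
          block_mat X 0 0 (- Y) \<preceq> (3 / \<epsilon>) *\<^sub>R block_mat (mat 1) (- mat 1) (- mat 1) (mat 1) \<longrightarrow>
          K y r ((1 / \<epsilon>) *\<^sub>R (x - y)) Y - K x r ((1 / \<epsilon>) *\<^sub>R (x - y)) X
            \<le> \<omega> (norm (x - y) * (1 + norm (x - y) / \<epsilon>))))"

definition uniformly_X_convex ::
  "(real^'n) set \<Rightarrow> (real^'n \<Rightarrow> real^'m^'n) \<Rightarrow> (real^'n \<Rightarrow> real) \<Rightarrow> bool" where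
  "uniformly_X_convex \<Omega> \<sigma> u \<longleftrightarrow>
     usc_on (closure \<Omega>) u \<and>
     (\<exists>\<gamma>>0. \<forall>\<phi> x. C2_on \<Omega> \<phi> \<and> loc_max_pt \<Omega> (\<lambda>y. u y - \<phi> y) x \<longrightarrow>
        \<gamma> *\<^sub>R mat 1 \<preceq> D2X \<sigma> \<phi> x)"

text \<open>The subsolution property is only meant for uniformly X-convex functions; the
  determinant is then positive at every contact point. The semicontinuity of sub- and
  supersolutions is not included in the two definitions below.\<close>

definition viscosity_subsolution ::
  "(real^'n) set \<Rightarrow> (real^'n \<Rightarrow> real^'m^'n) \<Rightarrow>
   (real^'n \<Rightarrow> real \<Rightarrow> real^'n \<Rightarrow> real^'n^'n \<Rightarrow> real) \<Rightarrow> (real^'n \<Rightarrow> real) \<Rightarrow> bool" where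
  "viscosity_subsolution \<Omega> \<sigma> K u \<longleftrightarrow>
     (\<forall>\<phi> x. C2_on \<Omega> \<phi> \<and> loc_max_pt \<Omega> (\<lambda>y. u y - \<phi> y) x \<longrightarrow>
        - ln (det (D2X \<sigma> \<phi> x)) + K x (u x) (grad \<phi> x) (hessian \<phi> x) \<le> 0)"

definition viscosity_supersolution ::
  "(real^'n) set \<Rightarrow> (real^'n \<Rightarrow> real^'m^'n) \<Rightarrow>
   (real^'n \<Rightarrow> real \<Rightarrow> real^'n \<Rightarrow> real^'n^'n \<Rightarrow> real) \<Rightarrow> (real^'n \<Rightarrow> real) \<Rightarrow> bool" where
  "viscosity_supersolution \<Omega> \<sigma> K v \<longleftrightarrow>
     (\<forall>\<phi> x. C2_on \<Omega> \<phi> \<and> loc_min_pt \<Omega> (\<lambda>y. v y - \<phi> y) x \<and> pos_definite (D2X \<sigma> \<phi> x) \<longrightarrow>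
        - ln (det (D2X \<sigma> \<phi> x)) + K x (v x) (grad \<phi> x) (hessian \<phi> x) \<ge> 0)"

definition viscosity_solution ::
  "(real^'n) set \<Rightarrow> (real^'n \<Rightarrow> real^'m^'n) \<Rightarrow>
   (real^'n \<Rightarrow> real \<Rightarrow> real^'n \<Rightarrow> real^'n^'n \<Rightarrow> real) \<Rightarrow> (real^'n \<Rightarrow> real) \<Rightarrow> bool" where
  "viscosity_solution \<Omega> \<sigma> K u \<longleftrightarrow>
     continuous_on (closure \<Omega>) u \<and>
     viscosity_subsolution \<Omega> \<sigma> K u \<and> viscosity_supersolution \<Omega> \<sigma> K u"

definition strictly_increasing_in_r ::
  "(real^'n) set \<Rightarrow> (real^'n \<Rightarrow> real \<Rightarrow> real^'n \<Rightarrow> real^'n^'n \<Rightarrow> real) \<Rightarrow> real \<Rightarrow> bool" where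
  "strictly_increasing_in_r \<Omega> K M \<longleftrightarrow>
     (\<exists>C>0. \<forall>r s. \<forall>x\<in>closure \<Omega>. \<forall>p. \<forall>X\<in>sym_mats.
        - M \<le> s \<and> s \<le> r \<and> r \<le> M \<longrightarrow> K x r p X - K x s p X \<ge> C * (r - s))"

end

theory Submission
  imports Defs
begin

text \<open>
  Doubling of variables, with penalisation \<open>|z - w|\<^sup>2 / (2 \<epsilon>)\<close>, reduces the comparison principle to
  the theorem on sums: at a maximum point of the doubled function there are limiting second
  order jets \<open>(p, X)\<close> of \<open>u\<close> and \<open>(p, Y)\<close> of \<open>v\<close> whose matrices satisfy the block inequality of the
  structure conditions. That inequality and the Lipschitz bounds on \<open>\<sigma>\<close> and its derivatives show
  that the horizontal Hessian at \<open>w\<close> is at least the one at \<open>z\<close> minus \<open>O(|z - w|\<^sup>2 / \<epsilon>) I\<close>. Since the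
  Hessian at \<open>z\<close> is at least \<open>\<gamma> I\<close>, the logarithms of the determinants differ, in the relevant direction,
  by a quantity tending to zero, and strict monotonicity of \<open>K\<close> in \<open>r\<close> gives a contradiction.

  The theorem on sums is derived without Alexandrov's or Rademacher's theorem. The sup-convolution
  of \<open>u\<close> is replaced by a Lasry--Lions regularisation, which is differentiable with Lipschitz
  gradient \<open>p\<close> and agrees with the sup-convolution at the relevant points. For almost every \<open>x\<close> the blow-ups
  of \<open>p\<close> at \<open>x\<close> along the scales \<open>2\<^sup>-\<^sup>k\<close> are asymptotically linear, because the dyadic energies
  telescope. As the contact points of slightly tilted maximum problems have gradients
  filling a ball, some contact point admits a second order expansion on one small scale, and a
  small additional quadratic term turns it into an admissible test function.
\<close>

section \<open>Blow-ups of Lipschitz maps\<close>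

text \<open>A sup-convolution alone is only semiconvex, so its gradient need not exist everywhere.
  The second regularisation makes the gradient a Lipschitz map on the whole space. Such maps send
  null sets to null sets, so a contact set whose gradients fill a ball cannot avoid the set of full
  measure where the blow-ups behave well.

  Approximate linearity on one scale does not produce a second order jet at a given point. It
  suffices because every error is a multiple of one parameter tending to zero, the matrices stay
  bounded, and the viscosity inequalities survive limits of touching points and their jets.

  The lower bound \<gamma> is used twice. A supersolution may be tested only where the horizontal
  Hessian is positive definite, and the estimate carries this property from \<open>u\<close> to
  \<open>v\<close>. It also converts the additive error \<open>d\<close> into the factor 1 -
  d/\<gamma>, which controls the difference of the logarithms without any upper bound on the
  Hessians; these may blow up as the penalisation grows.\<close>

lemma sum_squares_average:
  fixes a b :: real
  shows "a\<^sup>2 + b\<^sup>2 = 2 * ((a + b)/2)\<^sup>2 + (b - a)\<^sup>2 / 2"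
  by (simp add: power2_eq_square field_simps)

lemma nn_integral_lborel_shift:
  fixes f :: "'a::euclidean_space \<Rightarrow> ennreal"
  assumes "f \<in> borel_measurable borel"
  shows "(\<integral>\<^sup>+x. f (x + c) \<partial>lborel) = (\<integral>\<^sup>+x. f x \<partial>lborel)"
proof -
  have "(\<integral>\<^sup>+x. f x \<partial>lborel) = (\<integral>\<^sup>+x. f x \<partial>distr lborel borel ((+) c))"
    by (simp add: lborel_distr_plus)
  also have "\<dots> = (\<integral>\<^sup>+x. f (c + x) \<partial>lborel)"
    by (rule nn_integral_distr) (use assms in auto)
  finally show ?thesis by (simp add: add.commute)
qed

definition second_quotient :: "('a::real_normed_vector \<Rightarrow> real) \<Rightarrow> 'a \<Rightarrow> 'a \<Rightarrow> 'a \<Rightarrow> nat \<Rightarrow> real" where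
  "second_quotient g x m e k =
     (g (x + (1/2)^k *\<^sub>R (m + 2 *\<^sub>R e)) - 2 * g (x + (1/2)^k *\<^sub>R (m + e)) + g (x + (1/2)^k *\<^sub>R m)) / (1/2)^k"

text \<open>The difference quotient at scale \<open>2 s\<close> is the average of two at scale \<open>s\<close>, so by the
  parallelogram identity the squared \<open>L\<^sup>2\<close>-norms increase as the scale is halved and the norms
  of the second differences have a finite sum of squares.\<close>

lemma dyadic_second_difference_AE:
  fixes g :: "'a::euclidean_space \<Rightarrow> real" and e m :: 'a
  assumes lip: "L-lipschitz_on UNIV g" and supp: "\<And>x. norm x > R \<Longrightarrow> g x = 0"
  shows "AE x in lborel. second_quotient g x m e \<longlonglongrightarrow> 0"
proof -
  define s where "s = (\<lambda>k::nat. (1/2::real)^k)"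
  have spos: "s k > 0" "s k \<le> 1" for k by (auto simp: s_def power_le_one)
  have s_Suc: "s k = 2 * s (Suc k)" for k by (simp add: s_def)
  have cont: "continuous_on UNIV g" using lip lipschitz_on_continuous_on by blast
  have gm[measurable]: "g \<in> borel_measurable borel"
    using cont by (rule borel_measurable_continuous_onI)
  define F where "F k x = (g (x + s k *\<^sub>R e) - g x) / s k" for k x
  define D where "D k x = F k (x + s k *\<^sub>R e) - F k x" for k x
  define I where "I k = (\<integral>\<^sup>+x. ennreal ((F k x)\<^sup>2) \<partial>lborel)" for k
  have Fm[measurable]: "F k \<in> borel_measurable borel" for k unfolding F_def by measurable
  have Dm[measurable]: "D k \<in> borel_measurable borel" for k unfolding D_def by measurable
  have avg: "F k x = (F (Suc k) x + F (Suc k) (x + s (Suc k) *\<^sub>R e)) / 2" for k x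
  proof -
    have "x + s k *\<^sub>R e = x + s (Suc k) *\<^sub>R e + s (Suc k) *\<^sub>R e"
      by (subst s_Suc) (simp add: scaleR_2 flip: scaleR_scaleR)
    then show ?thesis using spos(1)[of "Suc k"] by (simp add: F_def s_Suc[of k] field_simps)
  qed
  have en: "2 * I (Suc k) = 2 * I k + (\<integral>\<^sup>+x. ennreal ((D (Suc k) x)\<^sup>2 / 2) \<partial>lborel)" for k
  proof -
    let ?s = "s (Suc k)"
    have "I (Suc k) + I (Suc k) = I (Suc k) + (\<integral>\<^sup>+x. ennreal ((F (Suc k) (x + ?s *\<^sub>R e))\<^sup>2) \<partial>lborel)"
      unfolding I_def by (subst (2) nn_integral_lborel_shift[symmetric, of _ "?s *\<^sub>R e"]) auto
    also have "\<dots> = (\<integral>\<^sup>+x. ennreal ((F (Suc k) x)\<^sup>2) + ennreal ((F (Suc k) (x + ?s *\<^sub>R e))\<^sup>2) \<partial>lborel)"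
      unfolding I_def by (rule nn_integral_add[symmetric]) auto
    also have "\<dots> = (\<integral>\<^sup>+x. ennreal (2 * (F k x)\<^sup>2) + ennreal ((D (Suc k) x)\<^sup>2 / 2) \<partial>lborel)"
    proof (rule nn_integral_cong)
      fix x
      show "ennreal ((F (Suc k) x)\<^sup>2) + ennreal ((F (Suc k) (x + ?s *\<^sub>R e))\<^sup>2) = ennreal (2 * (F k x)\<^sup>2) + ennreal ((D (Suc k) x)\<^sup>2 / 2)"
        using sum_squares_average[of "F (Suc k) x" "F (Suc k) (x + ?s *\<^sub>R e)"]
        by (simp add: avg[of k x] D_def flip: ennreal_plus)
    qed
    also have "\<dots> = (\<integral>\<^sup>+x. ennreal (2 * (F k x)\<^sup>2) \<partial>lborel) + (\<integral>\<^sup>+x. ennreal ((D (Suc k) x)\<^sup>2 / 2) \<partial>lborel)"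
      by (rule nn_integral_add) auto
    also have "(\<integral>\<^sup>+x. ennreal (2 * (F k x)\<^sup>2) \<partial>lborel) = 2 * I k"
      unfolding I_def by (subst nn_integral_cmult[symmetric]) (auto simp: ennreal_mult)
    finally show ?thesis by (simp add: mult_2)
  qed
  \<comment> \<open>Since all scales are at most 1, every \<open>F k\<close> vanishes outside the
    ball of radius \<open>R + norm e\<close> and is at most \<open>L * norm e\<close> in absolute
    value. The energies are thus bounded independently of \<open>k\<close>.\<close>
  have bd: "2 * I k \<le> 2 * (ennreal ((L * norm e)\<^sup>2) * emeasure lborel (cball (0::'a) (R + norm e)))" for k
  proof -
    have "I k \<le> (\<integral>\<^sup>+x. ennreal ((L * norm e)\<^sup>2) * indicator (cball (0::'a) (R + norm e)) x \<partial>lborel)"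
      unfolding I_def
    proof (rule nn_integral_mono)
      fix x
      show "ennreal ((F k x)\<^sup>2) \<le> ennreal ((L * norm e)\<^sup>2) * indicator (cball (0::'a) (R + norm e)) x"
      proof (cases "norm x \<le> R + norm e")
        case True
        have "\<bar>g (x + s k *\<^sub>R e) - g x\<bar> \<le> L * norm (s k *\<^sub>R e)"
          using lipschitz_onD[OF lip, of "x + s k *\<^sub>R e" x] by (simp add: dist_norm)
        then have "\<bar>F k x\<bar> \<le> L * norm e" using spos(1)[of k]
          by (simp add: F_def field_simps)
        then have "(F k x)\<^sup>2 \<le> (L * norm e)\<^sup>2"
          by (metis abs_ge_zero power2_abs power_mono)
        then show ?thesis using True by (simp add: ennreal_leI)
      next
        case False
        have "norm (s k *\<^sub>R e) \<le> norm e" using spos[of k] by (simp add: mult_left_le_one_le)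
        then have "norm (x + s k *\<^sub>R e) > R"
          using False norm_triangle_ineq4[of "x + s k *\<^sub>R e" "s k *\<^sub>R e"] by simp
        moreover have "norm x > R" using False norm_ge_zero[of e] by linarith
        ultimately have "F k x = 0" by (simp add: F_def supp)
        then show ?thesis by simp
      qed
    qed
    also have "\<dots> = ennreal ((L * norm e)\<^sup>2) * emeasure lborel (cball (0::'a) (R + norm e))"
      by (subst nn_integral_cmult_indicator) auto
    finally show ?thesis by (rule mult_left_mono) simp
  qed
  have partial: "2 * I 0 + (\<Sum>k<n. (\<integral>\<^sup>+x. ennreal ((D (Suc k) x)\<^sup>2 / 2) \<partial>lborel)) = 2 * I n" for n
    by (induction n) (simp_all add: en add.assoc)
  have fin: "ennreal ((L * norm e)\<^sup>2) * emeasure lborel (cball (0::'a) (R + norm e)) < \<infinity>"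
    using emeasure_lborel_cball_finite[of "0::'a" "R + norm e"] by (simp add: ennreal_mult_less_top)
  \<comment> \<open>By translation invariance the offset \<open>m\<close> leaves the summable
    integrals unchanged, although it moves with the scale.\<close>
  have shift: "(\<integral>\<^sup>+x. ennreal ((D (Suc k) (x + s (Suc k) *\<^sub>R m))\<^sup>2 / 2) \<partial>lborel) = (\<integral>\<^sup>+x. ennreal ((D (Suc k) x)\<^sup>2 / 2) \<partial>lborel)" for k
    by (rule nn_integral_lborel_shift[where f="\<lambda>x. ennreal ((D (Suc k) x)\<^sup>2 / 2)"]) simp
  have "(\<integral>\<^sup>+x. (\<Sum>k. ennreal ((D (Suc k) (x + s (Suc k) *\<^sub>R m))\<^sup>2 / 2)) \<partial>lborel)
      = (\<Sum>k. \<integral>\<^sup>+x. ennreal ((D (Suc k) (x + s (Suc k) *\<^sub>R m))\<^sup>2 / 2) \<partial>lborel)"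
    by (rule nn_integral_suminf) simp
  also have "\<dots> \<le> 2 * (ennreal ((L * norm e)\<^sup>2) * emeasure lborel (cball (0::'a) (R + norm e)))"
    unfolding shift suminf_eq_SUP
  proof (rule SUP_least)
    fix n
    show "(\<Sum>k<n. (\<integral>\<^sup>+x. ennreal ((D (Suc k) x)\<^sup>2 / 2) \<partial>lborel)) \<le> 2 * (ennreal ((L * norm e)\<^sup>2) * emeasure lborel (cball (0::'a) (R + norm e)))"
      by (rule order_trans[OF _ bd[of n]]) (simp flip: partial[of n])
  qed
  also have "\<dots> < \<infinity>" using fin by (simp add: ennreal_mult_less_top)
  finally have "(\<integral>\<^sup>+x. (\<Sum>k. ennreal ((D (Suc k) (x + s (Suc k) *\<^sub>R m))\<^sup>2 / 2)) \<partial>lborel) \<noteq> \<infinity>" by simp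
  then have "AE x in lborel. (\<Sum>k. ennreal ((D (Suc k) (x + s (Suc k) *\<^sub>R m))\<^sup>2 / 2)) \<noteq> \<infinity>"
    by (intro nn_integral_noteq_infinite) auto
  then show ?thesis
  proof (rule AE_mp, intro AE_I2 impI)
    fix x assume "(\<Sum>k. ennreal ((D (Suc k) (x + s (Suc k) *\<^sub>R m))\<^sup>2 / 2)) \<noteq> \<infinity>"
    then have "summable (\<lambda>k. (D (Suc k) (x + s (Suc k) *\<^sub>R m))\<^sup>2 / 2)"
      by (intro summable_suminf_not_top) auto
    then have "(\<lambda>k. 2 * ((D (Suc k) (x + s (Suc k) *\<^sub>R m))\<^sup>2 / 2)) \<longlonglongrightarrow> 2 * 0"
      by (intro tendsto_mult_left summable_LIMSEQ_zero)
    then have "(\<lambda>k. sqrt ((D (Suc k) (x + s (Suc k) *\<^sub>R m))\<^sup>2)) \<longlonglongrightarrow> sqrt 0"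
      by (intro tendsto_real_sqrt) simp
    then have "(\<lambda>k. D (Suc k) (x + s (Suc k) *\<^sub>R m)) \<longlonglongrightarrow> 0"
      by (simp add: tendsto_rabs_zero_iff)
    then have "(\<lambda>k. D k (x + s k *\<^sub>R m)) \<longlonglongrightarrow> 0"
      by (rule LIMSEQ_imp_Suc)
    moreover have "D k (x + s k *\<^sub>R m) = second_quotient g x m e k" for k
    proof -
      have "x + s k *\<^sub>R (m + 2 *\<^sub>R e) = x + s k *\<^sub>R m + s k *\<^sub>R e + s k *\<^sub>R e"
        by (simp add: scaleR_2 algebra_simps)
      moreover have "x + s k *\<^sub>R (m + e) = x + s k *\<^sub>R m + s k *\<^sub>R e" by (simp add: algebra_simps)
      ultimately show ?thesis by (simp add: D_def F_def second_quotient_def s_def diff_divide_distrib[symmetric] add.assoc)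
    qed
    ultimately show "second_quotient g x m e \<longlonglongrightarrow> 0"
      by (simp flip: s_def)
  qed
qed

text \<open>Vanishing second differences give additivity in the limit, additivity gives homogeneity
  for rational factors, and the common Lipschitz constant extends it to real ones. A finite net of
  the unit ball then makes the convergence uniform.\<close>

lemma asymptotically_linear:
  fixes q :: "nat \<Rightarrow> 'a::euclidean_space \<Rightarrow> 'b::real_normed_vector"
  assumes lip: "\<And>k x y. norm (q k x - q k y) \<le> L * norm (x - y)" and q0: "\<And>k. q k 0 = 0"
    and second: "\<And>m e. (\<lambda>k. q k (m + 2 *\<^sub>R e) - 2 *\<^sub>R q k (m + e) + q k m) \<longlonglongrightarrow> 0"
    and "\<kappa> > 0"
  shows "\<forall>\<^sub>F k in sequentially. \<exists>T. linear T \<and> (\<forall>h\<in>cball 0 1. norm (q k h - T h) \<le> \<kappa>)"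
proof -
  obtain b0 :: 'a where "b0 \<in> Basis" using nonempty_Basis by blast
  then have L0: "L \<ge> 0"
    using order_trans[OF norm_ge_zero lip[of undefined b0 0]] by simp
  \<comment> \<open>The second differences over \<open>0, (a+b)/2, a+b\<close> and over
    \<open>a, (a+b)/2, b\<close> share the midpoint, which cancels when they are subtracted.\<close>
  have add: "(\<lambda>k. q k (a + b) - (q k a + q k b)) \<longlonglongrightarrow> 0" for a b
  proof -
    have *: "a + 2 *\<^sub>R ((1/2) *\<^sub>R (b - a)) = b" "a + (1/2) *\<^sub>R (b - a) = (1/2) *\<^sub>R (a + b)"
      by (simp_all add: algebra_simps flip: scaleR_add_left)
    show ?thesis
      using tendsto_diff[OF second[of 0 "(1/2) *\<^sub>R (a + b)"] second[of a "(1/2) *\<^sub>R (b - a)"], unfolded *]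
      by (simp add: q0 algebra_simps)
  qed
  define P where "P c \<longleftrightarrow> (\<forall>b. (\<lambda>k. q k (c *\<^sub>R b) - c *\<^sub>R q k b) \<longlonglongrightarrow> 0)" for c
  have P0: "P (real n)" for n
  proof (induction n)
    case 0 then show ?case by (simp add: P_def q0)
  next
    case (Suc n)
    show ?case unfolding P_def
    proof
      fix b
      have "(\<lambda>k. (q k (b + real n *\<^sub>R b) - (q k b + q k (real n *\<^sub>R b))) + (q k (real n *\<^sub>R b) - real n *\<^sub>R q k b)) \<longlonglongrightarrow> 0 + 0"
        using Suc by (intro tendsto_add add) (auto simp: P_def)
      then show "(\<lambda>k. q k (real (Suc n) *\<^sub>R b) - real (Suc n) *\<^sub>R q k b) \<longlonglongrightarrow> 0"
        by (simp add: algebra_simps)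
    qed
  qed
  have Pneg: "P (-c)" if "P c" for c
    unfolding P_def
  proof
    fix b
    have "(\<lambda>k. - (q k (c *\<^sub>R b + (-c) *\<^sub>R b) - (q k (c *\<^sub>R b) + q k ((-c) *\<^sub>R b))) - (q k (c *\<^sub>R b) - c *\<^sub>R q k b)) \<longlonglongrightarrow> - 0 - 0"
      using that by (intro tendsto_diff tendsto_minus add) (auto simp: P_def)
    then show "(\<lambda>k. q k (-c *\<^sub>R b) - (-c) *\<^sub>R q k b) \<longlonglongrightarrow> 0"
      by (simp add: algebra_simps q0)
  qed
  have Pint: "P (of_int i)" for i
    using P0 Pneg[OF P0] by (cases i rule: int_cases2) (simp_all)
  have Pdiv: "P (of_int i / real n)" if "n > 0" for i n
    unfolding P_def
  proof
    fix b
    let ?c = "of_int i / real n"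
    have "(\<lambda>k. (1 / real n) *\<^sub>R ((q k (of_int i *\<^sub>R b) - of_int i *\<^sub>R q k b) - (q k (real n *\<^sub>R (?c *\<^sub>R b)) - real n *\<^sub>R q k (?c *\<^sub>R b)))) \<longlonglongrightarrow> (1 / real n) *\<^sub>R (0 - 0)"
      using Pint[of i] P0[of n] by (intro tendsto_scaleR tendsto_const tendsto_diff) (auto simp only: P_def)
    then show "(\<lambda>k. q k (?c *\<^sub>R b) - ?c *\<^sub>R q k b) \<longlonglongrightarrow> 0"
      using that by (simp add: algebra_simps)
  qed
  have P: "P c" for c
    unfolding P_def
  proof
    fix b
    show "(\<lambda>k. q k (c *\<^sub>R b) - c *\<^sub>R q k b) \<longlonglongrightarrow> 0"
    proof (rule LIMSEQ_I, goal_cases)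
      case (1 r)
      \<comment> \<open>Replacing \<open>c\<close> by a fraction with denominator \<open>n\<close>
        costs at most \<open>L * norm b / n\<close> in the argument of \<open>q k\<close> and as
        much in the scalar factor. This choice of \<open>n\<close> makes the sum smaller than
        r/2.\<close>
      obtain n :: nat where n: "real n > 4 * L * norm b / r + 1" using reals_Archimedean2 by blast
      have "4 * L * norm b / r \<ge> 0" using L0 1 by simp
      then have n0: "n > 0" using n by linarith
      let ?d = "of_int \<lfloor>c * real n\<rfloor> / real n"
      have cd: "\<bar>c - ?d\<bar> \<le> 1 / real n"
      proof -
        have "\<bar>c * real n - of_int \<lfloor>c * real n\<rfloor>\<bar> \<le> 1" by linarith
        moreover have "c - ?d = (c * real n - of_int \<lfloor>c * real n\<rfloor>) / real n" using n0 by (simp add: field_simps)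
        ultimately show ?thesis using n0 by (simp add: abs_divide divide_right_mono)
      qed
      have sm: "2 * L * (1 / real n) * norm b < r/2"
      proof -
        have "4 * L * norm b / r < real n" using n by linarith
        then have "4 * L * norm b < real n * r" using 1 by (simp add: field_simps)
        then show ?thesis using n0 by (simp add: field_simps)
      qed
      have "(\<lambda>k. q k (?d *\<^sub>R b) - ?d *\<^sub>R q k b) \<longlonglongrightarrow> 0" using Pdiv[OF n0] by (auto simp: P_def)
      then obtain N where N: "\<And>k. k \<ge> N \<Longrightarrow> norm (q k (?d *\<^sub>R b) - ?d *\<^sub>R q k b) < r/2"
        using LIMSEQ_D[of _ 0 "r/2"] 1 by auto
      show ?case
      proof (intro exI allI impI)
        fix k assume "N \<le> k"
        have "q k (c *\<^sub>R b) - c *\<^sub>R q k b = (q k (?d *\<^sub>R b) - ?d *\<^sub>R q k b) + (q k (c *\<^sub>R b) - q k (?d *\<^sub>R b)) - (c - ?d) *\<^sub>R q k b"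
          by (simp add: algebra_simps)
        also have "norm \<dots> \<le> norm (q k (?d *\<^sub>R b) - ?d *\<^sub>R q k b) + norm (q k (c *\<^sub>R b) - q k (?d *\<^sub>R b)) + norm ((c - ?d) *\<^sub>R q k b)"
          by (meson norm_triangle_ineq norm_triangle_ineq4 order_trans add_right_mono)
        also have "norm (q k (c *\<^sub>R b) - q k (?d *\<^sub>R b)) \<le> L * (\<bar>c - ?d\<bar> * norm b)"
          using lip[of k "c *\<^sub>R b" "?d *\<^sub>R b"] by (simp flip: scaleR_diff_left)
        also have "\<dots> \<le> L * (1 / real n * norm b)"
          using cd L0 by (intro mult_left_mono mult_right_mono) auto
        also have "norm ((c - ?d) *\<^sub>R q k b) \<le> (1 / real n) * (L * norm b)"
          unfolding norm_scaleR using cd lip[of k b 0] by (intro mult_mono) (auto simp: q0)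
        finally show "norm (q k (c *\<^sub>R b) - c *\<^sub>R q k b - 0) < r"
          using N[OF \<open>N \<le> k\<close>] sm by simp
      qed
    qed
  qed
  \<comment> \<open>The linear map that agrees with \<open>q k\<close> on the standard basis. The
    sequence \<open>q k\<close> need not converge, so \<open>T\<close> varies with
    \<open>k\<close>.\<close>
  define T where "T k h = (\<Sum>i\<in>Basis. (h \<bullet> i) *\<^sub>R q k i)" for k h
  have linT: "linear (T k)" for k
    unfolding T_def by (intro linearI) (simp_all add: inner_add_left scaleR_add_left sum.distrib scaleR_sum_right)
  have sumadd: "(\<lambda>k. q k (\<Sum>i\<in>A. v i) - (\<Sum>i\<in>A. q k (v i))) \<longlonglongrightarrow> 0" if "finite A" for A :: "'a set" and v
    using that
  proof (induction A rule: finite_induct)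
    case empty then show ?case by (simp add: q0)
  next
    case (insert i A)
    have "(\<lambda>k. (q k (v i + (\<Sum>i\<in>A. v i)) - (q k (v i) + q k (\<Sum>i\<in>A. v i))) + (q k (\<Sum>i\<in>A. v i) - (\<Sum>i\<in>A. q k (v i)))) \<longlonglongrightarrow> 0 + 0"
      by (intro tendsto_add add insert)
    then show ?case using insert by (simp add: algebra_simps)
  qed
  have pw: "(\<lambda>k. q k h - T k h) \<longlonglongrightarrow> 0" for h
  proof -
    have "(\<lambda>k. (q k (\<Sum>i\<in>Basis. (h \<bullet> i) *\<^sub>R i) - (\<Sum>i\<in>Basis. q k ((h \<bullet> i) *\<^sub>R i))) + (\<Sum>i\<in>Basis. q k ((h \<bullet> i) *\<^sub>R i) - (h \<bullet> i) *\<^sub>R q k i)) \<longlonglongrightarrow> 0 + (\<Sum>i\<in>(Basis::'a set). 0)"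
      using P by (intro tendsto_add sumadd tendsto_sum) (auto simp: P_def)
    then show ?thesis by (simp add: T_def euclidean_representation sum_subtractf)
  qed
  define L' where "L' = L + real DIM('a) * L"
  have L'0: "L' \<ge> 0" using L0 by (simp add: L'_def)
  have lip': "norm ((q k x - T k x) - (q k y - T k y)) \<le> L' * norm (x - y)" for k x y
  proof -
    have "norm (T k x - T k y) = norm (T k (x - y))" using linT by (simp add: linear_diff)
    also have "\<dots> \<le> (\<Sum>i\<in>(Basis::'a set). norm (x - y) * L)"
      unfolding T_def
    proof (rule sum_norm_le)
      fix i :: 'a assume i: "i \<in> Basis"
      have "norm (q k i) \<le> L" using lip[of k i 0] i by (simp add: q0)
      then show "norm (((x - y) \<bullet> i) *\<^sub>R q k i) \<le> norm (x - y) * L"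
        unfolding norm_scaleR using Basis_le_norm[OF i] by (intro mult_mono) auto
    qed
    finally have "norm (T k x - T k y) \<le> real DIM('a) * L * norm (x - y)" by (simp add: mult_ac)
    moreover have "norm ((q k x - T k x) - (q k y - T k y)) \<le> norm (q k x - q k y) + norm (T k x - T k y)"
      using norm_triangle_ineq4[of "q k x - q k y" "T k x - T k y"] by (simp add: algebra_simps)
    ultimately show ?thesis using lip[of k x y] by (simp add: L'_def algebra_simps)
  qed
  \<comment> \<open>Mesh of the net: the error \<open>q k - T k\<close> has Lipschitz constant
    \<open>L'\<close>, so between a point and the net it changes by at most \<kappa>/2.\<close>
  define d where "d = \<kappa> / (2 * (L' + 1))"
  have d: "d > 0" "L' * d \<le> \<kappa>/2" using \<open>\<kappa> > 0\<close> L'0 by (auto simp: d_def field_simps)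
  obtain N where N: "finite N" "cball (0::'a) 1 \<subseteq> (\<Union>x\<in>N. ball x d)"
    using compact_imp_seq_compact[OF compact_cball, THEN seq_compact_imp_totally_bounded, of "0::'a" 1] d by metis
  have "\<forall>\<^sub>F k in sequentially. \<forall>x\<in>N. norm (q k x - T k x) < \<kappa>/2"
  proof (rule eventually_ball_finite[OF N(1)], rule ballI)
    fix x
    show "\<forall>\<^sub>F k in sequentially. norm (q k x - T k x) < \<kappa>/2"
      using tendstoD[OF pw[of x], of "\<kappa>/2"] \<open>\<kappa> > 0\<close> by simp
  qed
  then show ?thesis
  proof eventually_elim
    case (elim k)
    show ?case
    proof (intro exI[of _ "T k"] conjI linT ballI)
      fix h :: 'a assume "h \<in> cball 0 1"
      then obtain x where x: "x \<in> N" "norm (h - x) < d" using N by (auto simp: dist_norm norm_minus_commute)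
      have "norm (q k h - T k h) \<le> norm (q k x - T k x) + norm ((q k h - T k h) - (q k x - T k x))"
        by (rule norm_triangle_sub)
      also have "norm ((q k h - T k h) - (q k x - T k x)) \<le> L' * d"
        using lip'[of k h x] x L'0 by (meson less_imp_le mult_left_mono order_trans)
      finally show "norm (q k h - T k h) \<le> \<kappa>" using elim x d by force
    qed
  qed
qed

text \<open>Localisation: \<open>g\<close> is clipped between plus and minus a tent function of
  bounded support. Linear growth of \<open>g\<close> keeps the tent \<open>\<phi> N\<close> above
  |g| on the ball of radius \<open>N\<close>, so nothing is clipped there. Countably many
  \<open>N\<close> share one null set, and near any point one of the clipped functions equals
  \<open>g\<close>.\<close>

lemma lipschitz_second_difference_AE:
  fixes g :: "'a::euclidean_space \<Rightarrow> real" and m e :: 'a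
  assumes lip: "\<And>x y. \<bar>g x - g y\<bar> \<le> L * norm (x - y)"
  shows "AE x in lborel. second_quotient g x m e \<longlonglongrightarrow> 0"
proof -
  obtain b0 :: 'a where "b0 \<in> Basis" using nonempty_Basis by blast
  then have L0: "L \<ge> 0"
    using order_trans[OF abs_ge_zero lip[of b0 0]] by simp
  define \<phi> where "\<phi> N x = max 0 (\<bar>g 0\<bar> + (L + 1) * real N - norm x)" for N and x :: 'a
  define G where "G N x = max (- \<phi> N x) (min (\<phi> N x) (g x))" for N x
  have \<phi>lip: "\<bar>\<phi> N x - \<phi> N y\<bar> \<le> norm (x - y)" for N x y
    using norm_triangle_ineq2[of x y] norm_triangle_ineq2[of y x] by (auto simp: \<phi>_def max_def norm_minus_commute abs_le_iff)
  have Glip: "(L+1)-lipschitz_on UNIV (G N)" for N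
  proof (rule lipschitz_onI)
    fix x y :: 'a
    have "L * norm (x - y) \<le> (L + 1) * norm (x - y)" "norm (x - y) \<le> (L + 1) * norm (x - y)"
      using mult_nonneg_nonneg[OF L0 norm_ge_zero[of "x - y"]] by (simp_all add: distrib_right)
    then have "\<bar>\<phi> N x - \<phi> N y\<bar> \<le> (L + 1) * norm (x - y)" "\<bar>g x - g y\<bar> \<le> (L + 1) * norm (x - y)"
      using \<phi>lip[of N x y] lip[of x y] by linarith+
    then show "dist (G N x) (G N y) \<le> (L + 1) * dist x y"
      unfolding dist_norm G_def by (auto simp: max_def min_def)
  qed (use L0 in simp)
  have "AE x in lborel. \<forall>N. second_quotient (G N) x m e \<longlonglongrightarrow> 0"
    unfolding AE_all_countable
  proof
    fix N :: nat
    have "G N x = 0" if "norm x > \<bar>g 0\<bar> + (L + 1) * real N" for x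
      using that by (simp add: G_def \<phi>_def)
    from dyadic_second_difference_AE[OF Glip this]
    show "AE x in lborel. second_quotient (G N) x m e \<longlonglongrightarrow> 0"
      by blast
  qed
  then show ?thesis
  proof (rule AE_mp, intro AE_I2 impI)
    fix x :: 'a
    assume A: "\<forall>N. second_quotient (G N) x m e \<longlonglongrightarrow> 0"
    obtain N :: nat where N: "norm x < real N" using reals_Archimedean2 by blast
    have Geq: "G N y = g y" if "norm y < real N" for y
    proof -
      have "\<bar>g y\<bar> \<le> \<bar>g 0\<bar> + L * real N"
        using lip[of y 0] that L0 mult_left_mono[of "norm y" "real N" L] by simp
      moreover have "\<phi> N y \<ge> \<bar>g 0\<bar> + L * real N" using that by (simp add: \<phi>_def algebra_simps)
      ultimately show ?thesis by (auto simp: G_def)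
    qed
    have ev: "\<forall>\<^sub>F k in sequentially. norm (x + (1/2)^k *\<^sub>R v) < real N" for v
    proof -
      have "(\<lambda>k. x + (1/2)^k *\<^sub>R v) \<longlonglongrightarrow> x + 0 *\<^sub>R v"
        by (intro tendsto_intros LIMSEQ_realpow_zero) auto
      from order_tendstoD(2)[OF tendsto_norm[OF this]] N show ?thesis by simp
    qed
    have "\<forall>\<^sub>F k in sequentially. second_quotient (G N) x m e k = second_quotient g x m e k"
      using ev[of "m + 2 *\<^sub>R e"] ev[of "m + e"] ev[of m] by eventually_elim (simp add: Geq second_quotient_def)
    then show "second_quotient g x m e \<longlonglongrightarrow> 0"
      by (rule Lim_transform_eventually[OF spec[OF A]])
  qed
qed

text \<open>The exceptional null set of a second difference depends on \<open>m\<close> and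
  \<open>e\<close>. A countable dense set of directions gives a common one, and the Lipschitz
  dependence of the rescaled second difference on \<open>m\<close> and \<open>e\<close> recovers all
  directions. Since \<open>T\<close> may change with \<open>k\<close>, this is weaker than
  differentiability of \<open>p\<close>.\<close>

theorem lipschitz_dyadic_affine_AE:
  fixes p :: "'a::euclidean_space \<Rightarrow> 'b::euclidean_space"
  assumes lip: "\<And>x y. norm (p x - p y) \<le> L * norm (x - y)"
  shows "AE x in lborel. \<forall>\<kappa>>0. \<forall>\<^sub>F k in sequentially.
     \<exists>T. linear T \<and> (\<forall>h. norm h \<le> (1/2)^k \<longrightarrow> norm (p (x + h) - p x - T h) \<le> \<kappa> * (1/2)^k)"
proof -
  define s where "s = (\<lambda>k::nat. (1/2::real)^k)"
  have spos: "s k > 0" for k by (simp add: s_def)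
  obtain b0 :: 'a where "b0 \<in> Basis" using nonempty_Basis by blast
  then have L0: "L \<ge> 0"
    using order_trans[OF norm_ge_zero lip[of b0 0]] by simp
  obtain D :: "'a set" where D: "countable D" "\<And>X. open X \<Longrightarrow> X \<noteq> {} \<Longrightarrow> \<exists>d\<in>D. d \<in> X"
    using countable_dense_setE by (metis empty_iff)
  define Q where "Q x k h = (1 / s k) *\<^sub>R (p (x + s k *\<^sub>R h) - p x)" for x k h
  have Qlip: "norm (Q x k y - Q x k z) \<le> L * norm (y - z)" for x k y z
  proof -
    have "Q x k y - Q x k z = (1 / s k) *\<^sub>R (p (x + s k *\<^sub>R y) - p (x + s k *\<^sub>R z))"
      by (simp add: Q_def algebra_simps)
    also have "norm \<dots> \<le> (1 / s k) * (L * norm (s k *\<^sub>R y - s k *\<^sub>R z))"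
      using lip[of "x + s k *\<^sub>R y" "x + s k *\<^sub>R z"] spos[of k] by (simp add: divide_right_mono)
    also have "\<dots> = L * norm (y - z)"
      using spos[of k] by (simp flip: scaleR_diff_right)
    finally show ?thesis .
  qed
  have comp: "\<bar>p x \<bullet> b - p y \<bullet> b\<bar> \<le> L * norm (x - y)" if "b \<in> Basis" for b x y
    using Basis_le_norm[OF that, of "p x - p y"] lip[of x y] by (simp add: inner_diff_left)
  have "AE x in lborel. \<forall>m\<in>D. \<forall>e\<in>D. \<forall>b\<in>Basis. second_quotient (\<lambda>x. p x \<bullet> b) x m e \<longlonglongrightarrow> 0"
    using D(1) lipschitz_second_difference_AE[OF comp]
    by (intro AE_ball_countable' countable_finite[OF finite_Basis]) auto
  then show ?thesis
  proof (rule AE_mp, intro AE_I2 impI allI)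
    fix x :: 'a and \<kappa> :: real
    assume A: "\<forall>m\<in>D. \<forall>e\<in>D. \<forall>b\<in>Basis. second_quotient (\<lambda>x. p x \<bullet> b) x m e \<longlonglongrightarrow> 0"
      and "\<kappa> > 0"
    define q where "q = Q x"
    define E where "E k m e = q k (m + 2 *\<^sub>R e) - 2 *\<^sub>R q k (m + e) + q k m" for k m e
    have ED: "(\<lambda>k. E k m e) \<longlonglongrightarrow> 0" if "m \<in> D" "e \<in> D" for m e
    proof -
      have "E k m e \<bullet> b = second_quotient (\<lambda>x. p x \<bullet> b) x m e k" for k b
        using spos[of k] by (simp add: E_def q_def Q_def second_quotient_def inner_add_left inner_diff_left field_simps flip: s_def)
      then show ?thesis
        using A that by (subst tendsto_componentwise_iff) auto
    qed
    have Elip: "norm (E k m e - E k m' e') \<le> L * (4 * norm (m - m') + 4 * norm (e - e'))" for k m e m' e'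
    proof -
      have "E k m e - E k m' e' = (q k (m + 2 *\<^sub>R e) - q k (m' + 2 *\<^sub>R e')) - 2 *\<^sub>R (q k (m + e) - q k (m' + e')) + (q k m - q k m')"
        by (simp add: E_def algebra_simps)
      also have "norm \<dots> \<le> norm (q k (m + 2 *\<^sub>R e) - q k (m' + 2 *\<^sub>R e')) + 2 * norm (q k (m + e) - q k (m' + e')) + norm (q k m - q k m')"
        by norm
      also have "\<dots> \<le> L * norm ((m + 2 *\<^sub>R e) - (m' + 2 *\<^sub>R e')) + 2 * (L * norm ((m + e) - (m' + e'))) + L * norm (m - m')"
        unfolding q_def by (intro add_mono mult_left_mono Qlip) auto
      also have "\<dots> = L * (norm ((m + 2 *\<^sub>R e) - (m' + 2 *\<^sub>R e')) + 2 * norm ((m + e) - (m' + e')) + norm (m - m'))"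
        by (simp add: algebra_simps)
      also have "\<dots> \<le> L * (4 * norm (m - m') + 4 * norm (e - e'))"
      proof (rule mult_left_mono[OF _ L0])
        have "norm ((m + 2 *\<^sub>R e) - (m' + 2 *\<^sub>R e')) \<le> norm (m - m') + 2 * norm (e - e')"
          using norm_triangle_ineq[of "m - m'" "2 *\<^sub>R (e - e')"] unfolding norm_scaleR by (simp add: algebra_simps)
        moreover have "norm ((m + e) - (m' + e')) \<le> norm (m - m') + norm (e - e')"
          using norm_triangle_ineq[of "m - m'" "e - e'"] by (simp add: algebra_simps)
        ultimately show "norm ((m + 2 *\<^sub>R e) - (m' + 2 *\<^sub>R e')) + 2 * norm ((m + e) - (m' + e')) + norm (m - m') \<le> 4 * norm (m - m') + 4 * norm (e - e')"
          by simp
      qed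
      finally show ?thesis .
    qed
    have E0: "(\<lambda>k. E k m e) \<longlonglongrightarrow> 0" for m e
    proof (rule LIMSEQ_I, goal_cases)
      case (1 r)
      define d where "d = r / (16 * (L + 1))"
      have d: "d > 0" "L * (8 * d) \<le> r/2" using 1 L0 by (auto simp: d_def field_simps)
      obtain m' where m': "m' \<in> D" "norm (m - m') < d"
        using D(2)[of "ball m d"] d by (auto simp: dist_norm)
      obtain e' where e': "e' \<in> D" "norm (e - e') < d"
        using D(2)[of "ball e d"] d by (auto simp: dist_norm)
      obtain N where N: "\<And>k. k \<ge> N \<Longrightarrow> norm (E k m' e') < r/2"
        using LIMSEQ_D[OF ED[OF m'(1) e'(1)], of "r/2"] 1 by auto
      show ?case
      proof (intro exI allI impI)
        fix k assume "N \<le> k"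
        have "norm (E k m e) \<le> norm (E k m' e') + norm (E k m e - E k m' e')" by (rule norm_triangle_sub)
        also have "norm (E k m e - E k m' e') \<le> L * (8 * d)"
          by (rule order_trans[OF Elip mult_left_mono[OF _ L0]]) (use m' e' in simp)
        finally show "norm (E k m e - 0) < r" using N[OF \<open>N \<le> k\<close>] d by simp
      qed
    qed
    have "\<forall>\<^sub>F k in sequentially. \<exists>T. linear T \<and> (\<forall>h\<in>cball 0 1. norm (q k h - T h) \<le> \<kappa>)"
      using E0 \<open>\<kappa> > 0\<close> unfolding E_def
      by (intro asymptotically_linear[where L=L]) (auto simp: q_def Qlip, simp add: Q_def)
    then show "\<forall>\<^sub>F k in sequentially. \<exists>T. linear T \<and> (\<forall>h. norm h \<le> (1/2)^k \<longrightarrow> norm (p (x + h) - p x - T h) \<le> \<kappa> * (1/2)^k)"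
    proof eventually_elim
      case (elim k)
      then obtain T where T: "linear T" "\<And>h. norm h \<le> 1 \<Longrightarrow> norm (q k h - T h) \<le> \<kappa>" by auto
      show ?case
      proof (intro exI[of _ T] conjI T(1) allI impI)
        fix h :: 'a assume "norm h \<le> (1/2)^k"
        then have "norm ((1 / s k) *\<^sub>R h) \<le> 1" using spos[of k] by (simp add: s_def field_simps)
        note T(2)[OF this]
        moreover have "p (x + h) - p x - T h = s k *\<^sub>R (q k ((1 / s k) *\<^sub>R h) - T ((1 / s k) *\<^sub>R h))"
          using spos[of k] T(1) by (simp add: q_def Q_def linear_scale scaleR_diff_right)
        ultimately show "norm (p (x + h) - p x - T h) \<le> \<kappa> * (1/2)^k"
          using spos[of k] by (simp add: s_def mult.commute)
      qed
    qed
  qed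
qed

section \<open>Functions with quadratic bounds on both sides\<close>

lemmas inner_expand = inner_add_left inner_add_right inner_diff_left inner_diff_right inner_commute algebra_simps

text \<open>Equivalently, \<open>f\<close> is differentiable with gradient \<open>p\<close> and \<open>p\<close> is Lipschitz.\<close>

definition quad_bounded :: "real \<Rightarrow> ('a::real_inner \<Rightarrow> real) \<Rightarrow> ('a \<Rightarrow> 'a) \<Rightarrow> bool" where
  "quad_bounded c f p \<longleftrightarrow> (\<forall>x h. \<bar>f (x + h) - f x - p x \<bullet> h\<bar> \<le> c * (norm h)\<^sup>2)"

lemma quad_bounded_nonneg:
  fixes f :: "'a::euclidean_space \<Rightarrow> real"
  assumes "quad_bounded c f p" shows "c \<ge> 0"
proof -
  obtain b :: 'a where "b \<in> Basis" using nonempty_Basis by blast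
  then show ?thesis using assms[unfolded quad_bounded_def, rule_format, of 0 b] by simp
qed

lemma inner_le_quadratic_imp_zero:
  fixes v :: "'a::real_inner"
  assumes "\<And>h. v \<bullet> h \<le> c * (norm h)\<^sup>2" shows "v = 0"
proof (rule ccontr)
  assume "v \<noteq> 0"
  \<comment> \<open>Small enough that |c| t < 1: along \<open>t *\<^sub>R v\<close> the linear term
    then beats the quadratic one.\<close>
  define t where "t = 1 / (2 * (\<bar>c\<bar> + 1))"
  have t: "t > 0" "\<bar>c\<bar> * t < 1" by (auto simp: t_def field_simps)
  have "t * (norm v)\<^sup>2 \<le> c * (t * norm v)\<^sup>2"
    using assms[of "t *\<^sub>R v"] t by (simp add: power2_norm_eq_inner)
  also have "\<dots> \<le> (\<bar>c\<bar> * t) * (t * (norm v)\<^sup>2)"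
    using mult_right_mono[OF abs_ge_self[of c] zero_le_power2[of "t * norm v"]]
    by (simp add: power2_eq_square mult_ac)
  finally have "1 * (t * (norm v)\<^sup>2) \<le> (\<bar>c\<bar> * t) * (t * (norm v)\<^sup>2)" by simp
  moreover have "t * (norm v)\<^sup>2 > 0" using t \<open>v \<noteq> 0\<close> by simp
  ultimately show False using t(2) by (simp only: mult_le_cancel_right_pos)
qed

text \<open>With \<open>h = x - y\<close>, let \<open>k\<close> point along \<open>p x - p y\<close>
  and have the length of \<open>h\<close>. The increment \<open>h + k\<close> from \<open>y\<close>
  is compared with \<open>h\<close> from \<open>y\<close> followed by \<open>k\<close> from
  \<open>x\<close>. The three remainders contribute 4 + 1 + 1 times
  \<open>c * (norm h)\<^sup>2\<close>.\<close>

lemma quad_bounded_lipschitz: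
  fixes f :: "'a::euclidean_space \<Rightarrow> real"
  assumes "quad_bounded c f p"
  shows "norm (p x - p y) \<le> 6 * c * norm (x - y)"
proof (cases "p x = p y")
  case True then show ?thesis using quad_bounded_nonneg[OF assms] by simp
next
  case False
  define h where "h = x - y"
  define k where "k = (norm h / norm (p x - p y)) *\<^sub>R (p x - p y)"
  have Q: "\<bar>f (z + h) - f z - p z \<bullet> h\<bar> \<le> c * (norm h)\<^sup>2" for z h
    using assms by (simp add: quad_bounded_def)
  have xy: "x = y + h" by (simp add: h_def)
  have h0: "h \<noteq> 0" using False xy by auto
  have nk: "norm k = norm h" using False by (simp add: k_def)
  have nhk: "(norm (h + k))\<^sup>2 \<le> 4 * (norm h)\<^sup>2"
  proof -
    have "norm (h + k) \<le> 2 * norm h" using norm_triangle_ineq[of h k] nk by simp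
    then have "(norm (h + k))\<^sup>2 \<le> (2 * norm h)\<^sup>2" by (intro power_mono) auto
    then show ?thesis by (simp add: power_mult_distrib)
  qed
  have "(p x - p y) \<bullet> k \<le> c * (norm (h + k))\<^sup>2 + c * (norm h)\<^sup>2 + c * (norm k)\<^sup>2"
    using Q[of y "h + k"] Q[of y h] Q[of "y + h" k]
    by (simp add: xy inner_add_right inner_diff_left add.assoc abs_le_iff)
  also have "\<dots> \<le> c * (4 * (norm h)\<^sup>2) + c * (norm h)\<^sup>2 + c * (norm h)\<^sup>2"
    using nhk quad_bounded_nonneg[OF assms] by (intro add_mono mult_left_mono) (auto simp: nk)
  finally have "(p x - p y) \<bullet> k \<le> 6 * c * (norm h)\<^sup>2" by simp
  moreover have "(p x - p y) \<bullet> k = norm h * norm (p x - p y)"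
    using False by (simp add: k_def power2_norm_eq_inner[symmetric] power2_eq_square)
  ultimately have "norm h * norm (p x - p y) \<le> norm h * (6 * c * norm h)"
    by (simp add: power2_eq_square mult_ac)
  then show ?thesis using h0 by (simp add: h_def)
qed

lemma quad_bounded_has_derivative:
  fixes f :: "'a::euclidean_space \<Rightarrow> real"
  assumes "quad_bounded c f p"
  shows "(f has_derivative (\<lambda>h. p x \<bullet> h)) (at x)"
proof -
  have c0: "c \<ge> 0" by (rule quad_bounded_nonneg[OF assms])
  have "(\<lambda>h. norm (f (x + h) - f x - p x \<bullet> h) / norm h) \<midarrow>0\<rightarrow> 0"
  proof (rule Lim_null_comparison[where g="\<lambda>h. c * norm h"])
    show "\<forall>\<^sub>F h in at 0. norm (norm (f (x + h) - f x - p x \<bullet> h) / norm h) \<le> c * norm h"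
    proof (intro always_eventually allI)
      fix h :: 'a
      have "\<bar>f (x + h) - f x - p x \<bullet> h\<bar> \<le> c * (norm h)\<^sup>2"
        using assms by (simp add: quad_bounded_def)
      then show "norm (norm (f (x + h) - f x - p x \<bullet> h) / norm h) \<le> c * norm h"
        using c0 by (cases "h = 0") (auto simp: divide_simps power2_eq_square)
    qed
    have "((\<lambda>h::'a. c * norm h) \<longlongrightarrow> c * norm (0::'a)) (at 0)"
      by (intro tendsto_mult_left tendsto_norm tendsto_ident_at)
    then show "((\<lambda>h::'a. c * norm h) \<longlongrightarrow> 0) (at 0)" by simp
  qed
  then show ?thesis unfolding has_derivative_at by (simp add: bounded_linear_inner_right)
qed

text \<open>The origin is a convex combination of \<open>h\<close> and
  \<open>- t *\<^sub>R h\<close>. Convexity bounds \<open>k h\<close> from below by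
  \<open>- k (- t *\<^sub>R h) / t\<close>, hence by a multiple of -t, and t tends to 0.\<close>

lemma convex_touched_above_imp_touched_below:
  fixes k :: "'a::real_normed_vector \<Rightarrow> real"
  assumes cv: "convex_on UNIV k" and "k 0 = 0" and up: "\<And>h. k h \<le> C * (norm h)\<^sup>2"
  shows "0 \<le> k h"
proof -
  have ev: "- (C * (norm h)\<^sup>2) * t \<le> k h" if t: "t > 0" for t
  proof -
    have "k ((1 - t/(1+t)) *\<^sub>R (- t *\<^sub>R h) + (t/(1+t)) *\<^sub>R h) \<le> (1 - t/(1+t)) * k (- t *\<^sub>R h) + t/(1+t) * k h"
      using t by (intro convex_onD[OF cv]) auto
    moreover have "(1 - t/(1+t)) *\<^sub>R (- t *\<^sub>R h) + (t/(1+t)) *\<^sub>R h = 0"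
    proof -
      have "- ((1 - t/(1+t)) * t) + t/(1+t) = 0" using t by (simp add: field_simps)
      then show ?thesis by (simp flip: scaleR_add_left)
    qed
    ultimately have "0 \<le> (1 - t/(1+t)) * k (- t *\<^sub>R h) + t/(1+t) * k h"
      using assms(2) by (simp only:)
    also have "\<dots> = (k (- t *\<^sub>R h) + t * k h) / (1 + t)"
    proof -
      have "1 - t/(1+t) = 1/(1+t)" using t by (simp add: field_simps)
      then show ?thesis by (simp add: add_divide_distrib)
    qed
    finally have "0 \<le> k (- t *\<^sub>R h) + t * k h" using t by (simp add: zero_le_divide_iff)
    also have "k (- t *\<^sub>R h) \<le> C * (t * norm h)\<^sup>2" using up[of "- t *\<^sub>R h"] t by simp
    finally have "0 \<le> t * (C * (norm h)\<^sup>2 * t + k h)" by (simp add: power2_eq_square algebra_simps)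
    then show ?thesis using t by (simp add: zero_le_mult_iff)
  qed
  have "((\<lambda>t. - (C * (norm h)\<^sup>2) * t) \<longlongrightarrow> - (C * (norm h)\<^sup>2) * 0) (at_right 0)"
    by (intro tendsto_intros)
  moreover have "\<forall>\<^sub>F t in at_right 0. - (C * (norm h)\<^sup>2) * t \<le> k h"
    using ev by (auto simp: eventually_at_filter)
  ultimately show ?thesis
    by (intro tendsto_upperbound[where F="at_right (0::real)" and f="\<lambda>t. - (C * (norm h)\<^sup>2) * t"]) auto
qed

text \<open>The first order remainder at \<open>x\<close> plus \<open>c * (norm h)\<^sup>2\<close>
  is convex, vanishes at 0 and lies below \<open>2 * c * (norm h)\<^sup>2\<close>. It is therefore
  nonnegative, which is the missing lower bound.\<close>

lemma quad_boundedI: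
  fixes f :: "'a::euclidean_space \<Rightarrow> real"
  assumes cv: "convex_on UNIV (\<lambda>x. f x + c * (norm x)\<^sup>2)"
    and up: "\<And>x h. f (x + h) \<le> f x + p x \<bullet> h + c * (norm h)\<^sup>2"
  shows "quad_bounded c f p"
  unfolding quad_bounded_def
proof (intro allI)
  fix x h
  define k where "k h = f (x + h) - f x - p x \<bullet> h + c * (norm h)\<^sup>2" for h
  have "convex_on UNIV k"
  proof (rule convex_onI)
    fix t :: real and y z :: 'a assume t: "0 < t" "t < 1"
    have *: "x + ((1 - t) *\<^sub>R y + t *\<^sub>R z) = (1 - t) *\<^sub>R (x + y) + t *\<^sub>R (x + z)" by (simp add: algebra_simps)
    have "f (x + ((1 - t) *\<^sub>R y + t *\<^sub>R z)) + c * (norm (x + ((1 - t) *\<^sub>R y + t *\<^sub>R z)))\<^sup>2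
      \<le> (1 - t) * (f (x + y) + c * (norm (x + y))\<^sup>2) + t * (f (x + z) + c * (norm (x + z))\<^sup>2)"
      unfolding * using convex_onD[OF cv, of t "x + y" "x + z"] t by simp
    then show "k ((1 - t) *\<^sub>R y + t *\<^sub>R z) \<le> (1 - t) * k y + t * k z"
      unfolding k_def power2_norm_eq_inner
      by (simp add: inner_expand)
  qed simp
  moreover have "k h \<le> (2 * c) * (norm h)\<^sup>2" for h using up[of x h] by (simp add: k_def)
  moreover have "k 0 = 0" by (simp add: k_def)
  ultimately have "0 \<le> k h"
    by (intro convex_touched_above_imp_touched_below[of k "2 * c"])
  then show "\<bar>f (x + h) - f x - p x \<bullet> h\<bar> \<le> c * (norm h)\<^sup>2"
    using up[of x h] by (simp add: k_def abs_le_iff)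
qed

text \<open>Substitute for the lemmas of Jensen and Alexandrov. The expansion is only claimed on the single
  scale \<open>t\<close>, not as a limit, and the operator \<open>T\<close> may depend on \<open>t\<close>.\<close>

lemma jensen_alexandrov:
  fixes F :: "'a::euclidean_space \<Rightarrow> real"
  assumes qb: "quad_bounded c F p" and "\<kappa> > 0" "\<eta> > 0"
    and max: "\<And>x. F x \<le> F x0 - \<kappa> * (norm (x - x0))\<^sup>2"
  obtains x t T where "norm (x - x0) < \<eta>" "norm (p x) < \<eta>" "0 < t" "t < \<eta>" "linear T"
    "\<And>y. F y \<le> F x + p x \<bullet> (y - x)"
    "\<And>h. norm h \<le> t \<Longrightarrow> \<bar>F (x + h) - F x - p x \<bullet> h - (h \<bullet> T h) / 2\<bar> \<le> \<eta> * t\<^sup>2"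
proof -
  define E where "E = {x. norm (x - x0) < \<eta> \<and> norm (p x) < \<eta> \<and> (\<forall>y. F y \<le> F x + p x \<bullet> (y - x))}"
  define G where "G = {x. \<forall>\<kappa>>0. \<forall>\<^sub>F k in sequentially.
     \<exists>T. linear T \<and> (\<forall>h. norm h \<le> (1/2)^k \<longrightarrow> norm (p (x + h) - p x - T h) \<le> \<kappa> * (1/2)^k)}"
  have c0: "c \<ge> 0" by (rule quad_bounded_nonneg[OF qb])
  have lip: "norm (p x - p y) \<le> (6 * c) * norm (x - y)" for x y
    by (rule quad_bounded_lipschitz[OF qb])
  have der: "(F has_derivative (\<lambda>h. p x \<bullet> h)) (at x)" for x
    by (rule quad_bounded_has_derivative[OF qb])
  have cont: "continuous_on A F" for A
    using der by (meson continuous_at_imp_continuous_on has_derivative_continuous)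
  have "AE x in lebesgue. x \<in> G"
    using lipschitz_dyadic_affine_AE[OF lip] unfolding G_def by (intro AE_completion) simp
  then have negl: "negligible (- G)"
    unfolding eventually_ae_filter by (auto simp: negligible_iff_null_sets[symmetric] intro: negligible_subset)
  \<comment> \<open>A tilt \<open>q\<close> with norm below \<kappa>\<eta>/2 is beaten by the
    quadratic decay at distances beyond \<eta>/2 from \<open>x0\<close>. The maximum of the tilted
    function over the small ball is then global.\<close>
  define \<delta> where "\<delta> = min (\<kappa> * (\<eta>/2)) \<eta>"
  have \<delta>: "\<delta> > 0" using assms by (simp add: \<delta>_def)
  have "ball 0 \<delta> \<subseteq> p ` E"
  proof
    fix q :: 'a assume "q \<in> ball 0 \<delta>"
    then have q: "norm q < \<kappa> * (\<eta>/2)" "norm q < \<eta>" by (auto simp: \<delta>_def)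
    obtain x where x: "x \<in> cball x0 (\<eta>/2)" and xmax: "\<And>y. y \<in> cball x0 (\<eta>/2) \<Longrightarrow> F y - q \<bullet> y \<le> F x - q \<bullet> x"
    proof -
      have "continuous_on (cball x0 (\<eta>/2)) (\<lambda>y. F y - q \<bullet> y)"
        by (intro continuous_intros cont)
      moreover have "cball x0 (\<eta>/2) \<noteq> {}" using \<open>\<eta> > 0\<close> by simp
      ultimately show thesis using continuous_attains_sup[OF compact_cball] that by blast
    qed
    have glob: "F y - q \<bullet> y \<le> F x - q \<bullet> x" for y
    proof (cases "y \<in> cball x0 (\<eta>/2)")
      case False
      then have far: "norm (y - x0) > \<eta>/2" by (simp add: dist_norm norm_minus_commute)
      have "q \<bullet> x0 - q \<bullet> y \<le> norm q * norm (y - x0)"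
        using norm_cauchy_schwarz[of q "x0 - y"] by (simp add: inner_diff_right norm_minus_commute)
      also have "\<dots> \<le> (\<kappa> * norm (y - x0)) * norm (y - x0)"
      proof (rule mult_right_mono)
        have "\<kappa> * (\<eta>/2) \<le> \<kappa> * norm (y - x0)" using far \<open>\<kappa> > 0\<close> by simp
        then show "norm q \<le> \<kappa> * norm (y - x0)" using q by linarith
      qed simp
      finally have "F y - q \<bullet> y \<le> F x0 - q \<bullet> x0" using max[of y] by (simp add: power2_eq_square)
      also have "\<dots> \<le> F x - q \<bullet> x" using xmax[of x0] \<open>\<eta> > 0\<close> by simp
      finally show ?thesis .
    qed (rule xmax)
    have "(p x - q) \<bullet> h \<le> c * (norm h)\<^sup>2" for h
      using glob[of "x + h"] qb[unfolded quad_bounded_def, rule_format, of x h]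
      by (simp add: inner_add_right inner_diff_left abs_le_iff)
    then have "p x - q = 0" by (rule inner_le_quadratic_imp_zero)
    then have "p x = q" by simp
    moreover have "norm (x - x0) < \<eta>" using x \<open>\<eta> > 0\<close> by (simp add: dist_norm norm_minus_commute)
    ultimately have "x \<in> E" using q glob by (auto simp: E_def inner_diff_right algebra_simps)
    then show "q \<in> p ` E" using \<open>p x = q\<close> by blast
  qed
  \<comment> \<open>Otherwise a ball would be covered by the Lipschitz image of a null set.\<close>
  have "\<not> E \<subseteq> - G"
  proof
    assume "E \<subseteq> - G"
    then have "ball 0 \<delta> \<subseteq> p ` (- G)" using \<open>ball 0 \<delta> \<subseteq> p ` E\<close> by blast
    moreover have "negligible (p ` (- G))"
      by (rule negligible_locally_Lipschitz_image[OF _ negl]) (use lip in blast)+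
    ultimately have "negligible (ball (0::'a) \<delta>)" using negligible_subset by blast
    then show False using \<delta> open_not_negligible[OF open_ball, of "0::'a" \<delta>] by simp
  qed
  then obtain x where x: "x \<in> E" "x \<in> G" by blast
  have "\<forall>\<^sub>F k in sequentially. (1/2::real)^k < \<eta>"
    using order_tendstoD(2)[OF LIMSEQ_realpow_zero[of "1/2"]] \<open>\<eta> > 0\<close> by simp
  moreover have "\<forall>\<^sub>F k in sequentially. \<exists>T. linear T \<and> (\<forall>h. norm h \<le> (1/2)^k \<longrightarrow> norm (p (x + h) - p x - T h) \<le> \<eta> * (1/2)^k)"
    using x(2) \<open>\<eta> > 0\<close> by (simp add: G_def)
  ultimately have "\<forall>\<^sub>F k in sequentially. (1/2::real)^k < \<eta> \<and> (\<exists>T. linear T \<and> (\<forall>h. norm h \<le> (1/2)^k \<longrightarrow> norm (p (x + h) - p x - T h) \<le> \<eta> * (1/2)^k))"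
    by eventually_elim simp
  then obtain k T where k: "(1/2::real)^k < \<eta>" and T: "linear T"
    and Tb: "\<And>h. norm h \<le> (1/2)^k \<Longrightarrow> norm (p (x + h) - p x - T h) \<le> \<eta> * (1/2)^k"
    using eventually_happens'[OF sequentially_bot] by blast
  define t :: real where "t = (1/2)^k"
  have t0: "t > 0" by (simp add: t_def)
  show thesis
  proof (rule that[of x t T])
    fix h :: 'a assume h: "norm h \<le> t"
    \<comment> \<open>The mean value theorem along the segment turns the first order estimate for
      \<open>p\<close> into the second order one for \<open>F\<close>. Only the quadratic form of
      \<open>T\<close> enters, so \<open>T\<close> may fail to be symmetric.\<close>
    define \<psi> where "\<psi> \<tau> = F (x + \<tau> *\<^sub>R h) - \<tau> * (p x \<bullet> h) - \<tau>\<^sup>2 / 2 * (h \<bullet> T h)" for \<tau>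
    have d\<psi>: "(\<psi> has_real_derivative (p (x + \<tau> *\<^sub>R h) - p x - T (\<tau> *\<^sub>R h)) \<bullet> h) (at \<tau>)" for \<tau>
    proof -
      have "((\<lambda>\<tau>. F (x + \<tau> *\<^sub>R h)) has_derivative (\<lambda>d. p (x + \<tau> *\<^sub>R h) \<bullet> (d *\<^sub>R h))) (at \<tau>)"
        by (rule has_derivative_compose[OF _ der, of "\<lambda>\<tau>. x + \<tau> *\<^sub>R h"]) (auto intro!: derivative_eq_intros)
      then have 1: "((\<lambda>\<tau>. F (x + \<tau> *\<^sub>R h)) has_real_derivative p (x + \<tau> *\<^sub>R h) \<bullet> h) (at \<tau>)"
        by (simp add: has_field_derivative_def mult_commute_abs)
      show ?thesis unfolding \<psi>_def
        by (rule derivative_eq_intros 1 refl | simp)+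
          (use T in \<open>simp add: linear_scale inner_diff_left inner_diff_right inner_commute\<close>)
    qed
    obtain \<xi> where \<xi>: "0 < \<xi>" "\<xi> < 1" "\<psi> 1 - \<psi> 0 = (1 - 0) * ((p (x + \<xi> *\<^sub>R h) - p x - T (\<xi> *\<^sub>R h)) \<bullet> h)"
      using MVT2[of 0 1 \<psi> "\<lambda>\<tau>. (p (x + \<tau> *\<^sub>R h) - p x - T (\<tau> *\<^sub>R h)) \<bullet> h"] d\<psi> by auto
    have nh: "norm (\<xi> *\<^sub>R h) \<le> t" using \<xi> h by (simp add: order_trans[OF mult_left_le_one_le])
    have "\<bar>\<psi> 1 - \<psi> 0\<bar> \<le> norm (p (x + \<xi> *\<^sub>R h) - p x - T (\<xi> *\<^sub>R h)) * norm h"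
      unfolding \<xi> using Cauchy_Schwarz_ineq2 by simp
    also have "\<dots> \<le> (\<eta> * t) * t"
      using Tb[of "\<xi> *\<^sub>R h"] nh h \<open>\<eta> > 0\<close> t0 by (intro mult_mono) (auto simp: t_def)
    finally show "\<bar>F (x + h) - F x - p x \<bullet> h - (h \<bullet> T h) / 2\<bar> \<le> \<eta> * t\<^sup>2"
      by (simp add: \<psi>_def power2_eq_square algebra_simps)
  qed (use x(1) k T t0 in \<open>auto simp: E_def t_def\<close>)
qed

section \<open>Semicontinuity and Lasry--Lions regularisation\<close>

lemma usc_on_iff:
  fixes u :: "'a::metric_space \<Rightarrow> real"
  shows "usc_on S u \<longleftrightarrow> (\<forall>x\<in>S. \<forall>c>u x. \<exists>d>0. \<forall>y\<in>S. dist y x < d \<longrightarrow> u y < c)"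
  unfolding usc_on_def eventually_at by metis

lemma usc_on_add:
  fixes u v :: "'a::metric_space \<Rightarrow> real"
  assumes "usc_on S u" "usc_on S v" shows "usc_on S (\<lambda>x. u x + v x)"
  unfolding usc_on_def
proof (intro ballI allI impI)
  fix x c assume x: "x \<in> S" "u x + v x < c"
  define r where "r = (c - u x - v x) / 2"
  have "u x < u x + r" "v x < v x + r" using x by (auto simp: r_def)
  then have "\<forall>\<^sub>F y in at x within S. u y < u x + r" "\<forall>\<^sub>F y in at x within S. v y < v x + r"
    using assms x unfolding usc_on_def by blast+
  then show "\<forall>\<^sub>F y in at x within S. u y + v y < c"
    by eventually_elim (simp add: r_def field_simps)
qed

lemma continuous_on_imp_usc_on:
  fixes u :: "'a::metric_space \<Rightarrow> real"
  assumes "continuous_on S u" shows "usc_on S u"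
  using assms unfolding usc_on_def continuous_on_def by (auto intro: order_tendstoD(2))

lemma usc_on_uminus:
  fixes v :: "'a::metric_space \<Rightarrow> real"
  assumes "lsc_on S v" shows "usc_on S (\<lambda>x. - v x)"
  unfolding usc_on_def
proof (intro ballI allI impI)
  fix x c assume "x \<in> S" "- v x < c"
  then have "\<forall>\<^sub>F y in at x within S. - c < v y" using assms unfolding lsc_on_def by auto
  then show "\<forall>\<^sub>F y in at x within S. - v y < c" by eventually_elim simp
qed

lemma usc_on_compose:
  fixes u :: "'b::metric_space \<Rightarrow> real" and f :: "'a::metric_space \<Rightarrow> 'b"
  assumes "usc_on S u" "continuous_on T f" "f ` T \<subseteq> S" shows "usc_on T (\<lambda>x. u (f x))"
  unfolding usc_on_iff
proof (intro ballI allI impI)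
  fix x c assume x: "x \<in> T" "u (f x) < c"
  then obtain d where d: "d > 0" "\<And>y. y \<in> S \<Longrightarrow> dist y (f x) < d \<Longrightarrow> u y < c"
    using assms(1)[unfolded usc_on_iff, rule_format, of "f x" c] assms(3) by blast
  obtain e where "e > 0" "\<And>y. y \<in> T \<Longrightarrow> dist y x < e \<Longrightarrow> dist (f y) (f x) < d"
    using assms(2)[unfolded continuous_on_iff, rule_format, OF x(1) d(1)] by blast
  then show "\<exists>e>0. \<forall>y\<in>T. dist y x < e \<longrightarrow> u (f y) < c"
    using d(2) assms(3) by blast
qed

lemma usc_on_subset: "usc_on S u \<Longrightarrow> T \<subseteq> S \<Longrightarrow> usc_on T u" for u :: "'a::metric_space \<Rightarrow> real"
  unfolding usc_on_iff by (meson subset_iff)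

text \<open>If no maximum existed, every \<open>x\<close> would have a point \<open>f x\<close> of
  larger value, and \<open>u\<close> would stay below that value near \<open>x\<close>. Among the
  centres of a finite subcover take \<open>m\<close> with \<open>u (f m)\<close> largest: the point
  \<open>f m\<close> lies in one of the balls, where \<open>u\<close> is smaller than that.\<close>

lemma usc_attains_sup:
  fixes u :: "'a::metric_space \<Rightarrow> real"
  assumes "compact S" "S \<noteq> {}" "usc_on S u"
  obtains x where "x \<in> S" "\<And>y. y \<in> S \<Longrightarrow> u y \<le> u x"
proof (rule ccontr)
  assume "\<not> thesis"
  then have "\<forall>x\<in>S. \<exists>y\<in>S. u x < u y" using that by (meson not_le)
  then obtain f where f: "\<And>x. x \<in> S \<Longrightarrow> f x \<in> S" "\<And>x. x \<in> S \<Longrightarrow> u x < u (f x)" by metis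
  have "\<forall>x\<in>S. \<exists>d>0. \<forall>y\<in>S. dist y x < d \<longrightarrow> u y < u (f x)"
    using assms(3) f(2) unfolding usc_on_iff by blast
  then obtain d where d: "\<And>x. x \<in> S \<Longrightarrow> d x > 0" "\<And>x y. x \<in> S \<Longrightarrow> y \<in> S \<Longrightarrow> dist y x < d x \<Longrightarrow> u y < u (f x)"
    by metis
  have "S \<subseteq> (\<Union>x\<in>S. ball x (d x))" using d(1) by force
  then obtain C where C: "C \<subseteq> S" "finite C" "S \<subseteq> (\<Union>x\<in>C. ball x (d x))"
    using compactE_image[OF assms(1), of S "\<lambda>x. ball x (d x)"] by auto
  then have "C \<noteq> {}" using assms(2) by auto
  then obtain m where m: "m \<in> C" "\<And>x. x \<in> C \<Longrightarrow> u (f x) \<le> u (f m)"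
  proof -
    have "Max ((\<lambda>x. u (f x)) ` C) \<in> (\<lambda>x. u (f x)) ` C" using C(2) \<open>C \<noteq> {}\<close> by (intro Max_in) auto
    then obtain m where m: "m \<in> C" "u (f m) = Max ((\<lambda>x. u (f x)) ` C)" by auto
    show thesis by (rule that[OF m(1)]) (use C(2) m(2) in \<open>auto intro: Max_ge\<close>)
  qed
  then have "f m \<in> S" using f C by blast
  then obtain x where "x \<in> C" "dist (f m) x < d x" using C(3) by (auto simp: dist_commute)
  then have "u (f m) < u (f x)" using d(2) C(1) \<open>f m \<in> S\<close> by blast
  then show False using m(2)[OF \<open>x \<in> C\<close>] by simp
qed

lemma norm_sq_convex_combination:
  fixes v z :: "'a::real_inner"
  assumes "c \<ge> 0" and "0 \<le> t" "t \<le> 1"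
  shows "c * (norm ((1 - t) *\<^sub>R v + t *\<^sub>R z))\<^sup>2 \<le> (1 - t) * (c * (norm v)\<^sup>2) + t * (c * (norm z)\<^sup>2)"
proof -
  have "(norm ((1 - t) *\<^sub>R v + t *\<^sub>R z))\<^sup>2 + t * (1 - t) * (norm (v - z))\<^sup>2 = (1 - t) * (norm v)\<^sup>2 + t * (norm z)\<^sup>2"
    unfolding power2_norm_eq_inner
    by (simp add: inner_expand power2_eq_square)
  moreover have "t * (1 - t) * (norm (v - z))\<^sup>2 \<ge> 0" using assms by simp
  ultimately have "(norm ((1 - t) *\<^sub>R v + t *\<^sub>R z))\<^sup>2 \<le> (1 - t) * (norm v)\<^sup>2 + t * (norm z)\<^sup>2" by linarith
  from mult_left_mono[OF this assms(1)] show ?thesis by (simp add: algebra_simps)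
qed

text \<open>In an inf-convolution of quadratics the reciprocals of the coefficients add. The
  penalisation constants of the regularisation and of the doubling argument come from this
  inequality. The defect is the square of the norm of
  \<open>\<beta> *\<^sub>R a - \<alpha> *\<^sub>R b\<close>.\<close>

lemma norm_add_sq_le_weighted:
  fixes a b :: "'a::real_inner"
  assumes "\<alpha> > 0" "\<beta> > 0"
  shows "(norm (a + b))\<^sup>2 / (\<alpha> + \<beta>) \<le> (norm a)\<^sup>2 / \<alpha> + (norm b)\<^sup>2 / \<beta>"
proof -
  have "\<alpha> * \<beta> * (norm (a + b))\<^sup>2 + (norm (\<beta> *\<^sub>R a - \<alpha> *\<^sub>R b))\<^sup>2 = (\<alpha> + \<beta>) * (\<beta> * (norm a)\<^sup>2 + \<alpha> * (norm b)\<^sup>2)"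
    unfolding power2_norm_eq_inner
    by (simp add: inner_expand power2_eq_square)
  then have "\<alpha> * \<beta> * (norm (a + b))\<^sup>2 \<le> (\<alpha> + \<beta>) * (\<beta> * (norm a)\<^sup>2 + \<alpha> * (norm b)\<^sup>2)"
    using zero_le_power2[of "norm (\<beta> *\<^sub>R a - \<alpha> *\<^sub>R b)"] by linarith
  then show ?thesis using assms by (simp add: field_simps)
qed

text \<open>Here \<open>a\<close> is an inf-convolution of a sup-convolution of \<open>u\<close>. The constants
  satisfy \<open>5 / (4 s) - 1 / (4 s) = 1 / s\<close>, so \<open>a\<close> lies above the sup-convolution with
  quadratic term \<open>s |x - w|\<^sup>2\<close>.\<close>

lemma lasry_lions:
  fixes u :: "'a::euclidean_space \<Rightarrow> real"
  assumes S: "compact S" "S \<noteq> {}" and usc: "usc_on S u" and s: "s > 0"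
  obtains a p where "quad_bounded (4 * s) a p"
    "\<And>w x. w \<in> S \<Longrightarrow> u w \<le> a x + s * (norm (x - w))\<^sup>2"
    "\<And>x z. \<exists>w\<in>S. a x \<le> u w - 4/5 * s * (norm (z - w))\<^sup>2 + 4 * s * (norm (x - z))\<^sup>2"
    "\<And>x. \<exists>z. \<exists>w\<in>S. a x = u w - 4/5 * s * (norm (z - w))\<^sup>2 + 4 * s * (norm (x - z))\<^sup>2
       \<and> p x = (8 * s) *\<^sub>R (x - z)"
proof -
  have "\<exists>w\<in>S. \<forall>w'\<in>S. u w' - 4/5 * s * (norm (z - w'))\<^sup>2 \<le> u w - 4/5 * s * (norm (z - w))\<^sup>2" for z
  proof -
    have "usc_on S (\<lambda>w. u w + (- (4/5 * s * (norm (z - w))\<^sup>2)))"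
      by (intro usc_on_add usc continuous_on_imp_usc_on continuous_intros)
    from usc_attains_sup[OF S this] show ?thesis by (metis diff_conv_add_uminus)
  qed
  then obtain W where W: "\<And>z. W z \<in> S" "\<And>z w. w \<in> S \<Longrightarrow> u w - 4/5 * s * (norm (z - w))\<^sup>2 \<le> u (W z) - 4/5 * s * (norm (z - W z))\<^sup>2"
    by metis
  define g where "g z = u (W z) - 4/5 * s * (norm (z - W z))\<^sup>2" for z
  \<comment> \<open>Expanding the square cancels the quadratic term in \<open>z\<close>, so this is
    a maximum of affine functions.\<close>
  have cvg: "convex_on UNIV (\<lambda>z. g z + 4/5 * s * (norm z)\<^sup>2)"
  proof (rule convex_onI)
    fix t :: real and x y :: 'a assume t: "0 < t" "t < 1"
    define z where "z = (1 - t) *\<^sub>R x + t *\<^sub>R y"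
    have e: "u w - 4/5 * s * (norm (x - w))\<^sup>2 + 4/5 * s * (norm x)\<^sup>2 = u w - 4/5 * s * (norm w)\<^sup>2 + 8/5 * s * (x \<bullet> w)" for x w
      unfolding power2_norm_eq_inner by (simp add: inner_expand)
    have lin: "(1 - t) * (c + 8/5 * s * (x \<bullet> w)) + t * (c + 8/5 * s * (y \<bullet> w)) = c + 8/5 * s * (z \<bullet> w)" for c w
    proof -
      have zw: "z \<bullet> w = (1 - t) * (x \<bullet> w) + t * (y \<bullet> w)" by (simp add: z_def inner_add_left)
      show ?thesis unfolding zw by (simp add: field_simps)
    qed
    have "(1 - t) * (u (W z) - 4/5 * s * (norm (x - W z))\<^sup>2 + 4/5 * s * (norm x)\<^sup>2) + t * (u (W z) - 4/5 * s * (norm (y - W z))\<^sup>2 + 4/5 * s * (norm y)\<^sup>2)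
       = u (W z) - 4/5 * s * (norm (z - W z))\<^sup>2 + 4/5 * s * (norm z)\<^sup>2"
      unfolding e by (rule lin)
    moreover have "(1 - t) * (u (W z) - 4/5 * s * (norm (x - W z))\<^sup>2 + 4/5 * s * (norm x)\<^sup>2) \<le> (1 - t) * (g x + 4/5 * s * (norm x)\<^sup>2)"
      using W(2)[OF W(1)[of z], of x] t unfolding g_def by (intro mult_left_mono) auto
    moreover have "t * (u (W z) - 4/5 * s * (norm (y - W z))\<^sup>2 + 4/5 * s * (norm y)\<^sup>2) \<le> t * (g y + 4/5 * s * (norm y)\<^sup>2)"
      using W(2)[OF W(1)[of z], of y] t unfolding g_def by (intro mult_left_mono) auto
    ultimately show "g ((1 - t) *\<^sub>R x + t *\<^sub>R y) + 4/5 * s * (norm ((1 - t) *\<^sub>R x + t *\<^sub>R y))\<^sup>2 \<le> (1 - t) * (g x + 4/5 * s * (norm x)\<^sup>2) + t * (g y + 4/5 * s * (norm y)\<^sup>2)"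
      unfolding z_def[symmetric] g_def by linarith
  qed simp
  have contg: "continuous_on A g" for A
  proof -
    have "continuous_on UNIV (\<lambda>z. (g z + 4/5 * s * (norm z)\<^sup>2) - 4/5 * s * (norm z)\<^sup>2)"
      by (intro continuous_on_diff convex_on_continuous[OF open_UNIV cvg] continuous_intros)
    then show ?thesis using continuous_on_subset by fastforce
  qed
  have "\<exists>z. \<forall>z'. g z + 4 * s * (norm (x - z))\<^sup>2 \<le> g z' + 4 * s * (norm (x - z'))\<^sup>2" for x
  proof -
    obtain w0 where w0: "w0 \<in> S" using S by blast
    \<comment> \<open>Coercivity: at distance \<open>d\<close> from \<open>x\<close>,
      \<open>g\<close> falls at most like \<open>8/5 * s * d\<^sup>2\<close> below a constant, while
      the penalty grows like \<open>4 * s * d\<^sup>2\<close>. Beyond the radius \<open>R\<close>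
      built from \<open>e\<close> a competitor is no better than \<open>x\<close> itself.\<close>
    define e where "e = g x - u w0 + 8/5 * s * (norm (x - w0))\<^sup>2"
    define R where "R = 1 + \<bar>e\<bar> / s"
    have "s * R = s + \<bar>e\<bar>" "R \<ge> 1" using s by (auto simp: R_def distrib_left)
    then have R: "R \<ge> 1" "s * R \<ge> g x - u w0 + 8/5 * s * (norm (x - w0))\<^sup>2"
      using s unfolding e_def by linarith+
    have ne: "cball x R \<noteq> {}" using R by simp
    have "continuous_on (cball x R) (\<lambda>z. g z + 4 * s * (norm (x - z))\<^sup>2)"
      by (intro continuous_intros contg)
    then obtain z where z: "z \<in> cball x R" "\<And>z'. z' \<in> cball x R \<Longrightarrow> g z + 4 * s * (norm (x - z))\<^sup>2 \<le> g z' + 4 * s * (norm (x - z'))\<^sup>2"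
      using continuous_attains_inf[OF compact_cball ne] by blast
    have "g z + 4 * s * (norm (x - z))\<^sup>2 \<le> g z' + 4 * s * (norm (x - z'))\<^sup>2" for z'
    proof (cases "z' \<in> cball x R")
      case False
      define d where "d = norm (x - z')"
      have d: "d > R" using False by (simp add: d_def dist_norm)
      have "(norm (z' - w0))\<^sup>2 \<le> 2 * d\<^sup>2 + 2 * (norm (x - w0))\<^sup>2"
        using norm_add_sq_le_weighted[of 1 1 "z' - x" "x - w0"] by (simp add: d_def norm_minus_commute)
      from mult_left_mono[OF this, of "4/5 * s"] s
      have "4/5 * s * (norm (z' - w0))\<^sup>2 \<le> 8/5 * s * d\<^sup>2 + 8/5 * s * (norm (x - w0))\<^sup>2" by (simp add: algebra_simps)
      moreover have "u w0 - 4/5 * s * (norm (z' - w0))\<^sup>2 \<le> g z'" unfolding g_def by (rule W(2)[OF w0])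
      moreover have "s * R \<le> s * d\<^sup>2"
      proof -
        have "R * 1 \<le> d * d" using d R by (intro mult_mono) auto
        then show ?thesis using s by (simp add: power2_eq_square)
      qed
      moreover have "s * d\<^sup>2 \<ge> 0" using s by simp
      moreover have "s * d\<^sup>2 * (4 - 8/5) = s * d\<^sup>2 * (12/5)" by simp
      ultimately have "g x \<le> g z' + 4 * s * d\<^sup>2" using R(2) by linarith
      moreover have "g z + 4 * s * (norm (x - z))\<^sup>2 \<le> g x" using z(2)[of x] R by simp
      ultimately show ?thesis by (simp add: d_def)
    qed (rule z(2))
    then show ?thesis by blast
  qed
  then obtain Z where Z: "\<And>x z'. g (Z x) + 4 * s * (norm (x - Z x))\<^sup>2 \<le> g z' + 4 * s * (norm (x - z'))\<^sup>2"
    by metis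
  define a where "a x = g (Z x) + 4 * s * (norm (x - Z x))\<^sup>2" for x
  define p where "p x = (8 * s) *\<^sub>R (x - Z x)" for x
  have a_le: "a x \<le> g z + 4 * s * (norm (x - z))\<^sup>2" for x z unfolding a_def by (rule Z)
  have "convex_on UNIV (\<lambda>x. a x + s * (norm x)\<^sup>2)"
  proof (rule convex_onI)
    fix t :: real and x y :: 'a assume t: "0 < t" "t < 1"
    define X where "X = (1 - t) *\<^sub>R x + t *\<^sub>R y"
    define z where "z = (1 - t) *\<^sub>R Z x + t *\<^sub>R Z y"
    \<comment> \<open>Completing the square writes the function to be minimised as a convex function
      of \<open>z\<close> plus the square of a norm of an expression linear in the pair. It is
      jointly convex, so its minimum over \<open>z\<close> is convex in \<open>x\<close>.\<close>
    have e: "g z + 4 * s * (norm (x - z))\<^sup>2 + s * (norm x)\<^sup>2 = (g z + 4/5 * s * (norm z)\<^sup>2) + 5 * s * (norm (x - (4/5) *\<^sub>R z))\<^sup>2" for x z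
      unfolding power2_norm_eq_inner by (simp add: inner_expand)
    have "a X + s * (norm X)\<^sup>2 \<le> (g z + 4/5 * s * (norm z)\<^sup>2) + 5 * s * (norm (X - (4/5) *\<^sub>R z))\<^sup>2"
      using a_le[of X z] e[of z X] by linarith
    moreover have "g z + 4/5 * s * (norm z)\<^sup>2 \<le> (1 - t) * (g (Z x) + 4/5 * s * (norm (Z x))\<^sup>2) + t * (g (Z y) + 4/5 * s * (norm (Z y))\<^sup>2)"
      unfolding z_def using convex_onD[OF cvg, of t "Z x" "Z y"] t by simp
    moreover have "5 * s * (norm (X - (4/5) *\<^sub>R z))\<^sup>2 \<le> (1 - t) * (5 * s * (norm (x - (4/5) *\<^sub>R Z x))\<^sup>2) + t * (5 * s * (norm (y - (4/5) *\<^sub>R Z y))\<^sup>2)"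
    proof -
      have "X - c *\<^sub>R z = (1 - t) *\<^sub>R (x - c *\<^sub>R Z x) + t *\<^sub>R (y - c *\<^sub>R Z y)" for c
        by (simp add: X_def z_def algebra_simps)
      then show ?thesis using norm_sq_convex_combination[of "5 * s" t] s t by simp
    qed
    ultimately have "a X + s * (norm X)\<^sup>2 \<le> (1 - t) * ((g (Z x) + 4/5 * s * (norm (Z x))\<^sup>2) + 5 * s * (norm (x - (4/5) *\<^sub>R Z x))\<^sup>2)
        + t * ((g (Z y) + 4/5 * s * (norm (Z y))\<^sup>2) + 5 * s * (norm (y - (4/5) *\<^sub>R Z y))\<^sup>2)"
      by (simp only: distrib_left)
    then show "a ((1 - t) *\<^sub>R x + t *\<^sub>R y) + s * (norm ((1 - t) *\<^sub>R x + t *\<^sub>R y))\<^sup>2 \<le> (1 - t) * (a x + s * (norm x)\<^sup>2) + t * (a y + s * (norm y)\<^sup>2)"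
      unfolding e[symmetric] X_def a_def .
  qed simp
  \<comment> \<open>The criterion for quadratic bounds uses one constant for both sides, so the
    semiconvexity constant \<open>s\<close> is weakened to \<open>4 * s\<close>, the constant of the
    upper bound.\<close>
  moreover have "4 * s * (norm x)\<^sup>2 = s * (norm x)\<^sup>2 + 3 * s * (norm x)\<^sup>2" for x :: 'a by simp
  moreover have "convex_on UNIV (\<lambda>x::'a. 3 * s * (norm x)\<^sup>2)"
    using s by (intro convex_onI norm_sq_convex_combination) auto
  ultimately have cva: "convex_on UNIV (\<lambda>x. a x + 4 * s * (norm x)\<^sup>2)"
    using convex_on_add[of UNIV "\<lambda>x. a x + s * (norm x)\<^sup>2" "\<lambda>x. 3 * s * (norm x)\<^sup>2"] by (simp add: algebra_simps)
  have "quad_bounded (4 * s) a p"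
  proof (rule quad_boundedI[OF cva])
    fix x h
    have "a (x + h) \<le> g (Z x) + 4 * s * (norm (x + h - Z x))\<^sup>2" by (rule a_le)
    also have "\<dots> = a x + p x \<bullet> h + 4 * s * (norm h)\<^sup>2"
      unfolding a_def p_def power2_norm_eq_inner
      by (simp add: inner_expand)
    finally show "a (x + h) \<le> a x + p x \<bullet> h + 4 * s * (norm h)\<^sup>2" .
  qed
  moreover have "u w \<le> a x + s * (norm (x - w))\<^sup>2" if "w \<in> S" for w x
  proof -
    have "(norm (Z x - w))\<^sup>2 / (5/4) \<le> 4 * (norm (x - Z x))\<^sup>2 + (norm (x - w))\<^sup>2"
      using norm_add_sq_le_weighted[of "1/4" 1 "Z x - x" "x - w"] by (simp add: norm_minus_commute)
    from mult_left_mono[OF this, of s] s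
    have "4/5 * s * (norm (Z x - w))\<^sup>2 \<le> 4 * s * (norm (x - Z x))\<^sup>2 + s * (norm (x - w))\<^sup>2"
      by (simp add: algebra_simps)
    moreover have "u w - 4/5 * s * (norm (Z x - w))\<^sup>2 \<le> g (Z x)" unfolding g_def by (rule W(2)[OF that])
    ultimately show ?thesis unfolding a_def by linarith
  qed
  moreover have "\<exists>w\<in>S. a x \<le> u w - 4/5 * s * (norm (z - w))\<^sup>2 + 4 * s * (norm (x - z))\<^sup>2" for x z
    using a_le[of x z] W(1)[of z] unfolding g_def by blast
  moreover have "\<exists>z. \<exists>w\<in>S. a x = u w - 4/5 * s * (norm (z - w))\<^sup>2 + 4 * s * (norm (x - z))\<^sup>2 \<and> p x = (8 * s) *\<^sub>R (x - z)" for x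
    using W(1)[of "Z x"] unfolding a_def p_def g_def by blast
  ultimately show thesis by (rule that)
qed

section \<open>The theorem on sums\<close>

text \<open>The blow-up operators are not known to be symmetric. Symmetrising leaves the quadratic
  form, the only datum used, unchanged.\<close>

lemma symmetric_matrix_of_quadratic_form:
  fixes f :: "real^'n \<Rightarrow> real^'n"
  assumes "linear f"
  obtains X :: "real^'n^'n" where "X \<in> sym_mats" "\<And>h. h \<bullet> (X *v h) = h \<bullet> f h"
proof
  define X where "X = (1/2) *\<^sub>R (matrix f + transpose (matrix f))"
  show "X \<in> sym_mats"
    by (simp add: sym_mats_def X_def transpose_def vec_eq_iff)
  show "h \<bullet> (X *v h) = h \<bullet> f h" for h
  proof -
    have "h \<bullet> (transpose (matrix f) *v h) = h \<bullet> f h"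
      by (simp add: inner_commute[of h] dot_lmul_matrix matrix_vector_mul(2)[OF assms])
    then show ?thesis
      by (simp add: X_def matrix_vector_mult_add_rdistrib scaleR_matrix_vector_assoc[symmetric] matrix_vector_mul(2)[OF assms] inner_add_right)
  qed
qed

lemma sym_mats_inner_commute:
  fixes X :: "real^'n^'n"
  assumes "X \<in> sym_mats" shows "x \<bullet> (X *v y) = (X *v x) \<bullet> y"
proof -
  have "x \<bullet> (X *v y) = (transpose X *v x) \<bullet> y" by (simp add: dot_lmul_matrix)
  then show ?thesis using assms by (simp only: sym_mats_def mem_Collect_eq)
qed

lemma sym_mats_add: "X \<in> sym_mats \<Longrightarrow> Y \<in> sym_mats \<Longrightarrow> X + Y \<in> sym_mats"
  and sym_mats_scaleR: "X \<in> sym_mats \<Longrightarrow> c *\<^sub>R X \<in> sym_mats"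
  and sym_mats_mat: "mat d \<in> sym_mats"
  and sym_mats_minus: "X \<in> sym_mats \<Longrightarrow> - X \<in> sym_mats"
  by (auto simp: sym_mats_def transpose_def vec_eq_iff mat_def)

lemma scaleR_mat_vector [simp]: "(c *\<^sub>R mat 1) *v x = c *\<^sub>R (x :: real^'n)"
  by (simp add: scaleR_matrix_vector_assoc[symmetric])

abbreviation touched_above ::
  "(real^'n) set \<Rightarrow> (real^'n \<Rightarrow> real) \<Rightarrow> real^'n \<Rightarrow> real^'n \<Rightarrow> real^'n^'n \<Rightarrow> bool" where
  "touched_above S u w P X \<equiv> \<exists>r>0. \<forall>z\<in>S. norm (z - w) < r \<longrightarrow>
     u z \<le> u w + P \<bullet> (z - w) + ((z - w) \<bullet> (X *v (z - w))) / 2"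

lemma one_scale_touch:
  fixes u :: "real^'n \<Rightarrow> real"
  assumes S: "compact S" and usc: "usc_on S u" and w: "w \<in> S" and "t > 0" "\<delta> > 0" and X: "X \<in> sym_mats"
    and ub: "\<And>h. norm h \<le> t \<Longrightarrow> w + h \<in> S \<Longrightarrow> u (w + h) \<le> u w + P \<bullet> h + (h \<bullet> (X *v h)) / 2 + \<delta> * t\<^sup>2"
  defines "X' \<equiv> X + (4 * \<delta>) *\<^sub>R mat 1"
  obtains w' where "w' \<in> S" "norm (w' - w) < t"
    "u w + P \<bullet> (w' - w) + ((w' - w) \<bullet> (X' *v (w' - w))) / 2 \<le> u w'"
    "touched_above S u w' (P + X' *v (w' - w)) X'"
proof -
  define \<phi> where "\<phi> z = P \<bullet> (z - w) + ((z - w) \<bullet> (X' *v (z - w))) / 2" for z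
  have X': "X' \<in> sym_mats" unfolding X'_def by (intro sym_mats_add X sym_mats_scaleR sym_mats_mat)
  have X'q: "h \<bullet> (X' *v h) = h \<bullet> (X *v h) + 4 * \<delta> * (norm h)\<^sup>2" for h
    by (simp add: X'_def matrix_vector_mult_add_rdistrib inner_add_right power2_norm_eq_inner)
  have cont: "continuous_on A \<phi>" for A
    unfolding \<phi>_def by (intro continuous_intros linear_continuous_on_compose[where f="\<lambda>z. z - w" and g="(*v) X'"]) auto
  define B where "B = S \<inter> cball w t"
  have "usc_on B (\<lambda>z. u z + (- \<phi> z))"
    unfolding B_def by (intro usc_on_add usc_on_subset[OF usc] continuous_on_imp_usc_on continuous_intros cont) auto
  moreover have "compact B" "w \<in> B" using S w \<open>t > 0\<close> by (auto simp: B_def)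
  ultimately obtain w' where w': "w' \<in> B" "\<And>z. z \<in> B \<Longrightarrow> u z - \<phi> z \<le> u w' - \<phi> w'"
    using usc_attains_sup[of B "\<lambda>z. u z + (- \<phi> z)"] by auto
  have val: "u w \<le> u w' - \<phi> w'" using w'(2)[OF \<open>w \<in> B\<close>] by (simp add: \<phi>_def)
  have lt: "norm (w' - w) < t"
  proof (rule ccontr)
    assume "\<not> norm (w' - w) < t"
    then have n: "norm (w' - w) = t" using w'(1) by (auto simp: B_def dist_norm norm_minus_commute)
    have "u w' \<le> u w + P \<bullet> (w' - w) + ((w' - w) \<bullet> (X *v (w' - w))) / 2 + \<delta> * t\<^sup>2"
      using ub[of "w' - w"] n w'(1) by (simp add: B_def)
    also have "\<dots> = u w + \<phi> w' - \<delta> * t\<^sup>2" by (simp add: \<phi>_def X'q n)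
    also have "\<dots> < u w + \<phi> w'" using \<open>t > 0\<close> \<open>\<delta> > 0\<close> by simp
    finally show False using val by simp
  qed
  show thesis
  proof (rule that[of w'])
    show "w' \<in> S" using w' by (simp add: B_def)
    show "norm (w' - w) < t" by (rule lt)
    show "u w + P \<bullet> (w' - w) + ((w' - w) \<bullet> (X' *v (w' - w))) / 2 \<le> u w'" using val by (simp add: \<phi>_def)
    show "touched_above S u w' (P + X' *v (w' - w)) X'"
    proof (intro exI[of _ "t - norm (w' - w)"] conjI ballI impI)
      show "t - norm (w' - w) > 0" using lt by simp
      fix z assume z: "z \<in> S" "norm (z - w') < t - norm (w' - w)"
      then have "norm (z - w) < t" using norm_triangle_ineq[of "z - w'" "w' - w"] by simp
      then have "z \<in> B" using z by (simp add: B_def dist_norm norm_minus_commute)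
      then have "u z \<le> u w' + (\<phi> z - \<phi> w')" using w'(2) by force
      also have "\<phi> z - \<phi> w' = (P + X' *v (w' - w)) \<bullet> (z - w') + ((z - w') \<bullet> (X' *v (z - w'))) / 2"
      proof -
        define h where "h = z - w'"
        define k where "k = w' - w"
        have zw: "z - w = h + k" by (simp add: h_def k_def)
        have "h \<bullet> (X' *v k) = (X' *v k) \<bullet> h" "k \<bullet> (X' *v h) = (X' *v k) \<bullet> h"
          using sym_mats_inner_commute[OF X'] by (simp_all add: inner_commute)
        then show ?thesis
          unfolding \<phi>_def zw h_def[symmetric] k_def[symmetric]
          by (simp add: inner_add_left inner_add_right matrix_vector_right_distrib add_divide_distrib)
      qed
      finally show "u z \<le> u w' + (P + X' *v (w' - w)) \<bullet> (z - w') + ((z - w') \<bullet> (X' *v (z - w'))) / 2" by simp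
    qed
  qed
qed

text \<open>Where \<open>a\<close> is touched from above by a paraboloid flatter than those defining the
  inf-convolution, \<open>a\<close> coincides with the sup-convolution: otherwise the optimal paraboloid would
  meet \<open>a\<close> again at \<open>y \<noteq> x\<close>.\<close>

lemma lasry_lions_contact:
  fixes u :: "'a::euclidean_space \<Rightarrow> real"
  assumes s: "s > 0"
    and lb: "\<And>w x. w \<in> S \<Longrightarrow> u w \<le> a x + s * (norm (x - w))\<^sup>2"
    and rep: "\<exists>z. \<exists>w\<in>S. a x = u w - 4/5 * s * (norm (z - w))\<^sup>2 + 4 * s * (norm (x - z))\<^sup>2
       \<and> p = (8 * s) *\<^sub>R (x - z)"
    and up: "\<And>y. a y \<le> a x + p \<bullet> (y - x) + C * (norm (y - x))\<^sup>2" and C: "C < 4 * s"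
  obtains w where "w \<in> S" "a x = u w - s * (norm (x - w))\<^sup>2" "p = (2 * s) *\<^sub>R (w - x)"
proof -
  obtain z w where w: "w \<in> S" and ax: "a x = u w - 4/5 * s * (norm (z - w))\<^sup>2 + 4 * s * (norm (x - z))\<^sup>2"
    and p: "p = (8 * s) *\<^sub>R (x - z)" using rep by blast
  \<comment> \<open>The equality case of the weighted inequality with weights 1/4 and 1: at
    \<open>y\<close> the paraboloid of opening \<open>s\<close> around \<open>w\<close> meets the
    optimal one of opening \<open>4 * s\<close> around \<open>z\<close>.\<close>
  define y where "y = z + (1/5) *\<^sub>R (w - z)"
  have yw: "y - w = (4/5) *\<^sub>R (z - w)" "y - z = (-1/5) *\<^sub>R (z - w)"
    by (simp_all add: y_def algebra_simps flip: scaleR_add_left)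
  have nyw: "(norm (y - w))\<^sup>2 = 16/25 * (norm (z - w))\<^sup>2" "(norm (y - z))\<^sup>2 = 1/25 * (norm (z - w))\<^sup>2"
    unfolding yw norm_scaleR by (simp_all add: power2_eq_square)
  have val: "u w - s * (norm (y - w))\<^sup>2 = u w - 4/5 * s * (norm (z - w))\<^sup>2 + 4 * s * (norm (y - z))\<^sup>2"
    unfolding nyw by simp
  have "u w - s * (norm (y - w))\<^sup>2 \<le> a x + p \<bullet> (y - x) + C * (norm (y - x))\<^sup>2"
    using lb[OF w, of y] up[of y] by linarith
  moreover have "u w - 4/5 * s * (norm (z - w))\<^sup>2 + 4 * s * (norm (y - z))\<^sup>2 = a x + p \<bullet> (y - x) + 4 * s * (norm (y - x))\<^sup>2"
    unfolding ax p power2_norm_eq_inner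
    by (simp add: inner_expand)
  ultimately have "4 * s * (norm (y - x))\<^sup>2 \<le> C * (norm (y - x))\<^sup>2" using val by linarith
  then have "(4 * s - C) * (norm (y - x))\<^sup>2 \<le> 0" by (simp add: algebra_simps)
  then have "y = x" using C by (simp add: mult_le_0_iff)
  have "p = (2 * s) *\<^sub>R (w - x)"
  proof -
    have "w - x = (-4/5) *\<^sub>R (z - w)" "x - z = (-1/5) *\<^sub>R (z - w)"
      using yw unfolding \<open>y = x\<close> by (simp_all add: algebra_simps)
    then show ?thesis unfolding p by simp
  qed
  moreover have "a x = u w - s * (norm (x - w))\<^sup>2" using val ax unfolding \<open>y = x\<close> by simp
  ultimately show thesis using that w by blast
qed

lemma norm_prod_sq: "(norm (z :: 'a::real_inner \<times> 'b::real_inner))\<^sup>2 = (norm (fst z))\<^sup>2 + (norm (snd z))\<^sup>2"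
  by (simp add: norm_prod_def)

text \<open>An approximate second order superjet of \<open>u\<close> at \<open>w\<close>, valid on
  one scale \<open>t\<close>. The value inequality records that \<open>w\<close> competes with
  \<open>zh\<close> in the sup-convolution at \<open>x\<close>; it later forces the values at the
  contact points to converge. The last clause is semiconvexity up to \<delta>, which bounds the
  matrices from below.\<close>

definition one_scale_jet ::
  "(real^'n) set \<Rightarrow> (real^'n \<Rightarrow> real) \<Rightarrow> real \<Rightarrow> real^'n \<Rightarrow> real \<Rightarrow> real^'n \<Rightarrow> real^'n \<Rightarrow> real^'n^'n \<Rightarrow> real^'n \<Rightarrow> bool" where
  "one_scale_jet S u s zh \<delta> x P X w \<longleftrightarrow> X \<in> sym_mats \<and> w \<in> S \<and> P = (2 * s) *\<^sub>R (w - x) \<and>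
     u zh - s * (norm (x - zh))\<^sup>2 \<le> u w - s * (norm (x - w))\<^sup>2 \<and>
     (\<exists>t>0. t < \<delta> \<and> (\<forall>h. norm h \<le> t \<longrightarrow> w + h \<in> S \<longrightarrow> u (w + h) \<le> u w + P \<bullet> h + (h \<bullet> (X *v h)) / 2 + \<delta> * t\<^sup>2)) \<and>
     (\<forall>h. - (2 * s + 2 * \<delta>) * (norm h)\<^sup>2 \<le> h \<bullet> (X *v h))"

lemma quadratic_form_scaleR: "(c *\<^sub>R h) \<bullet> (Y *v (c *\<^sub>R h)) = c\<^sup>2 * (h \<bullet> (Y *v h))" for Y :: "real^'n^'n"
  by (simp add: matrix_vector_mult_scaleR power2_eq_square)

text \<open>Moving both arguments of the sup-convolution by the same \<open>h\<close> leaves the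
  penalty unchanged, so the expansion of \<open>a\<close> at \<open>x\<close> bounds
  \<open>u\<close> near \<open>w\<close>. Keeping \<open>w\<close> fixed instead puts a paraboloid
  of Hessian \<open>-2 * s\<close> below \<open>a\<close> at \<open>x\<close>. Comparing on the
  sphere of radius \<open>t\<close> and rescaling gives the lower bound on \<open>X\<close>.\<close>

lemma one_scale_jetI:
  fixes u :: "real^'n \<Rightarrow> real"
  assumes lb: "\<And>w x. w \<in> S \<Longrightarrow> u w \<le> a x + s * (norm (x - w))\<^sup>2" and "zh \<in> S"
    and t: "0 < t" "t < \<delta>" and "X \<in> sym_mats"
    and w: "w \<in> S" "a x = u w - s * (norm (x - w))\<^sup>2" "P = (2 * s) *\<^sub>R (w - x)"
    and e: "\<And>h. norm h \<le> t \<Longrightarrow> \<bar>a (x + h) - a x - P \<bullet> h - (h \<bullet> (X *v h)) / 2\<bar> \<le> \<delta> * t\<^sup>2"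
  shows "one_scale_jet S u s zh \<delta> x P X w"
  unfolding one_scale_jet_def
proof (intro conjI exI[of _ t] allI impI w assms)
  show "u zh - s * (norm (x - zh))\<^sup>2 \<le> u w - s * (norm (x - w))\<^sup>2"
    using lb[OF \<open>zh \<in> S\<close>, of x] w(2) by linarith
  fix h :: "real^'n"
  show "u (w + h) \<le> u w + P \<bullet> h + (h \<bullet> (X *v h)) / 2 + \<delta> * t\<^sup>2" if "norm h \<le> t" "w + h \<in> S"
    using lb[OF that(2), of "x + h"] e[OF that(1)] w(2) by (simp add: abs_le_iff)
  have low: "- s * (norm h)\<^sup>2 - \<delta> * t\<^sup>2 \<le> (h \<bullet> (X *v h)) / 2" if "norm h \<le> t" for h
  proof -
    have n: "(norm (x + h - w))\<^sup>2 = (norm (x - w))\<^sup>2 + 2 * ((x - w) \<bullet> h) + (norm h)\<^sup>2"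
      unfolding power2_norm_eq_inner by (simp add: inner_expand)
    have "s * (norm (x + h - w))\<^sup>2 = s * (norm (x - w))\<^sup>2 - P \<bullet> h + s * (norm h)\<^sup>2"
      unfolding w(3) n by (simp add: inner_diff_left algebra_simps)
    then show ?thesis using lb[OF w(1), of "x + h"] e[OF that] w(2) by (simp add: abs_le_iff)
  qed
  show "- (2 * s + 2 * \<delta>) * (norm h)\<^sup>2 \<le> h \<bullet> (X *v h)"
  proof (cases "h = 0")
    case False
    define c where "c = t / norm h"
    have c: "c > 0" "norm (c *\<^sub>R h) = t" using False t by (auto simp: c_def)
    have "- s * t\<^sup>2 - \<delta> * t\<^sup>2 \<le> (c\<^sup>2 * (h \<bullet> (X *v h))) / 2"
      using low[of "c *\<^sub>R h"] c(2) quadratic_form_scaleR[of c h X] by simp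
    moreover have "t\<^sup>2 = c\<^sup>2 * (norm h)\<^sup>2" using c by (simp add: power_mult_distrib[symmetric])
    ultimately have "c\<^sup>2 * (- (2 * s + 2 * \<delta>) * (norm h)\<^sup>2) \<le> c\<^sup>2 * (h \<bullet> (X *v h))" by (simp add: algebra_simps)
    then show ?thesis using c(1) by simp
  qed simp
qed

text \<open>With \<open>s = 3 / (2 \<epsilon>)\<close> the penalisation \<open>s/3 |z - w|\<^sup>2\<close> is the minimum over \<open>x\<close> and \<open>y\<close> of
  \<open>s (|z - x|\<^sup>2 + |x - y|\<^sup>2 + |y - w|\<^sup>2)\<close>, attained at the two points trisecting the segment from \<open>z\<close> to \<open>w\<close>;
  this gives exactly the constant \<open>3 / \<epsilon>\<close> of the structure conditions.\<close>

lemma theorem_on_sums_scale: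
  fixes u1 u2 :: "real^'n \<Rightarrow> real"
  assumes S: "compact S" and usc: "usc_on S u1" "usc_on S u2" and s: "s > 0" and hat: "zh \<in> S" "wh \<in> S"
    and max: "\<And>z w. z \<in> S \<Longrightarrow> w \<in> S \<Longrightarrow> u1 z + u2 w - s/3 * (norm (z - w))\<^sup>2 \<le> u1 zh + u2 wh - s/3 * (norm (zh - wh))\<^sup>2"
    and \<delta>: "0 < \<delta>" "\<delta> < 3 * s"
  defines "xh \<equiv> zh - (1/3) *\<^sub>R (zh - wh)" and "yh \<equiv> wh + (1/3) *\<^sub>R (zh - wh)"
  obtains x y P1 P2 X1 X2 w1 w2 where
    "norm (x - xh) < \<delta>" "norm (y - yh) < \<delta>"
    "norm (P1 - (2 * s) *\<^sub>R (x - y) - (2 * \<delta>) *\<^sub>R (x - xh)) < \<delta>"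
    "norm (P2 + (2 * s) *\<^sub>R (x - y) - (2 * \<delta>) *\<^sub>R (y - yh)) < \<delta>"
    "one_scale_jet S u1 s zh \<delta> x P1 X1 w1" "one_scale_jet S u2 s wh \<delta> y P2 X2 w2"
    "\<And>h k. h \<bullet> (X1 *v h) + k \<bullet> (X2 *v k) \<le> 2 * s * (norm (h - k))\<^sup>2 + 6 * \<delta> * ((norm h)\<^sup>2 + (norm k)\<^sup>2)"
proof -
  have ne: "S \<noteq> {}" using hat by auto
  obtain a1 p1 where qb1: "quad_bounded (4 * s) a1 p1"
    and lb1: "\<And>w x. w \<in> S \<Longrightarrow> u1 w \<le> a1 x + s * (norm (x - w))\<^sup>2"
    and ub1: "\<And>x z. \<exists>w\<in>S. a1 x \<le> u1 w - 4/5 * s * (norm (z - w))\<^sup>2 + 4 * s * (norm (x - z))\<^sup>2"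
    and rep1: "\<And>x. \<exists>z. \<exists>w\<in>S. a1 x = u1 w - 4/5 * s * (norm (z - w))\<^sup>2 + 4 * s * (norm (x - z))\<^sup>2
       \<and> p1 x = (8 * s) *\<^sub>R (x - z)"
    using lasry_lions[OF S ne usc(1) s] by metis
  obtain a2 p2 where qb2: "quad_bounded (4 * s) a2 p2"
    and lb2: "\<And>w x. w \<in> S \<Longrightarrow> u2 w \<le> a2 x + s * (norm (x - w))\<^sup>2"
    and ub2: "\<And>x z. \<exists>w\<in>S. a2 x \<le> u2 w - 4/5 * s * (norm (z - w))\<^sup>2 + 4 * s * (norm (x - z))\<^sup>2"
    and rep2: "\<And>x. \<exists>z. \<exists>w\<in>S. a2 x = u2 w - 4/5 * s * (norm (z - w))\<^sup>2 + 4 * s * (norm (x - z))\<^sup>2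
       \<and> p2 x = (8 * s) *\<^sub>R (x - z)"
    using lasry_lions[OF S ne usc(2) s] by metis
  have glob: "a1 x + a2 y - s * (norm (x - y))\<^sup>2 \<le> u1 zh + u2 wh - s/3 * (norm (zh - wh))\<^sup>2" for x y
  proof -
    \<comment> \<open>Quarter points: the two terms with factor \<open>4 * s\<close> use half of
      \<open>s * (norm (x - y))\<^sup>2\<close>, and the middle segment, of half the length and with
      coefficient \<open>2 * s\<close>, uses the rest. The weights 5/4, 1/2 and 5/4 add up to 3,
      whence the coefficient s/3.\<close>
    define z where "z = x + (1/4) *\<^sub>R (y - x)"
    define z' where "z' = y - (1/4) *\<^sub>R (y - x)"
    obtain w where w: "w \<in> S" "a1 x \<le> u1 w - 4/5 * s * (norm (z - w))\<^sup>2 + 4 * s * (norm (x - z))\<^sup>2"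
      using ub1 by blast
    obtain w' where w': "w' \<in> S" "a2 y \<le> u2 w' - 4/5 * s * (norm (z' - w'))\<^sup>2 + 4 * s * (norm (y - z'))\<^sup>2"
      using ub2 by blast
    have v: "x - z = (1/4) *\<^sub>R (x - y)" "y - z' = (-1/4) *\<^sub>R (x - y)"
      by (simp_all add: z_def z'_def algebra_simps)
    have "x + c *\<^sub>R (y - x) - (y - c *\<^sub>R (y - x)) = (1 - c - c) *\<^sub>R (x - y)" for c
      unfolding scaleR_diff_left scaleR_one scaleR_diff_right by (simp add: add_diff_eq)
    from this[of "1/4"] have v3: "z - z' = (1/2) *\<^sub>R (x - y)"
      by (simp add: z_def z'_def)
    have n: "(norm (x - z))\<^sup>2 = 1/16 * (norm (x - y))\<^sup>2" "(norm (y - z'))\<^sup>2 = 1/16 * (norm (x - y))\<^sup>2" "(norm (z - z'))\<^sup>2 = 1/4 * (norm (x - y))\<^sup>2"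
      unfolding v v3 norm_scaleR by (simp_all add: power2_eq_square)
    have "1/3 * (norm (w - w'))\<^sup>2 \<le> 4/7 * (norm (w - z'))\<^sup>2 + 4/5 * (norm (z' - w'))\<^sup>2"
      using norm_add_sq_le_weighted[of "7/4" "5/4" "w - z'" "z' - w'"] by simp
    moreover have "4/7 * (norm (w - z'))\<^sup>2 \<le> 4/5 * (norm (w - z))\<^sup>2 + 2 * (norm (z - z'))\<^sup>2"
      using norm_add_sq_le_weighted[of "5/4" "1/2" "w - z" "z - z'"] by simp
    ultimately have "1/3 * (norm (w - w'))\<^sup>2 \<le> 4/5 * (norm (z - w))\<^sup>2 + 1/2 * (norm (x - y))\<^sup>2 + 4/5 * (norm (z' - w'))\<^sup>2"
      unfolding n(3) norm_minus_commute[of w z] by linarith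
    from mult_left_mono[OF this, of s] s
    have "s/3 * (norm (w - w'))\<^sup>2 \<le> 4/5 * s * (norm (z - w))\<^sup>2 + 1/2 * (s * (norm (x - y))\<^sup>2) + 4/5 * s * (norm (z' - w'))\<^sup>2"
      by (simp add: algebra_simps)
    moreover have "4 * s * (norm (x - z))\<^sup>2 = 1/4 * (s * (norm (x - y))\<^sup>2)" "4 * s * (norm (y - z'))\<^sup>2 = 1/4 * (s * (norm (x - y))\<^sup>2)"
      unfolding n by simp_all
    ultimately show ?thesis using w(2) w'(2) max[OF w(1) w'(1)] by linarith
  qed
  have hatv: "u1 zh + u2 wh - s/3 * (norm (zh - wh))\<^sup>2 \<le> a1 xh + a2 yh - s * (norm (xh - yh))\<^sup>2"
  proof -
    have "xh - zh = (-1/3) *\<^sub>R (zh - wh)" "yh - wh = (1/3) *\<^sub>R (zh - wh)"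
      by (simp_all add: xh_def yh_def)
    moreover have "xh - yh = (1/3) *\<^sub>R (zh - wh)"
    proof -
      have "xh - yh = (1 - 1/3 - 1/3) *\<^sub>R (zh - wh)" unfolding xh_def yh_def by (simp only: scaleR_diff_left) simp
      then show ?thesis by simp
    qed
    ultimately have n: "(norm (xh - zh))\<^sup>2 = 1/9 * (norm (zh - wh))\<^sup>2" "(norm (yh - wh))\<^sup>2 = 1/9 * (norm (zh - wh))\<^sup>2" "(norm (xh - yh))\<^sup>2 = 1/9 * (norm (zh - wh))\<^sup>2"
      by (simp_all add: power2_eq_square)
    show ?thesis using lb1[OF hat(1), of xh] lb2[OF hat(2), of yh] unfolding n by simp
  qed
  \<comment> \<open>The term with \<delta> gives the maximum at \<open>(xh, yh)\<close> the
    quadratic decay that the tilting argument requires.\<close>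
  define F where "F \<zeta> = a1 (fst \<zeta>) + a2 (snd \<zeta>) - s * (norm (fst \<zeta> - snd \<zeta>))\<^sup>2 - \<delta> * (norm (\<zeta> - (xh, yh)))\<^sup>2" for \<zeta>
  define pF where "pF \<zeta> = (p1 (fst \<zeta>) - (2 * s) *\<^sub>R (fst \<zeta> - snd \<zeta>) - (2 * \<delta>) *\<^sub>R (fst \<zeta> - xh),
      p2 (snd \<zeta>) + (2 * s) *\<^sub>R (fst \<zeta> - snd \<zeta>) - (2 * \<delta>) *\<^sub>R (snd \<zeta> - yh))" for \<zeta>
  have Fexp: "F ((x, y) + (h, k)) - F (x, y) - pF (x, y) \<bullet> (h, k) =
      (a1 (x + h) - a1 x - p1 x \<bullet> h) + (a2 (y + k) - a2 y - p2 y \<bullet> k) - s * (norm (h - k))\<^sup>2 - \<delta> * ((norm h)\<^sup>2 + (norm k)\<^sup>2)" for x y h k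
    unfolding F_def pF_def norm_prod_sq power2_norm_eq_inner
    by (simp add: inner_expand)
  have qbF: "quad_bounded (6 * s + \<delta>) F pF"
    unfolding quad_bounded_def
  proof (intro allI)
    fix \<zeta> H :: "(real^'n) \<times> (real^'n)"
    obtain x y h k where zH: "\<zeta> = (x, y)" "H = (h, k)" by (cases \<zeta>, cases H)
    have "\<bar>a1 (x + h) - a1 x - p1 x \<bullet> h\<bar> \<le> 4 * s * (norm h)\<^sup>2" "\<bar>a2 (y + k) - a2 y - p2 y \<bullet> k\<bar> \<le> 4 * s * (norm k)\<^sup>2"
      using qb1 qb2 by (auto simp: quad_bounded_def)
    moreover have "s * (norm (h - k))\<^sup>2 \<le> s * (2 * (norm h)\<^sup>2 + 2 * (norm k)\<^sup>2)"
      using norm_add_sq_le_weighted[of 1 1 h "- k"] s by (intro mult_left_mono) auto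
    moreover have "s * (norm (h - k))\<^sup>2 \<ge> 0" "\<delta> * ((norm h)\<^sup>2 + (norm k)\<^sup>2) \<ge> 0" using s \<delta> by auto
    moreover have "(6 * s + \<delta>) * (norm H)\<^sup>2 = 4 * s * (norm h)\<^sup>2 + 4 * s * (norm k)\<^sup>2 + s * (2 * (norm h)\<^sup>2 + 2 * (norm k)\<^sup>2) + \<delta> * ((norm h)\<^sup>2 + (norm k)\<^sup>2)"
      unfolding zH norm_prod_sq by (simp add: algebra_simps)
    ultimately show "\<bar>F (\<zeta> + H) - F \<zeta> - pF \<zeta> \<bullet> H\<bar> \<le> (6 * s + \<delta>) * (norm H)\<^sup>2"
      unfolding zH Fexp by linarith
  qed
  have "F \<zeta> \<le> F (xh, yh) - \<delta> * (norm (\<zeta> - (xh, yh)))\<^sup>2" for \<zeta>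
    using order_trans[OF glob[of "fst \<zeta>" "snd \<zeta>"] hatv] by (simp add: F_def)
  from jensen_alexandrov[OF qbF \<delta>(1) \<delta>(1) this]
  obtain \<zeta> t T where z: "norm (\<zeta> - (xh, yh)) < \<delta>" "norm (pF \<zeta>) < \<delta>" and t: "0 < t" "t < \<delta>" and T: "linear T"
    and contact: "\<And>y. F y \<le> F \<zeta> + pF \<zeta> \<bullet> (y - \<zeta>)"
    and expn: "\<And>h. norm h \<le> t \<Longrightarrow> \<bar>F (\<zeta> + h) - F \<zeta> - pF \<zeta> \<bullet> h - (h \<bullet> T h) / 2\<bar> \<le> \<delta> * t\<^sup>2"
    by metis
  obtain x y where xy: "\<zeta> = (x, y)" by (cases \<zeta>)
  have contact': "(a1 (x + h) - a1 x - p1 x \<bullet> h) + (a2 (y + k) - a2 y - p2 y \<bullet> k) \<le> s * (norm (h - k))\<^sup>2 + \<delta> * ((norm h)\<^sup>2 + (norm k)\<^sup>2)" for h k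
    using contact[of "(x, y) + (h, k)"] Fexp[of x y h k] unfolding xy by simp
  \<comment> \<open>This is where \<delta> < 3 s enters: the paraboloid above each function is
    flatter than those of the inf-convolution.\<close>
  have C: "s + \<delta> < 4 * s" using \<delta> by simp
  have "a1 y' \<le> a1 x + p1 x \<bullet> (y' - x) + (s + \<delta>) * (norm (y' - x))\<^sup>2" for y'
    using contact'[of "y' - x" 0] by (simp add: algebra_simps)
  from lasry_lions_contact[OF s lb1 rep1 this C]
  obtain w1 where w1: "w1 \<in> S" "a1 x = u1 w1 - s * (norm (x - w1))\<^sup>2" "p1 x = (2 * s) *\<^sub>R (w1 - x)" by blast
  have "a2 y' \<le> a2 y + p2 y \<bullet> (y' - y) + (s + \<delta>) * (norm (y' - y))\<^sup>2" for y'
    using contact'[of 0 "y' - y"] by (simp add: norm_minus_commute algebra_simps)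
  from lasry_lions_contact[OF s lb2 rep2 this C]
  obtain w2 where w2: "w2 \<in> S" "a2 y = u2 w2 - s * (norm (y - w2))\<^sup>2" "p2 y = (2 * s) *\<^sub>R (w2 - y)" by blast
  have T_left: "T (a + b, 0) = T (a, 0) + T (b, 0)" "T (r *\<^sub>R a, 0) = r *\<^sub>R T (a, 0)" for a b r
    using linear_add[OF T, of "(a, 0)" "(b, 0)"] linear_scale[OF T, of r "(a, 0)"] by simp_all
  have T_right: "T (0, a + b) = T (0, a) + T (0, b)" "T (0, r *\<^sub>R a) = r *\<^sub>R T (0, a)" for a b r
    using linear_add[OF T, of "(0, a)" "(0, b)"] linear_scale[OF T, of r "(0, a)"] by simp_all
  \<comment> \<open>A diagonal block of \<open>T\<close> with the Hessian
    \<open>2 * (s + \<delta>)\<close> of the subtracted quadratics added back: the second order part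
    of \<open>a1\<close> alone.\<close>
  have "linear (\<lambda>h. fst (T (h, 0)) + (2 * (s + \<delta>)) *\<^sub>R h)"
    by (rule linearI) (simp_all add: T_left scaleR_add_right)
  from symmetric_matrix_of_quadratic_form[OF this] obtain X1 where X1: "X1 \<in> sym_mats"
    "\<And>h. h \<bullet> (X1 *v h) = h \<bullet> (fst (T (h, 0)) + (2 * (s + \<delta>)) *\<^sub>R h)" by blast
  have "linear (\<lambda>k. snd (T (0, k)) + (2 * (s + \<delta>)) *\<^sub>R k)"
    by (rule linearI) (simp_all add: T_right scaleR_add_right)
  from symmetric_matrix_of_quadratic_form[OF this] obtain X2 where X2: "X2 \<in> sym_mats"
    "\<And>k. k \<bullet> (X2 *v k) = k \<bullet> (snd (T (0, k)) + (2 * (s + \<delta>)) *\<^sub>R k)" by blast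
  note X = X1(1) X2(1) and Xq = X1(2) X2(2)
  have e1: "\<bar>a1 (x + h) - a1 x - p1 x \<bullet> h - (h \<bullet> (X1 *v h)) / 2\<bar> \<le> \<delta> * t\<^sup>2" if "norm h \<le> t" for h
  proof -
    have "norm ((h, 0) :: (real^'n) \<times> (real^'n)) \<le> t" using that by (simp add: norm_Pair)
    from expn[OF this] show ?thesis unfolding xy Fexp Xq
      by (simp add: inner_prod_def inner_add_right power2_norm_eq_inner algebra_simps add_divide_distrib)
  qed
  have e2: "\<bar>a2 (y + k) - a2 y - p2 y \<bullet> k - (k \<bullet> (X2 *v k)) / 2\<bar> \<le> \<delta> * t\<^sup>2" if "norm k \<le> t" for k
  proof -
    have "norm ((0, k) :: (real^'n) \<times> (real^'n)) \<le> t" using that by (simp add: norm_Pair)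
    from expn[OF this] show ?thesis unfolding xy Fexp Xq
      by (simp add: inner_prod_def inner_add_right power2_norm_eq_inner algebra_simps add_divide_distrib)
  qed
  show thesis
  proof (rule that[of x y "p1 x" "p2 y" X1 w1 X2 w2])
    show "norm (x - xh) < \<delta>" "norm (y - yh) < \<delta>"
      using z(1) norm_fst_le[of "x - xh" "y - yh"] norm_snd_le[of "y - yh" "x - xh"] by (simp_all add: xy)
    show "norm (p1 x - (2 * s) *\<^sub>R (x - y) - (2 * \<delta>) *\<^sub>R (x - xh)) < \<delta>"
      "norm (p2 y + (2 * s) *\<^sub>R (x - y) - (2 * \<delta>) *\<^sub>R (y - yh)) < \<delta>"
      using z(2) norm_fst_le[of "fst (pF \<zeta>)" "snd (pF \<zeta>)"] norm_snd_le[of "snd (pF \<zeta>)" "fst (pF \<zeta>)"]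
      unfolding prod.collapse by (simp_all add: xy pF_def)
    show "one_scale_jet S u1 s zh \<delta> x (p1 x) X1 w1" by (rule one_scale_jetI[where a=a1, OF lb1 hat(1) t X(1) w1 e1])
    show "one_scale_jet S u2 s wh \<delta> y (p2 y) X2 w2" by (rule one_scale_jetI[where a=a2, OF lb2 hat(2) t X(2) w2 e2])
    fix h k :: "real^'n"
    show "h \<bullet> (X1 *v h) + k \<bullet> (X2 *v k) \<le> 2 * s * (norm (h - k))\<^sup>2 + 6 * \<delta> * ((norm h)\<^sup>2 + (norm k)\<^sup>2)"
    proof (cases "(h, k) = 0")
      case False
      \<comment> \<open>The pair is rescaled to the norm \<open>t\<close>. There the contact
        inequality contributes \<delta> and the two expansion errors \<open>2 * \<delta>\<close>;
        clearing the factor 1/2 gives \<open>6 * \<delta>\<close>.\<close>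
      define c where "c = t / norm (h, k)"
      have "norm (h, k) > 0" using False by simp
      then have c: "c > 0" "norm (c *\<^sub>R (h, k)) = t" using t unfolding norm_scaleR by (simp_all add: c_def)
      have hk: "norm (c *\<^sub>R h) \<le> t" "norm (c *\<^sub>R k) \<le> t"
        using norm_fst_le[of "c *\<^sub>R h" "c *\<^sub>R k"] norm_snd_le[of "c *\<^sub>R k" "c *\<^sub>R h"] c(2) by (simp_all only: scaleR_Pair)
      have "(c\<^sup>2 * (h \<bullet> (X1 *v h))) / 2 + (c\<^sup>2 * (k \<bullet> (X2 *v k))) / 2 \<le> s * (norm (c *\<^sub>R h - c *\<^sub>R k))\<^sup>2 + \<delta> * ((norm (c *\<^sub>R h))\<^sup>2 + (norm (c *\<^sub>R k))\<^sup>2) + 2 * \<delta> * t\<^sup>2"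
        using e1[OF hk(1)] e2[OF hk(2)] contact'[of "c *\<^sub>R h" "c *\<^sub>R k"] unfolding quadratic_form_scaleR abs_le_iff by linarith
      moreover have "t\<^sup>2 = c\<^sup>2 * ((norm h)\<^sup>2 + (norm k)\<^sup>2)"
        unfolding c(2)[symmetric] norm_prod_sq by (simp add: power_mult_distrib distrib_left)
      moreover have "(norm (c *\<^sub>R h - c *\<^sub>R k))\<^sup>2 = c\<^sup>2 * (norm (h - k))\<^sup>2"
        unfolding scaleR_diff_right[symmetric] by (simp add: power_mult_distrib)
      ultimately have "c\<^sup>2 * (h \<bullet> (X1 *v h) + k \<bullet> (X2 *v k)) \<le> c\<^sup>2 * (2 * s * (norm (h - k))\<^sup>2 + 6 * \<delta> * ((norm h)\<^sup>2 + (norm k)\<^sup>2))"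
        by (simp add: power_mult_distrib algebra_simps)
      then show ?thesis using c(1) by simp
    qed (simp add: zero_prod_def)
  qed
qed

section \<open>Passage to the limit as the scale shrinks\<close>

lemma tendsto_matrix_vector_mult:
  fixes A :: "'b \<Rightarrow> real^'n^'m"
  assumes "(A \<longlongrightarrow> A0) F" "(v \<longlongrightarrow> v0) F"
  shows "((\<lambda>k. A k *v v k) \<longlongrightarrow> A0 *v v0) F"
  unfolding matrix_vector_mult_def
  by (intro tendsto_vec_lambda tendsto_sum tendsto_mult tendsto_vec_nth assms)

lemma sym_mats_limit:
  fixes X :: "nat \<Rightarrow> real^'n^'n"
  assumes "\<And>k. X k \<in> sym_mats" "X \<longlonglongrightarrow> X0" shows "X0 \<in> sym_mats"
proof -
  have "X0 $ j $ i = X0 $ i $ j" for i j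
  proof (rule LIMSEQ_unique)
    show "(\<lambda>k. X k $ i $ j) \<longlonglongrightarrow> X0 $ i $ j" by (intro tendsto_vec_nth assms)
    have "X k $ i $ j = X k $ j $ i" for k
      using assms(1)[of k] by (simp add: sym_mats_def transpose_def vec_eq_iff)
    then show "(\<lambda>k. X k $ i $ j) \<longlonglongrightarrow> X0 $ j $ i"
      by (simp add: tendsto_vec_nth assms(2))
  qed
  then show ?thesis by (simp add: sym_mats_def transpose_def vec_eq_iff)
qed

lemma sym_mats_norm_bound:
  fixes X :: "real^'n^'n"
  assumes X: "X \<in> sym_mats" and b: "\<And>h. \<bar>h \<bullet> (X *v h)\<bar> \<le> C * (norm h)\<^sup>2"
  shows "norm X \<le> real CARD('n) * (real CARD('n) * (2 * C))"
proof -
  have C: "C \<ge> 0" using order_trans[OF abs_ge_zero b[of "axis undefined 1"]] by simp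
  have ent: "\<bar>X $ i $ j\<bar> \<le> 2 * C" for i j
  proof -
    define e :: "'n \<Rightarrow> real^'n" where "e i = axis i 1" for i
    have Xij: "X $ i $ j = e i \<bullet> (X *v e j)"
      by (simp add: e_def matrix_vector_mul_component inner_axis' row_def column_def matrix_vector_mult_basis)
    have comm: "e j \<bullet> (X *v e i) = e i \<bullet> (X *v e j)"
      using sym_mats_inner_commute[OF X, of "e j" "e i"] by (simp add: inner_commute)
    have 4: "4 * (X $ i $ j) = (e i + e j) \<bullet> (X *v (e i + e j)) - (e i - e j) \<bullet> (X *v (e i - e j))"
      unfolding Xij by (simp add: matrix_vector_right_distrib matrix_vector_mult_diff_distrib inner_add_left inner_add_right inner_diff_left inner_diff_right comm)
    have ne: "norm (e i) = 1" for i by (simp add: e_def)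
    have "(norm (e i + e j))\<^sup>2 \<le> 2\<^sup>2" "(norm (e i - e j))\<^sup>2 \<le> 2\<^sup>2"
      using power_mono[OF norm_triangle_ineq[of "e i" "e j"] norm_ge_zero, of 2]
        power_mono[OF norm_triangle_ineq4[of "e i" "e j"] norm_ge_zero, of 2] by (simp_all add: ne)
    then have "C * (norm (e i + e j))\<^sup>2 \<le> C * 4" "C * (norm (e i - e j))\<^sup>2 \<le> C * 4"
      using C by (auto intro!: mult_left_mono)
    then show ?thesis using 4 b[of "e i + e j"] b[of "e i - e j"] by linarith
  qed
  have "norm X \<le> (\<Sum>i\<in>UNIV. norm (X $ i))" unfolding norm_vec_def by (rule L2_set_le_sum) simp
  also have "\<dots> \<le> (\<Sum>i\<in>(UNIV::'n set). \<Sum>j\<in>(UNIV::'n set). 2 * C)"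
    by (intro sum_mono order_trans[OF norm_le_l1_cart] ent)
  finally show ?thesis by simp
qed

lemma usc_seq_upper:
  fixes u :: "'a::metric_space \<Rightarrow> real"
  assumes "usc_on S u" "x \<in> S" "\<And>k. w k \<in> S" "w \<longlonglongrightarrow> x" "c > u x"
  shows "\<forall>\<^sub>F k in sequentially. u (w k) < c"
proof -
  obtain d where d: "d > 0" "\<And>y. y \<in> S \<Longrightarrow> dist y x < d \<Longrightarrow> u y < c"
    using assms(1,2,5) unfolding usc_on_iff by blast
  show ?thesis using tendstoD[OF assms(4) d(1)] by eventually_elim (use d assms(3) in blast)
qed

text \<open>The identity \<open>P = (2 * s) *\<^sub>R (w - x)\<close> determines the contact points
  from \<open>x\<close> and \<open>P\<close>, so they converge to \<open>zh\<close>. Semicontinuity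
  bounds the limit of the values only from above; the lower bound \<open>b\<close> comes from the
  value inequality of the approximate jets.\<close>

lemma touch_limit:
  fixes u :: "real^'n \<Rightarrow> real"
  assumes S: "compact S" "usc_on S u" and s: "s > 0" and zh: "zh \<in> S"
    and \<delta>: "\<And>k. \<delta> k > 0" "\<delta> \<longlonglongrightarrow> 0"
    and jet: "\<And>k. one_scale_jet S u s zh (\<delta> k) (x k) (P k) (X k) (w k)"
    and lim: "X \<longlonglongrightarrow> Xh" "x \<longlonglongrightarrow> xh" "P \<longlonglongrightarrow> ph" and zhx: "ph = (2 * s) *\<^sub>R (zh - xh)"
  obtains w' P' X' where "\<And>k. w' k \<in> S" "w' \<longlonglongrightarrow> zh" "(\<lambda>k. u (w' k)) \<longlonglongrightarrow> u zh" "P' \<longlonglongrightarrow> ph"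
    "\<And>k. X' k \<in> sym_mats" "X' \<longlonglongrightarrow> Xh" "\<And>k. touched_above S u (w' k) (P' k) (X' k)"
proof -
  have X: "X k \<in> sym_mats" and w: "w k \<in> S" and P: "P k = (2 * s) *\<^sub>R (w k - x k)"
    and val: "u zh - s * (norm (x k - zh))\<^sup>2 \<le> u (w k) - s * (norm (x k - w k))\<^sup>2" for k
    using jet unfolding one_scale_jet_def by blast+
  define X' where "X' k = X k + (4 * \<delta> k) *\<^sub>R mat 1" for k
  have X's: "X' k \<in> sym_mats" for k
    unfolding X'_def by (intro sym_mats_add X sym_mats_scaleR sym_mats_mat)
  have "X' \<longlonglongrightarrow> Xh + (4 * 0) *\<^sub>R mat 1"
    unfolding X'_def by (intro tendsto_intros lim \<delta>)
  then have X'l: "X' \<longlonglongrightarrow> Xh" by simp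
  have "\<exists>w'. w' \<in> S \<and> norm (w' - w k) < \<delta> k \<and> u (w k) + P k \<bullet> (w' - w k) + ((w' - w k) \<bullet> (X' k *v (w' - w k))) / 2 \<le> u w' \<and>
     touched_above S u w' (P k + X' k *v (w' - w k)) (X' k)" for k
  proof -
    obtain t where t: "t > 0" "t < \<delta> k"
      and ub: "\<And>h. norm h \<le> t \<Longrightarrow> w k + h \<in> S \<Longrightarrow> u (w k + h) \<le> u (w k) + P k \<bullet> h + (h \<bullet> (X k *v h)) / 2 + \<delta> k * t\<^sup>2"
      using jet[of k] unfolding one_scale_jet_def by blast
    obtain w' where "w' \<in> S" "norm (w' - w k) < t"
      "u (w k) + P k \<bullet> (w' - w k) + ((w' - w k) \<bullet> (X' k *v (w' - w k))) / 2 \<le> u w'"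
      "touched_above S u w' (P k + X' k *v (w' - w k)) (X' k)"
      unfolding X'_def by (rule one_scale_touch[OF S w t(1) \<delta>(1) X ub])
    then show ?thesis using t(2) by (intro exI[of _ w']) auto
  qed
  then obtain w' where w'S: "\<And>k. w' k \<in> S" and near: "\<And>k. norm (w' k - w k) < \<delta> k"
    and low: "\<And>k. u (w k) + P k \<bullet> (w' k - w k) + ((w' k - w k) \<bullet> (X' k *v (w' k - w k))) / 2 \<le> u (w' k)"
    and touch: "\<And>k. touched_above S u (w' k) (P k + X' k *v (w' k - w k)) (X' k)"
    by metis
  define P' where "P' k = P k + X' k *v (w' k - w k)" for k
  have d0: "(\<lambda>k. w' k - w k) \<longlonglongrightarrow> 0"
  proof (rule Lim_null_comparison[OF _ \<delta>(2)])
    have "norm (w' k - w k) \<le> \<delta> k" for k using near[of k] by simp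
    then show "\<forall>\<^sub>F k in sequentially. norm (w' k - w k) \<le> \<delta> k" by simp
  qed
  have "w = (\<lambda>k. x k + (1 / (2 * s)) *\<^sub>R P k)" using s by (simp add: P)
  moreover have "(\<lambda>k. x k + (1 / (2 * s)) *\<^sub>R P k) \<longlonglongrightarrow> xh + (1 / (2 * s)) *\<^sub>R ph"
    by (intro tendsto_intros lim)
  ultimately have wl: "w \<longlonglongrightarrow> zh" using s by (simp add: zhx)
  have "(\<lambda>k. w k + (w' k - w k)) \<longlonglongrightarrow> zh + 0" by (intro tendsto_add wl d0)
  then have w'l: "w' \<longlonglongrightarrow> zh" by simp
  have "P' \<longlonglongrightarrow> ph + Xh *v 0"
    unfolding P'_def by (intro tendsto_add lim tendsto_matrix_vector_mult X'l d0)
  then have P'l: "P' \<longlonglongrightarrow> ph" by simp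
  define b where "b k = u zh - s * (norm (x k - zh))\<^sup>2 + s * (norm (x k - w k))\<^sup>2 + P k \<bullet> (w' k - w k) + ((w' k - w k) \<bullet> (X' k *v (w' k - w k))) / 2" for k
  have "b \<longlonglongrightarrow> u zh - s * (norm (xh - zh))\<^sup>2 + s * (norm (xh - zh))\<^sup>2 + ph \<bullet> 0 + (0 \<bullet> (Xh *v 0)) / 2"
    unfolding b_def by (intro tendsto_intros lim wl d0 tendsto_matrix_vector_mult X'l) auto
  then have bl: "b \<longlonglongrightarrow> u zh" by simp
  have bu: "b k \<le> u (w' k)" for k using low[of k] val[of k] by (simp add: b_def)
  have "(\<lambda>k. u (w' k)) \<longlonglongrightarrow> u zh"
  proof (rule order_tendstoI)
    fix c assume "c < u zh"
    from order_tendstoD(1)[OF bl this] show "\<forall>\<^sub>F k in sequentially. c < u (w' k)"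
      by eventually_elim (use bu in \<open>meson less_le_trans\<close>)
  qed (rule usc_seq_upper[OF S(2) zh w'S w'l])
  then show thesis
    by (rule that[of w' P' X', OF w'S w'l _ P'l X's X'l]) (use touch in \<open>simp add: P'_def\<close>)
qed

text \<open>A compactness argument over \<delta> tending to 0. Each matrix is bounded below by its
  jet and above by the joint inequality with the other vector set to zero, so a subsequence
  converges. The lower block bound is just the sum of the two separate ones.\<close>

theorem theorem_on_sums:
  fixes u1 u2 :: "real^'n \<Rightarrow> real"
  assumes S: "compact S" and usc: "usc_on S u1" "usc_on S u2" and s: "s > 0" and hat: "zh \<in> S" "wh \<in> S"
    and max: "\<And>z w. z \<in> S \<Longrightarrow> w \<in> S \<Longrightarrow> u1 z + u2 w - s/3 * (norm (z - w))\<^sup>2 \<le> u1 zh + u2 wh - s/3 * (norm (zh - wh))\<^sup>2"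
  defines "ph \<equiv> (2 * s / 3) *\<^sub>R (zh - wh)"
  obtains w1 w2 P1 P2 X1 X2 Y1 Y2 where
    "\<And>k. w1 k \<in> S" "w1 \<longlonglongrightarrow> zh" "(\<lambda>k. u1 (w1 k)) \<longlonglongrightarrow> u1 zh" "P1 \<longlonglongrightarrow> ph" "\<And>k. X1 k \<in> sym_mats" "X1 \<longlonglongrightarrow> Y1"
    "\<And>k. touched_above S u1 (w1 k) (P1 k) (X1 k)"
    "\<And>k. w2 k \<in> S" "w2 \<longlonglongrightarrow> wh" "(\<lambda>k. u2 (w2 k)) \<longlonglongrightarrow> u2 wh" "P2 \<longlonglongrightarrow> - ph" "\<And>k. X2 k \<in> sym_mats" "X2 \<longlonglongrightarrow> Y2"
    "\<And>k. touched_above S u2 (w2 k) (P2 k) (X2 k)"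
    "Y1 \<in> sym_mats" "Y2 \<in> sym_mats"
    "\<And>h k. - (2 * s) * ((norm h)\<^sup>2 + (norm k)\<^sup>2) \<le> h \<bullet> (Y1 *v h) + k \<bullet> (Y2 *v k)"
    "\<And>h k. h \<bullet> (Y1 *v h) + k \<bullet> (Y2 *v k) \<le> 2 * s * (norm (h - k))\<^sup>2"
proof -
  define xh where "xh = zh - (1/3) *\<^sub>R (zh - wh)"
  define yh where "yh = wh + (1/3) *\<^sub>R (zh - wh)"
  define \<delta> where "\<delta> k = s / real (Suc k)" for k
  have \<delta>: "0 < \<delta> k" "\<delta> k \<le> s" for k using s by (auto simp: \<delta>_def divide_simps)
  then have \<delta>3: "\<delta> k < 3 * s" for k using s by (smt (verit))
  have \<delta>0: "\<delta> \<longlonglongrightarrow> 0" unfolding \<delta>_def using LIMSEQ_Suc[OF lim_const_over_n[of s]] by simp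
  define Q where "Q k x y P1 P2 X1 X2 w1 w2 \<longleftrightarrow>
    norm (x - xh) < \<delta> k \<and> norm (y - yh) < \<delta> k \<and>
    norm (P1 - (2 * s) *\<^sub>R (x - y) - (2 * \<delta> k) *\<^sub>R (x - xh)) < \<delta> k \<and>
    norm (P2 + (2 * s) *\<^sub>R (x - y) - (2 * \<delta> k) *\<^sub>R (y - yh)) < \<delta> k \<and>
    one_scale_jet S u1 s zh (\<delta> k) x P1 X1 w1 \<and> one_scale_jet S u2 s wh (\<delta> k) y P2 X2 w2 \<and>
    (\<forall>h j. h \<bullet> (X1 *v h) + j \<bullet> (X2 *v j) \<le> 2 * s * (norm (h - j))\<^sup>2 + 6 * \<delta> k * ((norm h)\<^sup>2 + (norm j)\<^sup>2))"
    for k x y P1 P2 and X1 X2 :: "real^'n^'n" and w1 w2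
  have "\<exists>x y P1 P2 X1 X2 w1 w2. Q k x y P1 P2 X1 X2 w1 w2" for k
  proof (rule theorem_on_sums_scale[OF S usc s hat _ \<delta>(1)[of k] \<delta>3[of k]], goal_cases)
    case (1 z w)
    then show ?case by (rule max)
  next
    case (2 x y P1 P2 X1 X2 w1 w2)
    have "Q k x y P1 P2 X1 X2 w1 w2"
      unfolding Q_def xh_def yh_def by (intro conjI allI impI; rule 2; assumption)
    then show ?case by blast
  qed
  then obtain x y P1 P2 X1 X2 w1 w2 where "\<And>k. Q k (x k) (y k) (P1 k) (P2 k) (X1 k) (X2 k) (w1 k) (w2 k)"
    by metis
  then have Qn: "norm (x k - xh) < \<delta> k" "norm (y k - yh) < \<delta> k"
    "norm (P1 k - (2 * s) *\<^sub>R (x k - y k) - (2 * \<delta> k) *\<^sub>R (x k - xh)) < \<delta> k"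
    "norm (P2 k + (2 * s) *\<^sub>R (x k - y k) - (2 * \<delta> k) *\<^sub>R (y k - yh)) < \<delta> k"
    and jet: "one_scale_jet S u1 s zh (\<delta> k) (x k) (P1 k) (X1 k) (w1 k)" "one_scale_jet S u2 s wh (\<delta> k) (y k) (P2 k) (X2 k) (w2 k)"
    and upper: "h \<bullet> (X1 k *v h) + j \<bullet> (X2 k *v j) \<le> 2 * s * (norm (h - j))\<^sup>2 + 6 * \<delta> k * ((norm h)\<^sup>2 + (norm j)\<^sup>2)" for k h j
    unfolding Q_def by blast+
  have Qs: "X1 k \<in> sym_mats" "X2 k \<in> sym_mats"
    and lower: "- (2 * s + 2 * \<delta> k) * (norm h)\<^sup>2 \<le> h \<bullet> (X1 k *v h)" "- (2 * s + 2 * \<delta> k) * (norm h)\<^sup>2 \<le> h \<bullet> (X2 k *v h)" for k h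
    using jet unfolding one_scale_jet_def by blast+
  have \<delta>n: "\<delta> k * (norm h)\<^sup>2 \<le> s * (norm h)\<^sup>2" for k and h :: "real^'n" using \<delta>(2) by (intro mult_right_mono) auto
  \<comment> \<open>Here \<delta> \<le> s is used: \<open>2 * s + 6 * \<delta>\<close> is at most
    \<open>8 * s\<close>.\<close>
  have bd: "\<bar>h \<bullet> (X1 k *v h)\<bar> \<le> (8 * s) * (norm h)\<^sup>2" "\<bar>h \<bullet> (X2 k *v h)\<bar> \<le> (8 * s) * (norm h)\<^sup>2" for k h
    using lower[of k h] upper[of h k 0] upper[of 0 k h] \<delta>n[of k h] zero_le_mult_iff[of s "(norm h)\<^sup>2"] s
    by (auto simp: abs_le_iff algebra_simps)
  have "bounded (range (\<lambda>k. (X1 k, X2 k)))"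
  proof -
    let ?B = "real CARD('n) * (real CARD('n) * (2 * (8 * s)))"
    have "norm (X1 k) \<le> ?B" "norm (X2 k) \<le> ?B" for k
      by (intro sym_mats_norm_bound bd Qs)+
    then have "range (\<lambda>k. (X1 k, X2 k)) \<subseteq> cball 0 ?B \<times> cball 0 ?B" by auto
    then show ?thesis by (rule bounded_subset[rotated]) (intro bounded_Times bounded_cball)
  qed
  from bounded_imp_convergent_subsequence[OF this] obtain Y \<rho> where \<rho>: "strict_mono (\<rho> :: nat \<Rightarrow> nat)" "((\<lambda>k. (X1 k, X2 k)) \<circ> \<rho>) \<longlonglongrightarrow> Y"
    by blast
  define Y1 where "Y1 = fst Y"
  define Y2 where "Y2 = snd Y"
  have Y: "(\<lambda>k. X1 (\<rho> k)) \<longlonglongrightarrow> Y1" "(\<lambda>k. X2 (\<rho> k)) \<longlonglongrightarrow> Y2"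
    using tendsto_fst[OF \<rho>(2)] tendsto_snd[OF \<rho>(2)] by (simp_all add: Y1_def Y2_def)
  have \<delta>\<rho>: "(\<lambda>k. \<delta> (\<rho> k)) \<longlonglongrightarrow> 0" using LIMSEQ_subseq_LIMSEQ[OF \<delta>0 \<rho>(1)] by (simp add: o_def)
  have null: "f \<longlonglongrightarrow> a" if "\<And>k. norm (f k - a) < \<delta> k" for f and a :: "real^'n"
  proof -
    have "(\<lambda>k. f k - a) \<longlonglongrightarrow> 0"
      by (rule Lim_null_comparison[OF always_eventually \<delta>0]) (use that less_imp_le in blast)
    then show ?thesis by (rule LIM_zero_cancel)
  qed
  have x0: "x \<longlonglongrightarrow> xh" and y0: "y \<longlonglongrightarrow> yh" by (intro null Qn)+
  have xy: "xh - yh = (1/3) *\<^sub>R (zh - wh)"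
  proof -
    have "zh - c *\<^sub>R (zh - wh) - (wh + c *\<^sub>R (zh - wh)) = (1 - c - c) *\<^sub>R (zh - wh)" for c
      unfolding scaleR_diff_left scaleR_one by simp
    from this[of "1/3"] show ?thesis by (simp add: xh_def yh_def)
  qed
  have P10: "P1 \<longlonglongrightarrow> ph"
  proof -
    have "(\<lambda>k. P1 k - (2 * s) *\<^sub>R (x k - y k) - (2 * \<delta> k) *\<^sub>R (x k - xh)) \<longlonglongrightarrow> 0"
      by (rule null) (use Qn in simp)
    then have "(\<lambda>k. (P1 k - (2 * s) *\<^sub>R (x k - y k) - (2 * \<delta> k) *\<^sub>R (x k - xh)) + (2 * s) *\<^sub>R (x k - y k) + (2 * \<delta> k) *\<^sub>R (x k - xh))
      \<longlonglongrightarrow> 0 + (2 * s) *\<^sub>R (xh - yh) + (2 * 0) *\<^sub>R (xh - xh)"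
      by (intro tendsto_intros x0 y0 \<delta>0)
    then show ?thesis by (simp add: xy ph_def)
  qed
  have P20: "P2 \<longlonglongrightarrow> - ph"
  proof -
    have "(\<lambda>k. P2 k + (2 * s) *\<^sub>R (x k - y k) - (2 * \<delta> k) *\<^sub>R (y k - yh)) \<longlonglongrightarrow> 0"
      by (rule null) (use Qn in simp)
    then have "(\<lambda>k. (P2 k + (2 * s) *\<^sub>R (x k - y k) - (2 * \<delta> k) *\<^sub>R (y k - yh)) - (2 * s) *\<^sub>R (x k - y k) + (2 * \<delta> k) *\<^sub>R (y k - yh))
      \<longlonglongrightarrow> 0 - (2 * s) *\<^sub>R (xh - yh) + (2 * 0) *\<^sub>R (yh - yh)"
      by (intro tendsto_intros x0 y0 \<delta>0)
    then show ?thesis by (simp add: xy ph_def)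
  qed
  have sub: "(\<lambda>k. f (\<rho> k)) \<longlonglongrightarrow> a" if "f \<longlonglongrightarrow> a" for f and a :: "real^'n"
    using LIMSEQ_subseq_LIMSEQ[OF that \<rho>(1)] by (simp add: o_def)
  have e1: "ph = (2 * s) *\<^sub>R (zh - xh)" "- ph = (2 * s) *\<^sub>R (wh - yh)"
    by (simp_all add: ph_def xh_def yh_def)
  obtain w1' P1' X1' where 1: "\<And>k. w1' k \<in> S" "w1' \<longlonglongrightarrow> zh" "(\<lambda>k. u1 (w1' k)) \<longlonglongrightarrow> u1 zh" "P1' \<longlonglongrightarrow> ph"
    "\<And>k. X1' k \<in> sym_mats" "X1' \<longlonglongrightarrow> Y1" "\<And>k. touched_above S u1 (w1' k) (P1' k) (X1' k)"
    using touch_limit[OF S usc(1) s hat(1) \<delta>(1) \<delta>\<rho> jet(1) Y(1) sub[OF x0] sub[OF P10] e1(1)] by blast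
  obtain w2' P2' X2' where 2: "\<And>k. w2' k \<in> S" "w2' \<longlonglongrightarrow> wh" "(\<lambda>k. u2 (w2' k)) \<longlonglongrightarrow> u2 wh" "P2' \<longlonglongrightarrow> - ph"
    "\<And>k. X2' k \<in> sym_mats" "X2' \<longlonglongrightarrow> Y2" "\<And>k. touched_above S u2 (w2' k) (P2' k) (X2' k)"
    using touch_limit[OF S usc(2) s hat(2) \<delta>(1) \<delta>\<rho> jet(2) Y(2) sub[OF y0] sub[OF P20] e1(2)] by blast
  have lim: "(\<lambda>k. h \<bullet> (X1 (\<rho> k) *v h) + j \<bullet> (X2 (\<rho> k) *v j)) \<longlonglongrightarrow> h \<bullet> (Y1 *v h) + j \<bullet> (Y2 *v j)" for h j
    by (intro tendsto_intros tendsto_matrix_vector_mult Y)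
  show thesis
  proof (rule that[OF 1 2])
    show "Y1 \<in> sym_mats" "Y2 \<in> sym_mats" using sym_mats_limit[OF 1(5,6)] sym_mats_limit[OF 2(5,6)] by auto
    fix h j :: "real^'n"
    have "(\<lambda>k. 2 * s * (norm (h - j))\<^sup>2 + 6 * \<delta> (\<rho> k) * ((norm h)\<^sup>2 + (norm j)\<^sup>2)) \<longlonglongrightarrow> 2 * s * (norm (h - j))\<^sup>2 + 6 * 0 * ((norm h)\<^sup>2 + (norm j)\<^sup>2)"
      by (intro tendsto_intros \<delta>\<rho>)
    from LIMSEQ_le[OF lim this] upper show "h \<bullet> (Y1 *v h) + j \<bullet> (Y2 *v j) \<le> 2 * s * (norm (h - j))\<^sup>2" by simp
    have "(\<lambda>k. - (2 * s + 2 * \<delta> (\<rho> k)) * ((norm h)\<^sup>2 + (norm j)\<^sup>2)) \<longlonglongrightarrow> - (2 * s + 2 * 0) * ((norm h)\<^sup>2 + (norm j)\<^sup>2)"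
      by (intro tendsto_intros \<delta>\<rho>)
    moreover have "- (2 * s + 2 * \<delta> (\<rho> k)) * ((norm h)\<^sup>2 + (norm j)\<^sup>2) \<le> h \<bullet> (X1 (\<rho> k) *v h) + j \<bullet> (X2 (\<rho> k) *v j)" for k
      using add_mono[OF lower(1)[of "\<rho> k" h] lower(2)[of "\<rho> k" j]] by (simp only: distrib_left)
    ultimately show "- (2 * s) * ((norm h)\<^sup>2 + (norm j)\<^sup>2) \<le> h \<bullet> (Y1 *v h) + j \<bullet> (Y2 *v j)"
      using LIMSEQ_le[OF _ lim] by fastforce
  qed
qed

section \<open>The horizontal Hessian\<close>

lemma has_derivative_grad:
  fixes f :: "real^'n \<Rightarrow> real"
  assumes "f differentiable (at x)"
  shows "(f has_derivative (\<lambda>h. grad f x \<bullet> h)) (at x)"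
proof -
  let ?D = "frechet_derivative f (at x)"
  have D: "(f has_derivative ?D) (at x)" using assms frechet_derivative_works by blast
  then have lin: "linear ?D" by (rule has_derivative_linear)
  have "?D h = grad f x \<bullet> h" for h
  proof -
    have "?D h = ?D (\<Sum>i\<in>UNIV. h $ i *\<^sub>R axis i 1)" by (simp add: basis_expansion[where 'a=real, unfolded scalar_mult_eq_scaleR])
    also have "\<dots> = (\<Sum>i\<in>UNIV. h $ i * ?D (axis i 1))"
      by (simp add: linear_sum[OF lin] linear_scale[OF lin])
    also have "\<dots> = grad f x \<bullet> h" by (simp add: grad_def inner_vec_def mult.commute)
    finally show ?thesis .
  qed
  then have "?D = (\<lambda>h. grad f x \<bullet> h)" by auto
  then show ?thesis using D by simp
qed

lemma grad_eqI:
  fixes f :: "real^'n \<Rightarrow> real"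
  assumes "(f has_derivative (\<lambda>h. g \<bullet> h)) (at x)"
  shows "grad f x = g"
proof -
  have "frechet_derivative f (at x) = (\<lambda>h. g \<bullet> h)" using frechet_derivative_at[OF assms] by simp
  then show ?thesis by (simp add: grad_def vec_eq_iff inner_axis)
qed

definition quad_test :: "real^'n \<Rightarrow> real^'n \<Rightarrow> real^'n^'n \<Rightarrow> real^'n \<Rightarrow> real" where
  "quad_test w P X z = P \<bullet> (z - w) + ((z - w) \<bullet> (X *v (z - w))) / 2"

lemma affine_matrix_has_derivative:
  fixes X :: "real^'n^'m"
  shows "((\<lambda>z. X *v (z - w)) has_derivative (\<lambda>h. X *v h)) (at z)"
proof -
  have "((\<lambda>z. z - w) has_derivative (\<lambda>h. h)) (at z)" by (auto intro!: derivative_eq_intros)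
  from bounded_linear.has_derivative[OF matrix_vector_mul_bounded_linear this] show ?thesis .
qed

context
  fixes w P :: "real^'n" and X :: "real^'n^'n"
  assumes X: "X \<in> sym_mats"
begin

lemma quad_test_has_derivative:
  "(quad_test w P X has_derivative (\<lambda>h. (P + X *v (z - w)) \<bullet> h)) (at z)"
proof -
  have aff: "((\<lambda>z. z - w) has_derivative (\<lambda>h. h)) (at z)" by (auto intro!: derivative_eq_intros)
  have "((\<lambda>z. P \<bullet> (z - w) + (1/2) * ((z - w) \<bullet> (X *v (z - w)))) has_derivative
      (\<lambda>h. P \<bullet> h + (1/2) * ((z - w) \<bullet> (X *v h) + h \<bullet> (X *v (z - w))))) (at z)"
    by (intro has_derivative_add has_derivative_mult_right has_derivative_inner_right has_derivative_inner aff affine_matrix_has_derivative)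
  then show ?thesis
    using sym_mats_inner_commute[OF X, of "z - w"]
    by (simp add: quad_test_def[abs_def] inner_add_left inner_add_right inner_commute)
qed

lemma grad_quad_test: "grad (quad_test w P X) = (\<lambda>z. P + X *v (z - w))"
  by (rule ext) (rule grad_eqI[OF quad_test_has_derivative])

lemma grad_quad_test_has_derivative: "(grad (quad_test w P X) has_derivative (\<lambda>h. X *v h)) (at z)"
  unfolding grad_quad_test
  by (rule derivative_eq_intros affine_matrix_has_derivative refl)+ simp

lemma hessian_quad_test: "hessian (quad_test w P X) z = X"
  using frechet_derivative_at[OF grad_quad_test_has_derivative[of z]]
  by (simp add: hessian_def jacobian_def flip: frechet_derivative_at[OF grad_quad_test_has_derivative[of z]])

lemma C2_on_quad_test: "C2_on \<Omega> (quad_test w P X)"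
  unfolding C2_on_def hessian_quad_test
  using quad_test_has_derivative grad_quad_test_has_derivative
  by (auto simp: differentiable_def)

end

text \<open>The component \<open>a\<close> of the derivative of column \<open>j\<close> of \<sigma>
  in the direction of column \<open>i\<close>: the first order coefficients that make up Q.\<close>

definition vfield_coeff :: "(real^'n \<Rightarrow> real^'m^'n) \<Rightarrow> 'n \<Rightarrow> 'm \<Rightarrow> 'm \<Rightarrow> real^'n \<Rightarrow> real" where
  "vfield_coeff \<sigma> a j i z = grad (\<lambda>x. \<sigma> x $ a $ j) z \<bullet> column i (\<sigma> z)"

text \<open>The horizontal Hessian as a function of an arbitrary jet \<open>(p, X)\<close> at
  \<open>z\<close>, that is the conjugation of \<open>X\<close> by \<sigma> plus Q. Limiting jets
  belong to no test function, so this form is needed for them.\<close>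

definition horiz_hess :: "(real^'n \<Rightarrow> real^'m^'n) \<Rightarrow> real^'n \<Rightarrow> real^'n \<Rightarrow> real^'n^'n \<Rightarrow> real^'m^'m" where
  "horiz_hess \<sigma> z p X = (\<chi> i j. column i (\<sigma> z) \<bullet> (X *v column j (\<sigma> z))
     + (\<Sum>a\<in>UNIV. p $ a * (vfield_coeff \<sigma> a j i z + vfield_coeff \<sigma> a i j z)) / 2)"

text \<open>The first vector field applied to a quadratic is an explicit product at every point, so
  the second one only requires the product rule at \<open>w\<close>.\<close>

lemma D2X_quad_test:
  fixes \<sigma> :: "real^'n \<Rightarrow> real^'m^'n"
  assumes X: "X \<in> sym_mats" and diff: "\<And>a j. (\<lambda>x. \<sigma> x $ a $ j) differentiable (at w)"
  shows "D2X \<sigma> (quad_test w P X) w = horiz_hess \<sigma> w P X"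
proof -
  have vf: "vfield \<sigma> j (quad_test w P X) = (\<lambda>z. (P + X *v (z - w)) \<bullet> column j (\<sigma> z))" for j
    unfolding vfield_def
    using frechet_derivative_at[OF quad_test_has_derivative[OF X]] by (metis (no_types))
  have col: "((\<lambda>z. column j (\<sigma> z)) has_derivative (\<lambda>h. \<chi> a. grad (\<lambda>x. \<sigma> x $ a $ j) w \<bullet> h)) (at w)" for j
    unfolding column_def
    by (subst has_derivative_componentwise_within) (auto simp: Basis_vec_def inner_axis intro!: has_derivative_grad diff)
  have g: "((\<lambda>z. P + X *v (z - w)) has_derivative (\<lambda>h. X *v h)) (at w)"
    using grad_quad_test_has_derivative[OF X, of w P w] unfolding grad_quad_test[OF X] .
  have V: "vfield \<sigma> i (vfield \<sigma> j (quad_test w P X)) w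
      = column j (\<sigma> w) \<bullet> (X *v column i (\<sigma> w)) + (\<Sum>a\<in>UNIV. P $ a * vfield_coeff \<sigma> a j i w)" for i j
  proof -
    have D: "((\<lambda>z. (P + X *v (z - w)) \<bullet> column j (\<sigma> z)) has_derivative
        (\<lambda>h. (P + X *v (w - w)) \<bullet> (\<chi> a. grad (\<lambda>x. \<sigma> x $ a $ j) w \<bullet> h) + (X *v h) \<bullet> column j (\<sigma> w))) (at w)"
      by (rule has_derivative_inner[OF g col])
    show ?thesis
      unfolding vfield_def[of \<sigma> i] vf frechet_derivative_at[OF D, symmetric]
      by (simp add: vfield_coeff_def inner_vec_def[of P] inner_commute)
  qed
  have cm: "column j (\<sigma> w) \<bullet> (X *v column i (\<sigma> w)) = column i (\<sigma> w) \<bullet> (X *v column j (\<sigma> w))" for i j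
    by (subst sym_mats_inner_commute[OF X]) (rule inner_commute)
  show ?thesis
    unfolding D2X_def horiz_hess_def V vec_eq_iff vec_lambda_beta
  proof (intro allI)
    fix i j
    show "(column j (\<sigma> w) \<bullet> (X *v column i (\<sigma> w)) + (\<Sum>a\<in>UNIV. P $ a * vfield_coeff \<sigma> a j i w) +
         (column i (\<sigma> w) \<bullet> (X *v column j (\<sigma> w)) + (\<Sum>a\<in>UNIV. P $ a * vfield_coeff \<sigma> a i j w))) / 2 =
        column i (\<sigma> w) \<bullet> (X *v column j (\<sigma> w)) + (\<Sum>a\<in>UNIV. P $ a * (vfield_coeff \<sigma> a j i w + vfield_coeff \<sigma> a i j w)) / 2"
      using cm[of j i] by (simp add: distrib_left sum.distrib add_divide_distrib)
  qed
qed

lemma horiz_hess_sym: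
  assumes "X \<in> sym_mats" shows "horiz_hess \<sigma> z p X \<in> sym_mats"
proof -
  have "column j (\<sigma> z) \<bullet> (X *v column i (\<sigma> z)) = column i (\<sigma> z) \<bullet> (X *v column j (\<sigma> z))" for i j
    by (subst sym_mats_inner_commute[OF assms]) (rule inner_commute)
  then show ?thesis
    unfolding sym_mats_def mem_Collect_eq vec_eq_iff transpose_def horiz_hess_def vec_lambda_beta
    by (intro allI arg_cong2[where f="(+)"] arg_cong2[where f="(/)"] sum.cong refl arg_cong2[where f="(*)"] add.commute)
qed

text \<open>Exchanging \<open>i\<close> and \<open>j\<close> identifies the two halves of Q, so a
  single sum of coefficients remains.\<close>

lemma horiz_hess_quadratic_form:
  "\<xi> \<bullet> (horiz_hess \<sigma> z p X *v \<xi>) = (\<sigma> z *v \<xi>) \<bullet> (X *v (\<sigma> z *v \<xi>))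
     + (\<Sum>i\<in>UNIV. \<Sum>j\<in>UNIV. \<xi> $ i * \<xi> $ j * (\<Sum>a\<in>UNIV. p $ a * vfield_coeff \<sigma> a j i z))"
proof -
  have sv: "\<sigma> z *v \<xi> = (\<Sum>i\<in>UNIV. \<xi> $ i *\<^sub>R column i (\<sigma> z))"
    unfolding matrix_mult_sum scalar_mult_eq_scaleR ..
  have "(\<sigma> z *v \<xi>) \<bullet> (X *v (\<sigma> z *v \<xi>)) = (\<Sum>i\<in>UNIV. \<Sum>j\<in>UNIV. \<xi> $ i * \<xi> $ j * (column i (\<sigma> z) \<bullet> (X *v column j (\<sigma> z))))"
    unfolding sv
    by (subst sum.swap) (simp add: linear_sum[OF matrix_vector_mul_linear] inner_sum_left inner_sum_right matrix_vector_mult_scaleR sum_distrib_left mult_ac)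
  moreover have "\<xi> \<bullet> (horiz_hess \<sigma> z p X *v \<xi>) = (\<Sum>i\<in>UNIV. \<Sum>j\<in>UNIV. \<xi> $ i * \<xi> $ j * horiz_hess \<sigma> z p X $ i $ j)"
    by (simp add: inner_vec_def matrix_vector_mult_def sum_distrib_left mult_ac)
  moreover have "(\<Sum>i\<in>UNIV. \<Sum>j\<in>UNIV. \<xi> $ i * \<xi> $ j * (\<Sum>a\<in>UNIV. p $ a * vfield_coeff \<sigma> a i j z))
     = (\<Sum>i\<in>UNIV. \<Sum>j\<in>UNIV. \<xi> $ i * \<xi> $ j * (\<Sum>a\<in>UNIV. p $ a * vfield_coeff \<sigma> a j i z))"
    by (subst sum.swap) (simp add: mult_ac)
  ultimately show ?thesis
    by (simp add: horiz_hess_def distrib_left sum.distrib add_divide_distrib flip: sum_divide_distrib)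
qed

section \<open>Local Lipschitz estimates for the coefficients\<close>

lemma lipschitz_on_uniform:
  fixes f :: "'k::finite \<Rightarrow> 'a::metric_space \<Rightarrow> 'b::metric_space"
  assumes "\<And>k. \<exists>L. L-lipschitz_on S (f k)"
  shows "\<exists>L. \<forall>k. L-lipschitz_on S (f k)"
proof -
  obtain L where L: "\<And>k. (L k)-lipschitz_on S (f k)" using assms by metis
  have "L k \<le> (\<Sum>k\<in>UNIV. L k)" for k
    by (rule member_le_sum) (auto intro: lipschitz_on_nonneg[OF L])
  then show ?thesis using lipschitz_on_le[OF L] by blast
qed

lemma lipschitz_on_mult:
  fixes f g :: "'a::metric_space \<Rightarrow> real"
  assumes "L-lipschitz_on S f" "M-lipschitz_on S g" "compact S"
  shows "\<exists>N. N-lipschitz_on S (\<lambda>x. f x * g x)"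
proof -
  have "bounded (f ` S)" "bounded (g ` S)"
    using assms by (auto intro!: compact_imp_bounded compact_continuous_image lipschitz_on_continuous_on)
  then obtain A B where A: "\<And>x. x \<in> S \<Longrightarrow> \<bar>f x\<bar> \<le> A" and B: "\<And>x. x \<in> S \<Longrightarrow> \<bar>g x\<bar> \<le> B"
    unfolding bounded_iff by auto
  have L: "L \<ge> 0" "M \<ge> 0" using assms lipschitz_on_nonneg by auto
  have "(\<bar>A\<bar> * M + \<bar>B\<bar> * L)-lipschitz_on S (\<lambda>x. f x * g x)"
  proof (rule lipschitz_onI)
    fix x y assume xy: "x \<in> S" "y \<in> S"
    have "f x * g x - f y * g y = f x * (g x - g y) + g y * (f x - f y)" by (simp add: algebra_simps)
    then have "\<bar>f x * g x - f y * g y\<bar> \<le> \<bar>f x\<bar> * \<bar>g x - g y\<bar> + \<bar>g y\<bar> * \<bar>f x - f y\<bar>"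
      by (metis abs_mult abs_triangle_ineq)
    also have "\<dots> \<le> \<bar>A\<bar> * (M * dist x y) + \<bar>B\<bar> * (L * dist x y)"
      using A[OF xy(1)] B[OF xy(2)] lipschitz_onD[OF assms(1) xy] lipschitz_onD[OF assms(2) xy]
      by (intro add_mono mult_mono) (auto simp: dist_real_def)
    finally show "dist (f x * g x) (f y * g y) \<le> (\<bar>A\<bar> * M + \<bar>B\<bar> * L) * dist x y"
      by (simp add: dist_real_def algebra_simps)
  qed (use L in simp)
  then show ?thesis by blast
qed

lemma lipschitz_on_sum:
  fixes f :: "'k \<Rightarrow> 'a::metric_space \<Rightarrow> real"
  assumes "finite K" "\<And>k. k \<in> K \<Longrightarrow> \<exists>L. L-lipschitz_on S (f k)"
  shows "\<exists>L. L-lipschitz_on S (\<lambda>x. \<Sum>k\<in>K. f k x)"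
  using assms
proof (induction K rule: finite_induct)
  case empty
  then show ?case using lipschitz_on_constant by auto
next
  case (insert k K)
  then obtain L M where "L-lipschitz_on S (f k)" "M-lipschitz_on S (\<lambda>x. \<Sum>k\<in>K. f k x)" by blast
  from lipschitz_on_add[OF this] insert show ?case by auto
qed

lemma lipschitz_on_vec_nth:
  fixes f :: "'a::metric_space \<Rightarrow> real^'n"
  assumes "L-lipschitz_on S f" shows "L-lipschitz_on S (\<lambda>x. f x $ i)"
  using assms unfolding lipschitz_on_def
  by (meson dist_vec_nth_le order_trans)

text \<open>A bound on the gradient gives a Lipschitz bound on convex sets, and \<Omega> need not be
  convex. Balls suffice, because the doubled points concentrate at one interior point.\<close>

lemma C11_closure_lipschitz:
  fixes f :: "real^'n \<Rightarrow> real"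
  assumes f: "C11_closure \<Omega> f" and sub: "cball z r \<subseteq> \<Omega>"
  shows "\<exists>L. L-lipschitz_on (cball z r) f"
proof -
  obtain L where "L-lipschitz_on \<Omega> (grad f)" using f by (auto simp: C11_closure_def)
  then have "continuous_on (cball z r) (grad f)"
    using lipschitz_on_continuous_on continuous_on_subset sub by blast
  then have "bounded (grad f ` cball z r)"
    by (intro compact_imp_bounded compact_continuous_image) auto
  then obtain B where B: "\<And>x. x \<in> cball z r \<Longrightarrow> norm (grad f x) \<le> B"
    unfolding bounded_iff by (meson imageI)
  have "\<bar>B\<bar>-lipschitz_on (cball z r) f"
  proof (rule bounded_derivative_imp_lipschitz)
    fix x assume x: "x \<in> cball z r"
    then show "(f has_derivative (\<lambda>h. grad f x \<bullet> h)) (at x within cball z r)"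
      using f sub by (auto simp: C11_closure_def intro!: has_derivative_at_withinI has_derivative_grad)
    show "onorm (\<lambda>h. grad f x \<bullet> h) \<le> \<bar>B\<bar>"
    proof (rule onorm_le)
      fix h
      have "\<bar>grad f x \<bullet> h\<bar> \<le> norm (grad f x) * norm h" by (rule Cauchy_Schwarz_ineq2)
      also have "\<dots> \<le> \<bar>B\<bar> * norm h" using B[OF x] by (intro mult_right_mono) auto
      finally show "norm (grad f x \<bullet> h) \<le> \<bar>B\<bar> * norm h" by simp
    qed
  qed auto
  then show ?thesis by blast
qed

lemma vfield_coeff_lipschitz:
  fixes \<sigma> :: "real^'n \<Rightarrow> real^'m^'n"
  assumes \<sigma>: "\<forall>i j. C11_closure \<Omega> (\<lambda>x. \<sigma> x $ i $ j)" and sub: "cball z r \<subseteq> \<Omega>"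
  shows "\<exists>L. L-lipschitz_on (cball z r) (vfield_coeff \<sigma> a j i)"
proof -
  have eq: "vfield_coeff \<sigma> a j i = (\<lambda>x. \<Sum>b\<in>UNIV. grad (\<lambda>x. \<sigma> x $ a $ j) x $ b * (\<sigma> x $ b $ i))"
    by (simp add: fun_eq_iff vfield_coeff_def inner_vec_def column_def)
  show ?thesis unfolding eq
  proof (rule lipschitz_on_sum)
    fix b
    obtain L where "L-lipschitz_on \<Omega> (grad (\<lambda>x. \<sigma> x $ a $ j))" using \<sigma> unfolding C11_closure_def by blast
    then have "L-lipschitz_on (cball z r) (\<lambda>x. grad (\<lambda>x. \<sigma> x $ a $ j) x $ b)"
      by (intro lipschitz_on_vec_nth) (rule lipschitz_on_subset[OF _ sub])
    moreover obtain M where "M-lipschitz_on (cball z r) (\<lambda>x. \<sigma> x $ b $ i)"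
      using C11_closure_lipschitz[OF _ sub] \<sigma> by blast
    ultimately show "\<exists>N. N-lipschitz_on (cball z r) (\<lambda>x. grad (\<lambda>x. \<sigma> x $ a $ j) x $ b * \<sigma> x $ b $ i)"
      by (rule lipschitz_on_mult) simp
  qed simp
qed

lemma tendsto_horiz_hess:
  fixes \<sigma> :: "real^'n \<Rightarrow> real^'m^'n"
  assumes \<sigma>: "\<forall>i j. C11_closure \<Omega> (\<lambda>x. \<sigma> x $ i $ j)" and "open \<Omega>" "z0 \<in> \<Omega>"
    and lim: "w \<longlonglongrightarrow> z0" "P \<longlonglongrightarrow> p" "X \<longlonglongrightarrow> Y"
  shows "(\<lambda>k. horiz_hess \<sigma> (w k) (P k) (X k)) \<longlonglongrightarrow> horiz_hess \<sigma> z0 p Y"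
proof -
  obtain r where r: "r > 0" "cball z0 r \<subseteq> \<Omega>" using assms(2,3) open_contains_cball by blast
  have lipcont: "(\<lambda>k. f (w k)) \<longlonglongrightarrow> f z0" if "\<exists>L. L-lipschitz_on (cball z0 r) f" for f :: "real^'n \<Rightarrow> real"
  proof -
    have "continuous_on (cball z0 r) f" using that lipschitz_on_continuous_on by blast
    then have "isCont f z0" using r(1) by (intro continuous_on_interior[of "cball z0 r"]) auto
    then show ?thesis using lim(1) by (rule isCont_tendsto_compose)
  qed
  have "(\<lambda>k. \<sigma> (w k) $ a $ j) \<longlonglongrightarrow> \<sigma> z0 $ a $ j" for a j
    using lipcont[OF C11_closure_lipschitz[OF _ r(2)]] \<sigma> by blast
  then have col: "(\<lambda>k. column j (\<sigma> (w k))) \<longlonglongrightarrow> column j (\<sigma> z0)" for j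
    unfolding column_def by (intro tendsto_vec_lambda)
  have "(\<lambda>k. vfield_coeff \<sigma> a j i (w k)) \<longlonglongrightarrow> vfield_coeff \<sigma> a j i z0" for a i j
    by (rule lipcont[OF vfield_coeff_lipschitz[OF \<sigma> r(2)]])
  then show ?thesis
    unfolding horiz_hess_def
    by (intro tendsto_vec_lambda tendsto_add tendsto_inner tendsto_divide tendsto_sum tendsto_mult tendsto_vec_nth
        tendsto_matrix_vector_mult col lim tendsto_const) auto
qed

text \<open>Quantifying over all jets and all \<open>c\<close> inside the definition makes
  \<open>L\<close> independent of the penalisation, which is sent to infinity afterwards.\<close>

definition horiz_hess_bound :: "(real^'n \<Rightarrow> real^'m^'n) \<Rightarrow> real \<Rightarrow> real^'n \<Rightarrow> real^'n \<Rightarrow> bool" where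
  "horiz_hess_bound \<sigma> L z w \<longleftrightarrow> (\<forall>p X Y c \<xi>. c \<ge> 0 \<longrightarrow>
     (\<forall>h k. h \<bullet> (X *v h) - k \<bullet> (Y *v k) \<le> c * (norm (h - k))\<^sup>2) \<longrightarrow>
     \<xi> \<bullet> (horiz_hess \<sigma> z p X *v \<xi>) - \<xi> \<bullet> (horiz_hess \<sigma> w p Y *v \<xi>)
       \<le> L * (c * (norm (z - w))\<^sup>2 + norm p * norm (z - w)) * (norm \<xi>)\<^sup>2)"

text \<open>The block inequality is applied to \<open>h = \<sigma> z *v \<xi>\<close> and
  \<open>k = \<sigma> w *v \<xi>\<close>, whose difference is of order |z - w| |\<xi>|; hence the
  quadratic term and the square in \<open>L\<close>. The first order terms carry the same
  \<open>p\<close> at both points, so they differ only by the Lipschitz variation of the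
  coefficients.\<close>

lemma horiz_hess_local_bound:
  fixes \<sigma> :: "real^'n \<Rightarrow> real^'m^'n"
  assumes \<sigma>: "\<forall>i j. C11_closure \<Omega> (\<lambda>x. \<sigma> x $ i $ j)" and "open \<Omega>" "z0 \<in> \<Omega>"
  obtains r L where "r > 0" "cball z0 r \<subseteq> \<Omega>" "L \<ge> 0"
    "\<And>z w. z \<in> cball z0 r \<Longrightarrow> w \<in> cball z0 r \<Longrightarrow> horiz_hess_bound \<sigma> L z w"
proof -
  obtain r where r: "r > 0" "cball z0 r \<subseteq> \<Omega>" using assms(2,3) open_contains_cball by blast
  have "\<exists>L. \<forall>a. L-lipschitz_on (cball z0 r) (\<lambda>x. \<sigma> x $ a $ j)" for j
    by (rule lipschitz_on_uniform) (use C11_closure_lipschitz[OF _ r(2)] \<sigma> in blast)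
  then obtain M0 where "\<And>j a. (M0 j)-lipschitz_on (cball z0 r) (\<lambda>x. \<sigma> x $ a $ j)" by metis
  then have "\<exists>M. \<forall>q. M-lipschitz_on (cball z0 r) (\<lambda>x. \<sigma> x $ fst q $ snd q)"
    by (intro lipschitz_on_uniform) blast
  then obtain M where M: "\<And>a j. M-lipschitz_on (cball z0 r) (\<lambda>x. \<sigma> x $ a $ j)" by force
  have "\<exists>N. \<forall>q. N-lipschitz_on (cball z0 r) (vfield_coeff \<sigma> (fst q) (fst (snd q)) (snd (snd q)))"
    by (intro lipschitz_on_uniform vfield_coeff_lipschitz[OF \<sigma> r(2)])
  then obtain N where N: "\<And>a j i. N-lipschitz_on (cball z0 r) (vfield_coeff \<sigma> a j i)" by force
  have M0: "M \<ge> 0" and N0: "N \<ge> 0" using lipschitz_on_nonneg M N by blast+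
  define n where "n = real CARD('n)"
  define m where "m = real CARD('m)"
  have nm: "n \<ge> 0" "m \<ge> 0" by (simp_all add: n_def m_def)
  define L where "L = (n * m * M)\<^sup>2 + m * m * n * N"
  have L: "L \<ge> 0" using nm N0 by (simp add: L_def)
  have est1: "norm (\<sigma> z *v \<xi> - \<sigma> w *v \<xi>) \<le> n * m * M * norm (z - w) * norm \<xi>"
    if zw: "z \<in> cball z0 r" "w \<in> cball z0 r" for z w \<xi>
  proof -
    have "norm (\<sigma> z *v \<xi> - \<sigma> w *v \<xi>) \<le> (\<Sum>a\<in>UNIV. \<bar>(\<sigma> z *v \<xi> - \<sigma> w *v \<xi>) $ a\<bar>)" by (rule norm_le_l1_cart)
    also have "\<dots> \<le> (\<Sum>a\<in>(UNIV::'n set). \<Sum>j\<in>(UNIV::'m set). M * norm (z - w) * norm \<xi>)"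
    proof (rule sum_mono)
      fix a
      have "(\<sigma> z *v \<xi> - \<sigma> w *v \<xi>) $ a = (\<Sum>j\<in>UNIV. (\<sigma> z $ a $ j - \<sigma> w $ a $ j) * \<xi> $ j)"
        by (simp add: matrix_vector_mult_def left_diff_distrib sum_subtractf)
      also have "\<bar>\<dots>\<bar> \<le> (\<Sum>j\<in>(UNIV::'m set). M * norm (z - w) * norm \<xi>)"
      proof (rule order_trans[OF sum_abs sum_mono])
        fix j
        show "\<bar>(\<sigma> z $ a $ j - \<sigma> w $ a $ j) * \<xi> $ j\<bar> \<le> M * norm (z - w) * norm \<xi>"
          unfolding abs_mult using lipschitz_onD[OF M zw, of a j] component_le_norm_cart[of \<xi> j] M0
          by (intro mult_mono) (auto simp: dist_norm dist_real_def)
      qed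
      finally show "\<bar>(\<sigma> z *v \<xi> - \<sigma> w *v \<xi>) $ a\<bar> \<le> (\<Sum>j\<in>(UNIV::'m set). M * norm (z - w) * norm \<xi>)" .
    qed
    also have "\<dots> = n * m * M * norm (z - w) * norm \<xi>" by (simp add: n_def m_def)
    finally show ?thesis .
  qed
  have est2: "(\<Sum>i\<in>UNIV. \<Sum>j\<in>UNIV. \<xi> $ i * \<xi> $ j * (\<Sum>a\<in>UNIV. p $ a * vfield_coeff \<sigma> a j i z))
      - (\<Sum>i\<in>UNIV. \<Sum>j\<in>UNIV. \<xi> $ i * \<xi> $ j * (\<Sum>a\<in>UNIV. p $ a * vfield_coeff \<sigma> a j i w))
      \<le> m * m * n * N * (norm p * norm (z - w)) * (norm \<xi>)\<^sup>2"
    if zw: "z \<in> cball z0 r" "w \<in> cball z0 r" for z w \<xi> and p :: "real^'n"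
  proof -
    have "(\<Sum>i\<in>UNIV. \<Sum>j\<in>UNIV. \<xi> $ i * \<xi> $ j * (\<Sum>a\<in>UNIV. p $ a * vfield_coeff \<sigma> a j i z))
      - (\<Sum>i\<in>UNIV. \<Sum>j\<in>UNIV. \<xi> $ i * \<xi> $ j * (\<Sum>a\<in>UNIV. p $ a * vfield_coeff \<sigma> a j i w))
      = (\<Sum>i\<in>UNIV. \<Sum>j\<in>UNIV. \<Sum>a\<in>UNIV. \<xi> $ i * \<xi> $ j * (p $ a * (vfield_coeff \<sigma> a j i z - vfield_coeff \<sigma> a j i w)))"
      by (simp add: sum_subtractf[symmetric] right_diff_distrib[symmetric] sum_distrib_left)
    also have "\<dots> \<le> (\<Sum>i\<in>(UNIV::'m set). \<Sum>j\<in>(UNIV::'m set). \<Sum>a\<in>(UNIV::'n set). norm \<xi> * norm \<xi> * (norm p * (N * norm (z - w))))"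
    proof (intro sum_mono)
      fix i j a
      have "\<bar>\<xi> $ i * \<xi> $ j * (p $ a * (vfield_coeff \<sigma> a j i z - vfield_coeff \<sigma> a j i w))\<bar> \<le> norm \<xi> * norm \<xi> * (norm p * (N * norm (z - w)))"
        unfolding abs_mult using lipschitz_onD[OF N zw, of a j i] N0
        by (intro mult_mono component_le_norm_cart) (auto simp: dist_norm dist_real_def)
      then show "\<xi> $ i * \<xi> $ j * (p $ a * (vfield_coeff \<sigma> a j i z - vfield_coeff \<sigma> a j i w)) \<le> norm \<xi> * norm \<xi> * (norm p * (N * norm (z - w)))"
        by linarith
    qed
    also have "\<dots> = m * m * n * N * (norm p * norm (z - w)) * (norm \<xi>)\<^sup>2"
      by (simp add: n_def m_def power2_eq_square)
    finally show ?thesis .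
  qed
  show thesis
  proof (rule that[OF r L])
    fix z w assume zw: "z \<in> cball z0 r" "w \<in> cball z0 r"
    show "horiz_hess_bound \<sigma> L z w"
      unfolding horiz_hess_bound_def
    proof (intro allI impI)
      fix p :: "real^'n" and \<xi> and X Y :: "real^'n^'n" and c :: real
      assume c: "c \<ge> 0" and XY: "\<forall>h k. h \<bullet> (X *v h) - k \<bullet> (Y *v k) \<le> c * (norm (h - k))\<^sup>2"
      have "(norm (\<sigma> z *v \<xi> - \<sigma> w *v \<xi>))\<^sup>2 \<le> (n * m * M * norm (z - w) * norm \<xi>)\<^sup>2"
        by (rule power_mono[OF est1[OF zw]]) simp
      from mult_left_mono[OF this c] XY[rule_format, of "\<sigma> z *v \<xi>" "\<sigma> w *v \<xi>"]
      have "(\<sigma> z *v \<xi>) \<bullet> (X *v (\<sigma> z *v \<xi>)) - (\<sigma> w *v \<xi>) \<bullet> (Y *v (\<sigma> w *v \<xi>)) \<le> (n * m * M)\<^sup>2 * (c * (norm (z - w))\<^sup>2) * (norm \<xi>)\<^sup>2"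
        by (simp add: power_mult_distrib mult_ac)
      also have "\<dots> \<le> L * (c * (norm (z - w))\<^sup>2) * (norm \<xi>)\<^sup>2"
        using c nm N0 by (intro mult_right_mono) (auto simp: L_def)
      finally have 1: "(\<sigma> z *v \<xi>) \<bullet> (X *v (\<sigma> z *v \<xi>)) - (\<sigma> w *v \<xi>) \<bullet> (Y *v (\<sigma> w *v \<xi>)) \<le> L * (c * (norm (z - w))\<^sup>2) * (norm \<xi>)\<^sup>2" .
      have "m * m * n * N * (norm p * norm (z - w)) * (norm \<xi>)\<^sup>2 \<le> L * (norm p * norm (z - w)) * (norm \<xi>)\<^sup>2"
        by (intro mult_right_mono) (auto simp: L_def)
      then show "\<xi> \<bullet> (horiz_hess \<sigma> z p X *v \<xi>) - \<xi> \<bullet> (horiz_hess \<sigma> w p Y *v \<xi>)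
          \<le> L * (c * (norm (z - w))\<^sup>2 + norm p * norm (z - w)) * (norm \<xi>)\<^sup>2"
        using 1 est2[OF zw, of \<xi> p] unfolding horiz_hess_quadratic_form by (simp add: distrib_left distrib_right)
    qed
  qed
qed

section \<open>Monotonicity of the determinant\<close>

lemma pos_def_imp_invertible:
  fixes A :: "real^'n^'n"
  assumes "\<And>\<xi>. \<xi> \<noteq> 0 \<Longrightarrow> 0 < \<xi> \<bullet> (A *v \<xi>)"
  shows "invertible A"
proof -
  have "\<forall>x. A *v x = 0 \<longrightarrow> x = 0"
    using assms by (metis inner_zero_right less_irrefl)
  then show ?thesis unfolding invertible_left_inverse matrix_left_invertible_ker .
qed

text \<open>The segment from the identity to \<open>A\<close> consists of positive definite, hence
  invertible, matrices, so the determinant cannot change sign along it.\<close>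

lemma pos_def_det_pos:
  fixes A :: "real^'n^'n"
  assumes pd: "\<And>\<xi>. \<xi> \<noteq> 0 \<Longrightarrow> 0 < \<xi> \<bullet> (A *v \<xi>)"
  shows "det A > 0"
proof (rule ccontr)
  define B where "B t = (1 - t) *\<^sub>R mat 1 + t *\<^sub>R A" for t :: real
  assume "\<not> det A > 0"
  then have "det (B 1) \<le> 0" by (simp add: B_def)
  moreover have "det (B 0) \<ge> 0" by (simp add: B_def)
  moreover have "continuous_on {0..1} (\<lambda>t. det (B t))"
    unfolding B_def det_def by (auto intro!: continuous_intros)
  ultimately obtain t where t: "0 \<le> t" "t \<le> 1" "det (B t) = 0"
    using IVT2'[of "\<lambda>t. det (B t)" 1 0 0] by auto
  have "0 < \<xi> \<bullet> (B t *v \<xi>)" if "\<xi> \<noteq> 0" for \<xi>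
  proof -
    have "\<xi> \<bullet> (B t *v \<xi>) = (1 - t) * (\<xi> \<bullet> \<xi>) + t * (\<xi> \<bullet> (A *v \<xi>))"
      by (simp add: B_def matrix_vector_mult_add_rdistrib scaleR_matrix_vector_assoc[symmetric] inner_add_right)
    moreover have "\<xi> \<bullet> \<xi> > 0" "\<xi> \<bullet> (A *v \<xi>) > 0" using pd that by auto
    ultimately show ?thesis using t(1,2)
      by (cases "t = 0") (auto intro!: add_nonneg_pos mult_nonneg_nonneg mult_pos_pos)
  qed
  then have "invertible (B t)" by (rule pos_def_imp_invertible)
  then show False using t(3) by (simp add: invertible_det_nz)
qed

lemma det_scaleR: "det (c *\<^sub>R (A :: real^'n^'n)) = c ^ CARD('n) * det A"
proof -
  have "c *\<^sub>R A = (c *\<^sub>R mat 1) ** A" by (simp add: scalar_matrix_assoc[symmetric])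
  moreover have "det (c *\<^sub>R (mat 1 :: real^'n^'n)) = c ^ CARD('n)"
    by (subst det_diagonal) (auto simp: mat_def)
  ultimately show ?thesis by (simp add: det_mul)
qed

text \<open>The matrix \<open>S = B\<^sup>-\<^sup>1 C\<close> is a contraction for the norm given by \<open>C\<close>, so its powers, and hence
  the powers of its determinant, are bounded.\<close>

lemma det_mono_pos_def:
  fixes C B :: "real^'n^'n"
  assumes C: "C \<in> sym_mats" "\<And>\<xi>. \<xi> \<noteq> 0 \<Longrightarrow> 0 < \<xi> \<bullet> (C *v \<xi>)" and le: "C \<preceq> B"
  shows "det C \<le> det B"
proof -
  have pdB: "0 < \<xi> \<bullet> (B *v \<xi>)" if "\<xi> \<noteq> 0" for \<xi>
    using le C(2)[OF that] unfolding loewner_le_def by (meson less_le_trans)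
  have detC: "det C > 0" and detB: "det B > 0" using pos_def_det_pos C(2) pdB by blast+
  obtain R where R: "R ** B = mat 1" "B ** R = mat 1"
    using pos_def_imp_invertible[OF pdB] unfolding invertible_def by blast
  define S where "S = R ** C"
  have BS: "B *v (S *v x) = C *v x" for x
    by (simp add: S_def matrix_vector_mul_assoc matrix_mul_assoc R)
  define q where "q x = x \<bullet> (C *v x)" for x
  \<comment> \<open>For \<open>y = S *v x\<close> one has B y = C x, so \<open>q y\<close> is at
    most the \<open>C\<close>-product of \<open>y\<close> and \<open>x\<close>. Expanding
    \<open>q (x - y)\<close>, which is nonnegative, turns this into the contraction.\<close>
  have contract: "q (S *v x) \<le> q x" for x
  proof -
    define y where "y = S *v x"
    have yx: "q y \<le> y \<bullet> (C *v x)"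
      using le BS[of x] unfolding loewner_le_def q_def y_def by metis
    have "0 \<le> q (x - y)" unfolding q_def using C(2)[of "x - y"] by (cases "x - y = 0") auto
    also have "q (x - y) = q x - 2 * (y \<bullet> (C *v x)) + q y"
      using sym_mats_inner_commute[OF C(1), of x y]
      by (simp add: q_def matrix_vector_mult_diff_distrib inner_diff_left inner_diff_right inner_commute)
    finally show ?thesis using yx by (simp add: y_def)
  qed
  have contq: "continuous_on UNIV q"
    unfolding q_def by (intro continuous_intros linear_continuous_on matrix_vector_mul_bounded_linear)
  have "compact (sphere (0::real^'n) 1)" "sphere (0::real^'n) 1 \<noteq> {}" by simp_all
  then obtain x0 where x0: "x0 \<in> sphere 0 1" "\<And>x. x \<in> sphere 0 1 \<Longrightarrow> q x0 \<le> q x"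
    using continuous_attains_inf[of "sphere 0 1" q] continuous_on_subset[OF contq] by blast
  \<comment> \<open>The minimum of \<open>q\<close> on the unit sphere makes the
    \<open>C\<close>-norm dominate the Euclidean one, which bounds the entries of all powers of
    \<open>S\<close>.\<close>
  define c where "c = q x0"
  have "x0 \<noteq> 0" using x0(1) by auto
  then have c: "c > 0" using C(2)[of x0] by (simp add: c_def q_def)
  have qc: "c * (norm x)\<^sup>2 \<le> q x" for x
  proof (cases "x = 0")
    case False
    then have "q x0 \<le> q ((1 / norm x) *\<^sub>R x)" by (intro x0(2)) simp
    also have "\<dots> = q x / (norm x)\<^sup>2"
      by (simp add: q_def matrix_vector_mult_scaleR power2_eq_square)
    finally show ?thesis using False by (simp add: c_def field_simps)
  qed (simp add: q_def)
  define Sp where "Sp k = (((**) S) ^^ k) (mat 1)" for k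
  have Sp_Suc: "Sp (Suc k) = S ** Sp k" for k by (simp add: Sp_def)
  have qSp: "q (Sp k *v x) \<le> q x" for k x
  proof (induction k)
    case (Suc k)
    have "q (Sp (Suc k) *v x) = q (S *v (Sp k *v x))" by (simp add: Sp_Suc matrix_vector_mul_assoc)
    also have "\<dots> \<le> q (Sp k *v x)" by (rule contract)
    finally show ?case using Suc by simp
  qed (simp add: Sp_def)
  define M where "M = (\<Sum>j\<in>UNIV. sqrt (q (axis j 1) / c))"
  have q0: "q x \<ge> 0" for x using qc[of x] c by (meson less_imp_le mult_nonneg_nonneg order_trans zero_le_power2)
  have entry: "\<bar>Sp k $ i $ j\<bar> \<le> M" for k i j
  proof -
    let ?e = "axis j (1::real)"
    have "c * (norm (Sp k *v ?e))\<^sup>2 \<le> q ?e" using qc qSp order_trans by blast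
    then have "(norm (Sp k *v ?e))\<^sup>2 \<le> q ?e / c" using c by (simp add: field_simps)
    then have "norm (Sp k *v ?e) \<le> sqrt (q ?e / c)" by (rule real_le_rsqrt)
    moreover have "\<bar>(Sp k *v ?e) $ i\<bar> \<le> norm (Sp k *v ?e)" by (rule component_le_norm_cart)
    moreover have "(Sp k *v ?e) $ i = Sp k $ i $ j" by (simp add: matrix_vector_mult_basis column_def)
    moreover have "sqrt (q ?e / c) \<le> M"
      unfolding M_def by (rule member_le_sum) (use q0 c in auto)
    ultimately show ?thesis by linarith
  qed
  have detSp: "det (Sp k) = det S ^ k" for k
    by (induction k) (simp_all add: Sp_Suc det_mul, simp add: Sp_def)
  have "\<bar>det (Sp k)\<bar> \<le> (\<Sum>p\<in>{p. p permutes (UNIV::'n set)}. M ^ CARD('n))" for k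
    unfolding det_def
  proof (rule order_trans[OF sum_abs sum_mono])
    fix p :: "'n \<Rightarrow> 'n"
    have "\<bar>of_int (sign p) * (\<Prod>i\<in>UNIV. Sp k $ i $ p i)\<bar> = (\<Prod>i\<in>UNIV. \<bar>Sp k $ i $ p i\<bar>)"
      by (simp add: abs_mult abs_prod sign_def)
    also have "\<dots> \<le> (\<Prod>i\<in>(UNIV::'n set). M)" by (intro prod_mono) (use entry in auto)
    finally show "\<bar>of_int (sign p) * (\<Prod>i\<in>UNIV. Sp k $ i $ p i)\<bar> \<le> M ^ CARD('n)" by simp
  qed
  then have bounded_powers: "\<bar>det S\<bar> ^ k \<le> (\<Sum>p\<in>{p. p permutes (UNIV::'n set)}. M ^ CARD('n))" for k
    by (simp add: detSp power_abs)
  have "\<bar>det S\<bar> \<le> 1"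
  proof (rule ccontr)
    assume "\<not> \<bar>det S\<bar> \<le> 1"
    then show False using real_arch_pow[of "\<bar>det S\<bar>"] bounded_powers by (meson not_le)
  qed
  moreover have "det B * det S = det C"
  proof -
    have "B ** S = C" by (simp add: S_def matrix_mul_assoc R)
    then show ?thesis by (metis det_mul)
  qed
  ultimately have "det B * det S \<le> det B * 1" using detB by (intro mult_left_mono) auto
  then show ?thesis using \<open>det B * det S = det C\<close> by simp
qed

text \<open>Since \<gamma> I lies below \<open>A\<close>, the loss \<open>d\<close> I is at most
  d/\<gamma> times \<open>A\<close>, so \<open>(1 - d/\<gamma>) *\<^sub>R A\<close> lies below
  \<open>B\<close>. The factor leaves the determinant with the power \<open>CARD('n)\<close>, and
  the error does not depend on the size of \<open>A\<close>.\<close>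

lemma ln_det_almost_mono:
  fixes A B :: "real^'n^'n"
  assumes A: "A \<in> sym_mats" "\<gamma> *\<^sub>R mat 1 \<preceq> A" and d: "0 \<le> d" "d < \<gamma>"
    and le: "\<And>\<xi>. \<xi> \<bullet> (A *v \<xi>) - d * (norm \<xi>)\<^sup>2 \<le> \<xi> \<bullet> (B *v \<xi>)"
  shows "real CARD('n) * ln (1 - d/\<gamma>) + ln (det A) \<le> ln (det B)"
proof -
  define c where "c = 1 - d/\<gamma>"
  have \<gamma>: "\<gamma> > 0" using d by simp
  have c: "c > 0" using d \<gamma> by (simp add: c_def field_simps)
  have gA: "\<gamma> * (norm \<xi>)\<^sup>2 \<le> \<xi> \<bullet> (A *v \<xi>)" for \<xi>
    using A(2) by (simp add: loewner_le_def power2_norm_eq_inner)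
  have pA: "0 < \<xi> \<bullet> (A *v \<xi>)" if "\<xi> \<noteq> 0" for \<xi>
  proof -
    have "0 < \<gamma> * (norm \<xi>)\<^sup>2" using that \<gamma> by simp
    then show ?thesis using gA[of \<xi>] by linarith
  qed
  have "c *\<^sub>R A \<preceq> B"
    unfolding loewner_le_def
  proof
    fix \<xi>
    have "(d/\<gamma>) * (\<gamma> * (norm \<xi>)\<^sup>2) \<le> (d/\<gamma>) * (\<xi> \<bullet> (A *v \<xi>))"
      using gA[of \<xi>] d \<gamma> by (intro mult_left_mono) auto
    then have "d * (norm \<xi>)\<^sup>2 \<le> (d/\<gamma>) * (\<xi> \<bullet> (A *v \<xi>))" using \<gamma> by simp
    moreover have "\<xi> \<bullet> ((c *\<^sub>R A) *v \<xi>) = \<xi> \<bullet> (A *v \<xi>) - (d/\<gamma>) * (\<xi> \<bullet> (A *v \<xi>))"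
      by (simp add: c_def scaleR_matrix_vector_assoc[symmetric] left_diff_distrib)
    ultimately show "\<xi> \<bullet> ((c *\<^sub>R A) *v \<xi>) \<le> \<xi> \<bullet> (B *v \<xi>)" using le[of \<xi>] by linarith
  qed
  moreover have "0 < \<xi> \<bullet> ((c *\<^sub>R A) *v \<xi>)" if "\<xi> \<noteq> 0" for \<xi>
    using pA[OF that] c by (simp add: scaleR_matrix_vector_assoc[symmetric])
  ultimately have "det (c *\<^sub>R A) \<le> det B"
    by (intro det_mono_pos_def sym_mats_scaleR A(1)) auto
  then have "c ^ CARD('n) * det A \<le> det B" by (simp add: det_scaleR)
  moreover have dA: "det A > 0" using pos_def_det_pos[OF pA] .
  ultimately have "ln (c ^ CARD('n) * det A) \<le> ln (det B)" using c by (intro ln_mono) auto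
  then show ?thesis using c dA unfolding c_def[symmetric] by (simp add: ln_mult ln_realpow)
qed

section \<open>Viscosity inequalities at limiting jets\<close>

lemma uminus_matrix_vector_mult: "(- A) *v x = - (A *v x)" for A :: "real^'n^'m"
  using scaleR_matrix_vector_assoc[of "-1" A x] by simp

lemma block_mat_quadratic_form:
  fixes A B C D :: "real^'n^'n" and \<zeta> :: "real^('n + 'n)"
  defines "h \<equiv> \<chi> i. \<zeta> $ Inl i" and "k \<equiv> \<chi> i. \<zeta> $ Inr i"
  shows "\<zeta> \<bullet> (block_mat A B C D *v \<zeta>) = h \<bullet> (A *v h) + h \<bullet> (B *v k) + k \<bullet> (C *v h) + k \<bullet> (D *v k)"
proof -
  have split: "(\<Sum>q\<in>UNIV. f q) = (\<Sum>i\<in>UNIV. f (Inl i)) + (\<Sum>i\<in>UNIV. f (Inr i))" for f :: "'n + 'n \<Rightarrow> real"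
    unfolding UNIV_Plus_UNIV[symmetric] by (subst sum.Plus) auto
  have l: "(block_mat A B C D *v \<zeta>) $ Inl i = (A *v h) $ i + (B *v k) $ i" for i
    unfolding matrix_vector_mult_def vec_lambda_beta split by (simp add: block_mat_def h_def k_def)
  have r: "(block_mat A B C D *v \<zeta>) $ Inr i = (C *v h) $ i + (D *v k) $ i" for i
    unfolding matrix_vector_mult_def vec_lambda_beta split by (simp add: block_mat_def h_def k_def)
  show ?thesis
    unfolding inner_vec_def split l r by (simp add: h_def k_def distrib_left sum.distrib)
qed

lemma block_mat_bounds:
  fixes X Y :: "real^'n^'n"
  assumes lower: "\<And>h k. - c * ((norm h)\<^sup>2 + (norm k)\<^sup>2) \<le> h \<bullet> (X *v h) - k \<bullet> (Y *v k)"
    and upper: "\<And>h k. h \<bullet> (X *v h) - k \<bullet> (Y *v k) \<le> c * (norm (h - k))\<^sup>2"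
  shows "(- c) *\<^sub>R block_mat (mat 1) 0 0 (mat 1) \<preceq> block_mat X 0 0 (- Y)"
    and "block_mat X 0 0 (- Y) \<preceq> c *\<^sub>R block_mat (mat 1) (- mat 1) (- mat 1) (mat 1)"
proof -
  show "(- c) *\<^sub>R block_mat (mat 1) 0 0 (mat 1) \<preceq> block_mat X 0 0 (- Y)"
    unfolding loewner_le_def scaleR_matrix_vector_assoc[symmetric] inner_scaleR_right block_mat_quadratic_form
    using lower by (simp add: uminus_matrix_vector_mult power2_norm_eq_inner)
  show "block_mat X 0 0 (- Y) \<preceq> c *\<^sub>R block_mat (mat 1) (- mat 1) (- mat 1) (mat 1)"
    unfolding loewner_le_def
  proof
    fix \<zeta> :: "real^('n + 'n)"
    let ?h = "\<chi> i. \<zeta> $ Inl i" and ?k = "\<chi> i. \<zeta> $ Inr i"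
    show "\<zeta> \<bullet> (block_mat X 0 0 (- Y) *v \<zeta>) \<le> \<zeta> \<bullet> ((c *\<^sub>R block_mat (mat 1) (- mat 1) (- mat 1) (mat 1)) *v \<zeta>)"
      unfolding scaleR_matrix_vector_assoc[symmetric] inner_scaleR_right block_mat_quadratic_form
      using upper[of ?h ?k]
      by (simp add: uminus_matrix_vector_mult power2_norm_eq_inner inner_expand)
  qed
qed

lemma tendsto_det:
  fixes A :: "nat \<Rightarrow> real^'n^'n"
  assumes "A \<longlonglongrightarrow> A0" shows "(\<lambda>k. det (A k)) \<longlonglongrightarrow> det A0"
  unfolding det_def by (intro tendsto_sum tendsto_mult tendsto_const tendsto_prod tendsto_vec_nth assms)

lemma abs_quadratic_form_le:
  fixes B :: "real^'n^'n"
  shows "\<bar>\<xi> \<bullet> (B *v \<xi>)\<bar> \<le> real CARD('n) * norm B * (norm \<xi>)\<^sup>2"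
proof -
  have "norm (B *v \<xi>) \<le> (\<Sum>i\<in>UNIV. \<bar>(B *v \<xi>) $ i\<bar>)" by (rule norm_le_l1_cart)
  also have "\<dots> \<le> (\<Sum>i\<in>(UNIV::'n set). norm B * norm \<xi>)"
  proof (rule sum_mono)
    fix i
    have "\<bar>(B *v \<xi>) $ i\<bar> = \<bar>B $ i \<bullet> \<xi>\<bar>" by (simp add: matrix_vector_mult_def inner_vec_def)
    also have "\<dots> \<le> norm (B $ i) * norm \<xi>" by (rule Cauchy_Schwarz_ineq2)
    also have "\<dots> \<le> norm B * norm \<xi>" by (intro mult_right_mono) (auto simp: Finite_Cartesian_Product.norm_nth_le)
    finally show "\<bar>(B *v \<xi>) $ i\<bar> \<le> norm B * norm \<xi>" .
  qed
  finally have "norm (B *v \<xi>) \<le> real CARD('n) * norm B * norm \<xi>" by simp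
  then have "norm \<xi> * norm (B *v \<xi>) \<le> norm \<xi> * (real CARD('n) * norm B * norm \<xi>)" by (rule mult_left_mono) simp
  then show ?thesis using Cauchy_Schwarz_ineq2[of \<xi> "B *v \<xi>"] by (simp add: power2_eq_square mult_ac)
qed

text \<open>The index has to be chosen uniformly in \<xi>: the quadratic form of
  \<open>A k - A0\<close> is controlled by its matrix norm. This later makes the test functions
  along the sequence admissible for a supersolution.\<close>

lemma eventually_pos_def:
  fixes A :: "nat \<Rightarrow> real^'n^'n"
  assumes lim: "A \<longlonglongrightarrow> A0" and "c > 0" and lb: "\<And>\<xi>. c * (norm \<xi>)\<^sup>2 \<le> \<xi> \<bullet> (A0 *v \<xi>)"
  shows "\<forall>\<^sub>F k in sequentially. \<forall>\<xi>. \<xi> \<noteq> 0 \<longrightarrow> 0 < \<xi> \<bullet> (A k *v \<xi>)"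
proof -
  have n0: "real CARD('n) > 0" by simp
  have "c / (2 * real CARD('n)) > 0" using \<open>c > 0\<close> by simp
  from tendstoD[OF lim this] show ?thesis
  proof eventually_elim
    case (elim k)
    have "real CARD('n) * norm (A k - A0) \<le> c / 2" using elim n0 by (simp add: dist_norm field_simps)
    show ?case
    proof (intro allI impI)
      fix \<xi> :: "real^'n" assume "\<xi> \<noteq> 0"
      have "\<xi> \<bullet> (A k *v \<xi>) = \<xi> \<bullet> (A0 *v \<xi>) + \<xi> \<bullet> ((A k - A0) *v \<xi>)"
        by (simp add: matrix_vector_mult_diff_rdistrib inner_diff_right)
      moreover have "\<bar>\<xi> \<bullet> ((A k - A0) *v \<xi>)\<bar> \<le> c/2 * (norm \<xi>)\<^sup>2"
        by (rule order_trans[OF abs_quadratic_form_le]) (intro mult_right_mono \<open>_ \<le> c / 2\<close>, simp)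
      moreover have "c/2 * (norm \<xi>)\<^sup>2 > 0" using \<open>\<xi> \<noteq> 0\<close> \<open>c > 0\<close> by simp
      moreover have "c * (norm \<xi>)\<^sup>2 = c/2 * (norm \<xi>)\<^sup>2 + c/2 * (norm \<xi>)\<^sup>2" by simp
      ultimately show "0 < \<xi> \<bullet> (A k *v \<xi>)" using lb[of \<xi>] by linarith
    qed
  qed
qed

context
  fixes \<Omega> :: "(real^'n) set" and \<sigma> :: "real^'n \<Rightarrow> real^'m^'n"
    and K :: "real^'n \<Rightarrow> real \<Rightarrow> real^'n \<Rightarrow> real^'n^'n \<Rightarrow> real"
  assumes op: "open \<Omega>" and \<sigma>: "\<forall>i j. C11_closure \<Omega> (\<lambda>x. \<sigma> x $ i $ j)"
    and K: "structure_conditions \<Omega> K"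
begin

lemma D2X_quad_test_in:
  "X \<in> sym_mats \<Longrightarrow> w \<in> \<Omega> \<Longrightarrow> D2X \<sigma> (quad_test w P X) w = horiz_hess \<sigma> w P X"
  using \<sigma> by (intro D2X_quad_test) (auto simp: C11_closure_def)

text \<open>The bound \<open>lb\<close> keeps the limiting determinant away from zero, where
  \<open>ln\<close> would fail to be continuous. Symmetric matrices form a closed set, so the limit
  stays in the domain on which \<open>K\<close> is continuous.\<close>

lemma operator_limit:
  assumes z: "z \<in> \<Omega>" and lim: "w \<longlonglongrightarrow> z" "r \<longlonglongrightarrow> r0" "P \<longlonglongrightarrow> p" "X \<longlonglongrightarrow> Y" and X: "\<And>k. X k \<in> sym_mats"
    and "c > 0" and lb: "\<And>\<xi>. c * (norm \<xi>)\<^sup>2 \<le> \<xi> \<bullet> (horiz_hess \<sigma> z p Y *v \<xi>)"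
  shows "(\<lambda>k. K (w k) (r k) (P k) (X k) - ln (det (horiz_hess \<sigma> (w k) (P k) (X k)))) \<longlonglongrightarrow> K z r0 p Y - ln (det (horiz_hess \<sigma> z p Y))"
proof (rule tendsto_diff)
  let ?D = "closure \<Omega> \<times> UNIV \<times> UNIV \<times> sym_mats"
  have "continuous_on ?D (\<lambda>(x, r, p, X). K x r p X)" using K by (simp add: structure_conditions_def)
  moreover have "(\<lambda>k. (w k, r k, P k, X k)) \<longlonglongrightarrow> (z, r0, p, Y)" using lim by (intro tendsto_Pair)
  moreover have "\<forall>\<^sub>F k in sequentially. (w k, r k, P k, X k) \<in> ?D"
    using topological_tendstoD[OF lim(1) op z] by eventually_elim (use X closure_subset in auto)
  moreover have "(z, r0, p, Y) \<in> ?D" using z closure_subset sym_mats_limit[OF X lim(4)] by auto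
  ultimately show "(\<lambda>k. K (w k) (r k) (P k) (X k)) \<longlonglongrightarrow> K z r0 p Y"
    using continuous_on_tendsto_compose[of _ _ "\<lambda>k. (w k, r k, P k, X k)"] by force
  have "det (horiz_hess \<sigma> z p Y) > 0"
  proof (rule pos_def_det_pos)
    fix \<xi> :: "real^'m" assume "\<xi> \<noteq> 0"
    then have "0 < c * (norm \<xi>)\<^sup>2" using \<open>c > 0\<close> by simp
    then show "0 < \<xi> \<bullet> (horiz_hess \<sigma> z p Y *v \<xi>)" using lb[of \<xi>] by linarith
  qed
  then show "(\<lambda>k. ln (det (horiz_hess \<sigma> (w k) (P k) (X k)))) \<longlonglongrightarrow> ln (det (horiz_hess \<sigma> z p Y))"
    by (intro tendsto_ln tendsto_det tendsto_horiz_hess[OF \<sigma> op z lim(1,3,4)]) simp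
qed

text \<open>Eventually the touching points lie in \<Omega>, where the quadratics are test functions.
  Both conclusions are closed conditions, and the convexity bound has to come first because it keeps
  the logarithm under control in the limit.\<close>

lemma subsolution_limit:
  assumes conv: "\<And>\<phi> x. C2_on \<Omega> \<phi> \<Longrightarrow> loc_max_pt \<Omega> (\<lambda>y. u y - \<phi> y) x \<Longrightarrow> \<gamma> *\<^sub>R mat 1 \<preceq> D2X \<sigma> \<phi> x" and "\<gamma> > 0"
    and sub: "viscosity_subsolution \<Omega> \<sigma> K u"
    and z: "z \<in> \<Omega>" and w: "w \<longlonglongrightarrow> z" "(\<lambda>k. u (w k)) \<longlonglongrightarrow> u z" and P: "P \<longlonglongrightarrow> p"
    and X: "\<And>k. X k \<in> sym_mats" "X \<longlonglongrightarrow> Y"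
    and touch: "\<And>k. touched_above (closure \<Omega>) u (w k) (P k) (X k)"
  shows "\<gamma> *\<^sub>R mat 1 \<preceq> horiz_hess \<sigma> z p Y"
    and "K z (u z) p Y \<le> ln (det (horiz_hess \<sigma> z p Y))"
proof -
  define H where "H k = horiz_hess \<sigma> (w k) (P k) (X k)" for k
  have Hl: "H \<longlonglongrightarrow> horiz_hess \<sigma> z p Y"
    unfolding H_def by (rule tendsto_horiz_hess[OF \<sigma> op z w(1) P X(2)])
  have ev: "\<forall>\<^sub>F k in sequentially. w k \<in> \<Omega>" using topological_tendstoD[OF w(1) op z] .
  have at: "\<gamma> *\<^sub>R mat 1 \<preceq> H k \<and> K (w k) (u (w k)) (P k) (X k) \<le> ln (det (H k))" if wk: "w k \<in> \<Omega>" for k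
  proof -
    let ?\<phi> = "quad_test (w k) (P k) (X k)"
    obtain r where r: "r > 0" "\<And>z. z \<in> closure \<Omega> \<Longrightarrow> norm (z - w k) < r \<Longrightarrow> u z \<le> u (w k) + ?\<phi> z"
      using touch[of k] unfolding quad_test_def add.assoc by blast
    have "loc_max_pt \<Omega> (\<lambda>y. u y - ?\<phi> y) (w k)"
      unfolding loc_max_pt_def eventually_at
    proof (intro conjI wk exI[of _ r] r(1) ballI impI)
      fix y assume "y \<in> \<Omega>" "y \<noteq> w k \<and> dist y (w k) < r"
      then have "u y \<le> u (w k) + ?\<phi> y" using closure_subset by (intro r(2)) (auto simp: dist_norm)
      then show "u y - ?\<phi> y \<le> u (w k) - ?\<phi> (w k)" by (simp add: quad_test_def)
    qed
    moreover have "C2_on \<Omega> ?\<phi>" by (rule C2_on_quad_test[OF X(1)])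
    ultimately show ?thesis
      using conv[of ?\<phi> "w k"] sub[unfolded viscosity_subsolution_def, rule_format, of ?\<phi> "w k"]
      by (simp add: D2X_quad_test_in[OF X(1) wk] H_def grad_quad_test[OF X(1)] hessian_quad_test[OF X(1)])
  qed
  show lower: "\<gamma> *\<^sub>R mat 1 \<preceq> horiz_hess \<sigma> z p Y"
    unfolding loewner_le_def
  proof
    fix \<xi>
    have "(\<lambda>k. \<xi> \<bullet> (H k *v \<xi>)) \<longlonglongrightarrow> \<xi> \<bullet> (horiz_hess \<sigma> z p Y *v \<xi>)"
      by (intro tendsto_inner tendsto_const tendsto_matrix_vector_mult Hl)
    moreover have "\<forall>\<^sub>F k in sequentially. \<xi> \<bullet> ((\<gamma> *\<^sub>R mat 1) *v \<xi>) \<le> \<xi> \<bullet> (H k *v \<xi>)"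
      using ev by eventually_elim (use at in \<open>auto simp: loewner_le_def\<close>)
    ultimately show "\<xi> \<bullet> ((\<gamma> *\<^sub>R mat 1) *v \<xi>) \<le> \<xi> \<bullet> (horiz_hess \<sigma> z p Y *v \<xi>)"
      by (intro tendsto_lowerbound) auto
  qed
  have "\<gamma> * (norm \<xi>)\<^sup>2 \<le> \<xi> \<bullet> (horiz_hess \<sigma> z p Y *v \<xi>)" for \<xi>
    using lower by (simp add: loewner_le_def power2_norm_eq_inner)
  note operator_limit[OF z w P X(2,1) \<open>\<gamma> > 0\<close> this]
  moreover have "\<forall>\<^sub>F k in sequentially. K (w k) (u (w k)) (P k) (X k) - ln (det (H k)) \<le> 0"
    using ev by eventually_elim (use at in simp)
  ultimately have "K z (u z) p Y - ln (det (horiz_hess \<sigma> z p Y)) \<le> 0"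
    unfolding H_def by (intro tendsto_upperbound[where F=sequentially]) auto
  then show "K z (u z) p Y \<le> ln (det (horiz_hess \<sigma> z p Y))" by simp
qed

text \<open>Positive definiteness is assumed at the limit only, but quantitatively, so it persists
  at the nearby touching points and permits testing there.\<close>

lemma supersolution_limit:
  assumes super: "viscosity_supersolution \<Omega> \<sigma> K v"
    and z: "z \<in> \<Omega>" and w: "w \<longlonglongrightarrow> z" "(\<lambda>k. v (w k)) \<longlonglongrightarrow> v z" and P: "P \<longlonglongrightarrow> p"
    and X: "\<And>k. X k \<in> sym_mats" "X \<longlonglongrightarrow> Y"
    and touch: "\<And>k. \<exists>r>0. \<forall>z\<in>closure \<Omega>. norm (z - w k) < r \<longrightarrow> v (w k) + P k \<bullet> (z - w k) + ((z - w k) \<bullet> (X k *v (z - w k))) / 2 \<le> v z"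
    and "c > 0" and lb: "\<And>\<xi>. c * (norm \<xi>)\<^sup>2 \<le> \<xi> \<bullet> (horiz_hess \<sigma> z p Y *v \<xi>)"
  shows "ln (det (horiz_hess \<sigma> z p Y)) \<le> K z (v z) p Y"
proof -
  define H where "H k = horiz_hess \<sigma> (w k) (P k) (X k)" for k
  have Hl: "H \<longlonglongrightarrow> horiz_hess \<sigma> z p Y"
    unfolding H_def by (rule tendsto_horiz_hess[OF \<sigma> op z w(1) P X(2)])
  have ev: "\<forall>\<^sub>F k in sequentially. w k \<in> \<Omega>" using topological_tendstoD[OF w(1) op z] .
  have evp: "\<forall>\<^sub>F k in sequentially. \<forall>\<xi>. \<xi> \<noteq> 0 \<longrightarrow> 0 < \<xi> \<bullet> (H k *v \<xi>)"
    by (rule eventually_pos_def[OF Hl \<open>c > 0\<close> lb])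
  have at: "ln (det (H k)) \<le> K (w k) (v (w k)) (P k) (X k)" if wk: "w k \<in> \<Omega>" and pd: "\<forall>\<xi>. \<xi> \<noteq> 0 \<longrightarrow> 0 < \<xi> \<bullet> (H k *v \<xi>)" for k
  proof -
    let ?\<phi> = "quad_test (w k) (P k) (X k)"
    obtain r where r: "r > 0" "\<And>z. z \<in> closure \<Omega> \<Longrightarrow> norm (z - w k) < r \<Longrightarrow> v (w k) + ?\<phi> z \<le> v z"
      using touch[of k] unfolding quad_test_def add.assoc by blast
    have "loc_min_pt \<Omega> (\<lambda>y. v y - ?\<phi> y) (w k)"
      unfolding loc_min_pt_def eventually_at
    proof (intro conjI wk exI[of _ r] r(1) ballI impI)
      fix y assume "y \<in> \<Omega>" "y \<noteq> w k \<and> dist y (w k) < r"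
      then have "v (w k) + ?\<phi> y \<le> v y" using closure_subset by (intro r(2)) (auto simp: dist_norm)
      then show "v (w k) - ?\<phi> (w k) \<le> v y - ?\<phi> y" by (simp add: quad_test_def)
    qed
    moreover have "C2_on \<Omega> ?\<phi>" by (rule C2_on_quad_test[OF X(1)])
    moreover have "pos_definite (D2X \<sigma> ?\<phi> (w k))"
      using pd horiz_hess_sym[OF X(1)] by (simp add: pos_definite_def D2X_quad_test_in[OF X(1) wk] H_def)
    ultimately show ?thesis
      using super[unfolded viscosity_supersolution_def, rule_format, of ?\<phi> "w k"]
      by (simp add: D2X_quad_test_in[OF X(1) wk] H_def grad_quad_test[OF X(1)] hessian_quad_test[OF X(1)])
  qed
  note operator_limit[OF z w P X(2,1) \<open>c > 0\<close> lb]
  moreover have "\<forall>\<^sub>F k in sequentially. 0 \<le> K (w k) (v (w k)) (P k) (X k) - ln (det (H k))"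
    using ev evp by eventually_elim (use at in simp)
  ultimately have "0 \<le> K z (v z) p Y - ln (det (horiz_hess \<sigma> z p Y))"
    unfolding H_def by (intro tendsto_lowerbound[where F=sequentially]) auto
  then show ?thesis by simp
qed

end

section \<open>Comparison\<close>

text \<open>The estimate for one fixed penalisation, with \<open>s = 3 / (2 * \<epsilon>)\<close>,
  so that \<open>2 * s\<close> is 3/\<epsilon> and \<open>2 * s / 3\<close> is 1/\<epsilon>.
  Monotonicity of \<open>K\<close> in \<open>r\<close>, the subsolution inequality at
  \<open>z\<close>, the supersolution inequality at \<open>w\<close> and the modulus are chained,
  leaving the difference of the logarithms as the second error term.\<close>

lemma doubling_estimate:
  fixes \<Omega> :: "(real^'n) set" and \<sigma> :: "real^'n \<Rightarrow> real^'m^'n"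
    and K :: "real^'n \<Rightarrow> real \<Rightarrow> real^'n \<Rightarrow> real^'n^'n \<Rightarrow> real"
  assumes op: "open \<Omega>" and bd: "bounded \<Omega>" and \<sigma>: "\<forall>i j. C11_closure \<Omega> (\<lambda>x. \<sigma> x $ i $ j)"
    and K: "structure_conditions \<Omega> K"
    and conv: "\<And>\<phi> x. C2_on \<Omega> \<phi> \<Longrightarrow> loc_max_pt \<Omega> (\<lambda>y. u y - \<phi> y) x \<Longrightarrow> \<gamma> *\<^sub>R mat 1 \<preceq> D2X \<sigma> \<phi> x" and \<gamma>: "\<gamma> > 0"
    and sub: "viscosity_subsolution \<Omega> \<sigma> K u" and super: "viscosity_supersolution \<Omega> \<sigma> K v"
    and usc: "usc_on (closure \<Omega>) u" and lsc: "lsc_on (closure \<Omega>) v"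
    and zw: "z \<in> \<Omega>" "w \<in> \<Omega>" and s: "s > 0"
    and max: "\<And>z' w'. z' \<in> closure \<Omega> \<Longrightarrow> w' \<in> closure \<Omega> \<Longrightarrow>
       u z' - v w' - s/3 * (norm (z' - w'))\<^sup>2 \<le> u z - v w - s/3 * (norm (z - w))\<^sup>2"
    and inc: "\<And>p X. X \<in> sym_mats \<Longrightarrow> C * (u z - v w) \<le> K z (u z) p X - K z (v w) p X"
    and mod: "\<And>p X Y. X \<in> sym_mats \<Longrightarrow> Y \<in> sym_mats \<Longrightarrow>
        (- (2 * s)) *\<^sub>R block_mat (mat 1) 0 0 (mat 1) \<preceq> block_mat X 0 0 (- Y) \<Longrightarrow>
        block_mat X 0 0 (- Y) \<preceq> (2 * s) *\<^sub>R block_mat (mat 1) (- mat 1) (- mat 1) (mat 1) \<Longrightarrow>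
        K w (v w) ((2 * s / 3) *\<^sub>R (z - w)) Y - K z (v w) ((2 * s / 3) *\<^sub>R (z - w)) X \<le> \<Theta>"
    and loc: "horiz_hess_bound \<sigma> L z w"
    and L: "L \<ge> 0"
    and small: "8 * L * (s/3 * (norm (z - w))\<^sup>2) < \<gamma>"
  shows "C * (u z - v w) \<le> \<Theta> - real CARD('m) * ln (1 - 8 * L * (s/3 * (norm (z - w))\<^sup>2) / \<gamma>)"
proof -
  define S where "S = closure \<Omega>"
  define p where "p = (2 * s / 3) *\<^sub>R (z - w)"
  have S: "compact S" using bd by (simp add: S_def compact_closure)
  have inS: "z \<in> S" "w \<in> S" using zw closure_subset by (auto simp: S_def)
  have usc1: "usc_on S u" using usc by (simp add: S_def)
  have usc2: "usc_on S (\<lambda>x. - v x)" unfolding S_def by (rule usc_on_uminus[OF lsc])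
  have max': "u z' + - v w' - s/3 * (norm (z' - w'))\<^sup>2 \<le> u z + - v w - s/3 * (norm (z - w))\<^sup>2" if "z' \<in> S" "w' \<in> S" for z' w'
    using max[of z' w'] that by (simp add: S_def)
  obtain w1 w2 P1 P2 X1 X2 Y1 Y2 where
    1: "\<And>k. w1 k \<in> S" "w1 \<longlonglongrightarrow> z" "(\<lambda>k. u (w1 k)) \<longlonglongrightarrow> u z" "P1 \<longlonglongrightarrow> p" "\<And>k. X1 k \<in> sym_mats" "X1 \<longlonglongrightarrow> Y1"
    "\<And>k. touched_above S u (w1 k) (P1 k) (X1 k)"
    and 2: "\<And>k. w2 k \<in> S" "w2 \<longlonglongrightarrow> w" "(\<lambda>k. - v (w2 k)) \<longlonglongrightarrow> - v w" "P2 \<longlonglongrightarrow> - p" "\<And>k. X2 k \<in> sym_mats" "X2 \<longlonglongrightarrow> Y2"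
    "\<And>k. touched_above S (\<lambda>x. - v x) (w2 k) (P2 k) (X2 k)"
    and Y: "Y1 \<in> sym_mats" "Y2 \<in> sym_mats"
    and lower: "\<And>h k. - (2 * s) * ((norm h)\<^sup>2 + (norm k)\<^sup>2) \<le> h \<bullet> (Y1 *v h) + k \<bullet> (Y2 *v k)"
    and upper: "\<And>h k. h \<bullet> (Y1 *v h) + k \<bullet> (Y2 *v k) \<le> 2 * s * (norm (h - k))\<^sup>2"
    unfolding p_def by (rule theorem_on_sums[OF S usc1 usc2 s inS max']) blast+
  define A where "A = horiz_hess \<sigma> z p Y1"
  define B where "B = horiz_hess \<sigma> w p (- Y2)"
  \<comment> \<open>The sum of the two contributions \<open>c = 2 * s\<close> and
    \<open>norm p = 2 * s / 3 * norm (z - w)\<close>: the factor is 2 s + 2 s/3 = 8 s/3.\<close>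
  define d where "d = 8 * L * (s/3 * (norm (z - w))\<^sup>2)"
  have d: "0 \<le> d" "d < \<gamma>" using L s small by (auto simp: d_def)
  have up: "h \<bullet> (Y1 *v h) - k \<bullet> ((- Y2) *v k) \<le> 2 * s * (norm (h - k))\<^sup>2" for h k
    using upper by (simp add: uminus_matrix_vector_mult)
  have lo: "- (2 * s) * ((norm h)\<^sup>2 + (norm k)\<^sup>2) \<le> h \<bullet> (Y1 *v h) - k \<bullet> ((- Y2) *v k)" for h k
    using lower by (simp add: uminus_matrix_vector_mult)
  have A: "\<gamma> *\<^sub>R mat 1 \<preceq> A" "K z (u z) p Y1 \<le> ln (det A)"
    using subsolution_limit[OF op \<sigma> K conv \<gamma> sub zw(1) 1(2,3,4,5,6) 1(7)[unfolded S_def]] unfolding A_def by blast+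
  have AB: "\<xi> \<bullet> (A *v \<xi>) - d * (norm \<xi>)\<^sup>2 \<le> \<xi> \<bullet> (B *v \<xi>)" for \<xi>
  proof -
    have "norm p = 2 * s / 3 * norm (z - w)" using s by (simp add: p_def)
    then have "L * (2 * s * (norm (z - w))\<^sup>2 + norm p * norm (z - w)) = d"
      by (simp add: d_def power2_eq_square algebra_simps)
    then show ?thesis
      using loc[unfolded horiz_hess_bound_def, rule_format, of "2 * s" Y1 "- Y2" \<xi> p, OF _ up] s unfolding A_def B_def by simp
  qed
  have lbB: "(\<gamma> - d) * (norm \<xi>)\<^sup>2 \<le> \<xi> \<bullet> (B *v \<xi>)" for \<xi>
  proof -
    have "\<gamma> * (norm \<xi>)\<^sup>2 \<le> \<xi> \<bullet> (A *v \<xi>)" using A(1) by (simp add: loewner_le_def power2_norm_eq_inner)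
    then show ?thesis using AB[of \<xi>] by (simp add: algebra_simps)
  qed
  \<comment> \<open>Touching \<open>- v\<close> from above is touching \<open>v\<close> from below
    with the signs of \<open>P2\<close> and \<open>X2\<close> reversed. The bound \<gamma> - d,
    inherited from \<open>u\<close>, supplies the positivity needed for the test.\<close>
  have B: "ln (det B) \<le> K w (v w) p (- Y2)"
    unfolding B_def
  proof (rule supersolution_limit[OF op \<sigma> K super zw(2) 2(2), where P="\<lambda>k. - P2 k" and X="\<lambda>k. - X2 k" and c="\<gamma> - d"])
    show "(\<lambda>k. v (w2 k)) \<longlonglongrightarrow> v w" using tendsto_minus[OF 2(3)] by simp
    show "(\<lambda>k. - P2 k) \<longlonglongrightarrow> p" using tendsto_minus[OF 2(4)] by simp
    show "- X2 k \<in> sym_mats" for k using 2(5) by (rule sym_mats_minus)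
    show "(\<lambda>k. - X2 k) \<longlonglongrightarrow> - Y2" by (rule tendsto_minus[OF 2(6)])
    show "\<gamma> - d > 0" using d by simp
    show "(\<gamma> - d) * (norm \<xi>)\<^sup>2 \<le> \<xi> \<bullet> (horiz_hess \<sigma> w p (- Y2) *v \<xi>)" for \<xi>
      using lbB unfolding B_def .
    fix k
    obtain r where r: "r > 0" "\<And>z. z \<in> S \<Longrightarrow> norm (z - w2 k) < r \<Longrightarrow> - v z \<le> - v (w2 k) + P2 k \<bullet> (z - w2 k) + ((z - w2 k) \<bullet> (X2 k *v (z - w2 k))) / 2"
      using 2(7)[of k] by blast
    show "\<exists>r>0. \<forall>z\<in>closure \<Omega>. norm (z - w2 k) < r \<longrightarrow>
        v (w2 k) + (- P2 k) \<bullet> (z - w2 k) + ((z - w2 k) \<bullet> ((- X2 k) *v (z - w2 k))) / 2 \<le> v z"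
      using r by (intro exI[of _ r]) (force simp: S_def uminus_matrix_vector_mult)
  qed
  have "real CARD('m) * ln (1 - d/\<gamma>) + ln (det A) \<le> ln (det B)"
    by (rule ln_det_almost_mono[OF _ A(1) d AB]) (simp add: A_def horiz_hess_sym Y)
  moreover have "K w (v w) p (- Y2) - K z (v w) p Y1 \<le> \<Theta>"
    unfolding p_def
    by (rule mod[OF Y(1) sym_mats_minus[OF Y(2)] block_mat_bounds[OF lo up]])
  ultimately show ?thesis
    using inc[OF Y(1), of p] A(2) B unfolding d_def by linarith
qed

lemma sup_norm_on_upper:
  assumes "bounded (u ` S)" "x \<in> S" shows "\<bar>u x\<bar> \<le> sup_norm_on S u"
proof -
  obtain B where "\<And>x. x \<in> S \<Longrightarrow> \<bar>u x\<bar> \<le> B" using assms(1) unfolding bounded_iff by auto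
  then have "bdd_above ((\<lambda>x. \<bar>u x\<bar>) ` S)" by (intro bdd_aboveI2)
  then show ?thesis unfolding sup_norm_on_def using assms(2) by (rule cSUP_upper[rotated])
qed

theorem comparison:
  fixes \<Omega> :: "(real^'n) set" and \<sigma> :: "real^'n \<Rightarrow> real^'m^'n"
    and K :: "real^'n \<Rightarrow> real \<Rightarrow> real^'n \<Rightarrow> real^'n^'n \<Rightarrow> real"
  assumes op: "open \<Omega>" and bd: "bounded \<Omega>" and \<sigma>: "\<forall>i j. C11_closure \<Omega> (\<lambda>x. \<sigma> x $ i $ j)"
    and K: "structure_conditions \<Omega> K"
    and u: "bounded (u ` closure \<Omega>)" "uniformly_X_convex \<Omega> \<sigma> u" "viscosity_subsolution \<Omega> \<sigma> K u"
    and v: "bounded (v ` closure \<Omega>)" "lsc_on (closure \<Omega>) v" "viscosity_supersolution \<Omega> \<sigma> K v"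
    and inc: "strictly_increasing_in_r \<Omega> K (max (sup_norm_on (closure \<Omega>) u) (sup_norm_on (closure \<Omega>) v))"
    and frontier: "\<And>y. y \<in> frontier \<Omega> \<Longrightarrow> u y - v y \<le> m" and m: "0 \<le> m" and x: "x \<in> \<Omega>"
  shows "u x - v x \<le> m"
proof (rule ccontr)
  assume contra: "\<not> u x - v x \<le> m"
  define S where "S = closure \<Omega>"
  define M where "M = max (sup_norm_on S u) (sup_norm_on S v)"
  have S: "compact S" using bd by (simp add: S_def compact_closure)
  have \<Omega>S: "\<Omega> \<subseteq> S" unfolding S_def by (rule closure_subset)
  have xS: "x \<in> S" using x \<Omega>S by blast
  have uM: "\<bar>u y\<bar> \<le> M" and vM: "\<bar>v y\<bar> \<le> M" if "y \<in> S" for y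
    using sup_norm_on_upper[OF u(1), of y] sup_norm_on_upper[OF v(1), of y] that by (auto simp: M_def S_def)
  obtain C where C: "C > 0" "\<And>r s x p X. x \<in> closure \<Omega> \<Longrightarrow> X \<in> sym_mats \<Longrightarrow> - M \<le> s \<Longrightarrow> s \<le> r \<Longrightarrow> r \<le> M \<Longrightarrow> C * (r - s) \<le> K x r p X - K x s p X"
    using inc unfolding strictly_increasing_in_r_def M_def S_def by blast
  obtain \<gamma> where \<gamma>: "\<gamma> > 0" "\<And>\<phi> x. C2_on \<Omega> \<phi> \<Longrightarrow> loc_max_pt \<Omega> (\<lambda>y. u y - \<phi> y) x \<Longrightarrow> \<gamma> *\<^sub>R mat 1 \<preceq> D2X \<sigma> \<phi> x"
    and usc: "usc_on S u"
    using u(2) unfolding uniformly_X_convex_def S_def by blast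
  obtain \<omega> where \<omega>: "modulus \<omega>" and K\<omega>: "\<forall>\<epsilon>>0. \<forall>x\<in>closure \<Omega>. \<forall>y\<in>closure \<Omega>. \<forall>r. \<forall>X\<in>sym_mats. \<forall>Y\<in>sym_mats.
      (- (3 / \<epsilon>)) *\<^sub>R block_mat (mat 1) 0 0 (mat 1) \<preceq> block_mat X 0 0 (- Y) \<and>
      block_mat X 0 0 (- Y) \<preceq> (3 / \<epsilon>) *\<^sub>R block_mat (mat 1) (- mat 1) (- mat 1) (mat 1) \<longrightarrow>
      K y r ((1 / \<epsilon>) *\<^sub>R (x - y)) Y - K x r ((1 / \<epsilon>) *\<^sub>R (x - y)) X \<le> \<omega> (norm (x - y) * (1 + norm (x - y) / \<epsilon>))"
    using K unfolding structure_conditions_def by (elim conjE exE) (rule that)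
  have uscv: "usc_on S (\<lambda>x. - v x)" unfolding S_def by (rule usc_on_uminus[OF v(2)])
  obtain x0 where x0: "x0 \<in> S" "\<And>y. y \<in> S \<Longrightarrow> u y + - v y \<le> u x0 + - v x0"
    using usc_attains_sup[OF S _ usc_on_add[OF usc uscv]] xS by blast
  define m0 where "m0 = u x0 - v x0"
  have m0: "m0 > m" "m0 > 0" using x0(2)[OF xS] contra m by (auto simp: m0_def)
  \<comment> \<open>This is \<epsilon> = 1/(k + 1), and \<open>s k / 3\<close> is the usual
    coefficient 1/(2 \<epsilon>).\<close>
  define s where "s k = 3 / 2 * real (Suc k)" for k
  have s: "s k > 0" for k by (simp add: s_def)
  have "\<exists>q\<in>S \<times> S. \<forall>q'\<in>S \<times> S. u (fst q') + - v (snd q') + - (s k / 3 * (norm (fst q' - snd q'))\<^sup>2) \<le> u (fst q) + - v (snd q) + - (s k / 3 * (norm (fst q - snd q))\<^sup>2)" for k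
  proof -
    have "usc_on (S \<times> S) (\<lambda>q. u (fst q) + - v (snd q) + - (s k / 3 * (norm (fst q - snd q))\<^sup>2))"
      by (intro usc_on_add usc_on_compose[OF usc] usc_on_compose[OF uscv] continuous_on_imp_usc_on continuous_intros) auto
    then show ?thesis using usc_attains_sup[OF compact_Times[OF S S]] xS by (metis (no_types, lifting) empty_iff SigmaI)
  qed
  then obtain q where q: "\<And>k. q k \<in> S \<times> S" and qmax: "\<And>k q'. q' \<in> S \<times> S \<Longrightarrow> u (fst q') + - v (snd q') + - (s k / 3 * (norm (fst q' - snd q'))\<^sup>2) \<le> u (fst (q k)) + - v (snd (q k)) + - (s k / 3 * (norm (fst (q k) - snd (q k)))\<^sup>2)"
    by metis
  obtain q0 \<rho> where q0: "q0 \<in> S \<times> S" and \<rho>: "strict_mono (\<rho> :: nat \<Rightarrow> nat)" and ql: "(q \<circ> \<rho>) \<longlonglongrightarrow> q0"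
    using compact_Times[OF S S] q unfolding compact_def by blast
  define z where "z k = fst (q (\<rho> k))" for k
  define w where "w k = snd (q (\<rho> k))" for k
  define \<tau> where "\<tau> k = s (\<rho> k)" for k
  define e where "e k = \<tau> k / 3 * (norm (z k - w k))\<^sup>2" for k
  have \<tau>: "\<tau> k > 0" for k unfolding \<tau>_def by (rule s)
  have e0: "e k \<ge> 0" for k using \<tau>[of k] by (simp add: e_def)
  have zS: "z k \<in> S" and wS: "w k \<in> S" for k using q[of "\<rho> k"] by (auto simp: z_def w_def mem_Times_iff)
  have maxk: "u z' - v w' - \<tau> k / 3 * (norm (z' - w'))\<^sup>2 \<le> u (z k) - v (w k) - \<tau> k / 3 * (norm (z k - w k))\<^sup>2"
    if "z' \<in> S" "w' \<in> S" for z' w' k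
    using qmax[of "(z', w')" "\<rho> k"] that by (simp add: z_def w_def \<tau>_def)
  \<comment> \<open>Competitor on the diagonal: \<open>(x0, x0)\<close> pays no penalty.\<close>
  have gain: "m0 + e k \<le> u (z k) - v (w k)" for k
    using maxk[OF x0(1) x0(1), of k] by (simp add: m0_def e_def)
  define z0 where "z0 = fst q0"
  have zl: "z \<longlonglongrightarrow> z0" using tendsto_fst[OF ql] by (simp add: z_def[abs_def] z0_def o_def)
  have wl0: "w \<longlonglongrightarrow> snd q0" using tendsto_snd[OF ql] by (simp add: w_def[abs_def] o_def)
  \<comment> \<open>Boundedness of \<open>u\<close> and \<open>v\<close> gives
    \<open>e k \<le> 2 * M\<close>, while the coefficient of the squared distance in
    \<open>e k\<close> is at least (k + 1)/2 along the subsequence.\<close>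
  have nz: "(\<lambda>k. (norm (z k - w k))\<^sup>2) \<longlonglongrightarrow> 0"
  proof (rule Lim_null_comparison)
    show "\<forall>\<^sub>F k in sequentially. norm ((norm (z k - w k))\<^sup>2) \<le> 4 * M / real (Suc k)"
    proof (intro always_eventually allI)
      fix k
      have "e k \<le> 2 * M" using gain[of k] m0 uM[OF zS, of k] vM[OF wS, of k] by (simp add: abs_le_iff)
      moreover have "real (Suc k) \<le> real (Suc (\<rho> k))" using seq_suble[OF \<rho>, of k] by simp
      then have "real (Suc k) * (norm (z k - w k))\<^sup>2 \<le> real (Suc (\<rho> k)) * (norm (z k - w k))\<^sup>2" by (rule mult_right_mono) simp
      moreover have "2 * e k = real (Suc (\<rho> k)) * (norm (z k - w k))\<^sup>2" by (simp add: e_def \<tau>_def s_def)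
      ultimately have "real (Suc k) * (norm (z k - w k))\<^sup>2 \<le> 4 * M" by linarith
      then show "norm ((norm (z k - w k))\<^sup>2) \<le> 4 * M / real (Suc k)" by (simp add: field_simps)
    qed
    show "(\<lambda>k. 4 * M / real (Suc k)) \<longlonglongrightarrow> 0" by (rule LIMSEQ_Suc[OF lim_const_over_n])
  qed
  have dl: "(\<lambda>k. norm (z k - w k)) \<longlonglongrightarrow> 0"
    using tendsto_real_sqrt[OF nz] by simp
  have "(\<lambda>k. z k - w k) \<longlonglongrightarrow> z0 - snd q0" by (intro tendsto_diff zl wl0)
  moreover have "(\<lambda>k. z k - w k) \<longlonglongrightarrow> 0" using dl by (rule tendsto_norm_zero_cancel)
  ultimately have "snd q0 = z0" using LIMSEQ_unique by fastforce
  then have wl: "w \<longlonglongrightarrow> z0" using wl0 by simp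
  have z0S: "z0 \<in> S" using q0 by (auto simp: z0_def)
  have ev: "\<forall>\<^sub>F k in sequentially. u (z k) - v (w k) < u z0 - v z0 + \<eta>" if "\<eta> > 0" for \<eta>
  proof -
    have "\<forall>\<^sub>F k in sequentially. u (z k) < u z0 + \<eta>/2" by (rule usc_seq_upper[OF usc z0S zS zl]) (use that in simp)
    moreover have "\<forall>\<^sub>F k in sequentially. - v (w k) < - v z0 + \<eta>/2" by (rule usc_seq_upper[OF uscv z0S wS wl]) (use that in simp)
    ultimately show ?thesis by eventually_elim linarith
  qed
  \<comment> \<open>The limit point on the diagonal again attains the maximum. As \<open>m0\<close>
    exceeds the boundary bound \<open>m\<close>, it lies in \<Omega>, where the equation is
    available.\<close>
  have z0m: "m0 \<le> u z0 - v z0"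
  proof (rule ccontr)
    assume "\<not> m0 \<le> u z0 - v z0"
    then have "\<forall>\<^sub>F k in sequentially. u (z k) - v (w k) < u z0 - v z0 + (m0 - (u z0 - v z0))" by (intro ev) simp
    then have "\<forall>\<^sub>F k in sequentially. False" by eventually_elim (use gain e0 in \<open>smt (verit)\<close>)
    then show False by simp
  qed
  have "z0 \<notin> frontier \<Omega>" using frontier[of z0] z0m m0 by force
  then have z0: "z0 \<in> \<Omega>" using z0S op by (simp add: S_def frontier_def interior_open)
  \<comment> \<open>The penalty is at most the excess of \<open>u (z k) - v (w k)\<close> over
    \<open>m0\<close>, and semicontinuity makes this excess vanish in the limit. The mere bound by
    \<open>2 * M\<close> would not suffice, because the Hessian error is proportional to
    \<open>e k\<close>.\<close>
  have el: "e \<longlonglongrightarrow> 0"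
  proof (rule order_tendstoI)
    fix a :: real assume "a < 0"
    then have "a < e k" for k using e0[of k] by linarith
    then show "\<forall>\<^sub>F k in sequentially. a < e k" by simp
  next
    fix a :: real assume "0 < a"
    from ev[OF this] show "\<forall>\<^sub>F k in sequentially. e k < a"
    proof eventually_elim
      case (elim k)
      then show ?case using gain[of k] x0(2)[OF z0S] by (simp add: m0_def)
    qed
  qed
  obtain r L where r: "r > 0" "cball z0 r \<subseteq> \<Omega>" and L: "L \<ge> 0"
    and loc: "\<And>z w. z \<in> cball z0 r \<Longrightarrow> w \<in> cball z0 r \<Longrightarrow> horiz_hess_bound \<sigma> L z w"
    using horiz_hess_local_bound[OF \<sigma> op z0] by metis
  define R where "R k = \<omega> (norm (z k - w k) + 2 * e k) - real CARD('m) * ln (1 - 8 * L * e k / \<gamma>)" for k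
  have est: "\<forall>\<^sub>F k in sequentially. C * m0 \<le> R k"
  proof -
    have "\<forall>\<^sub>F k in sequentially. z k \<in> ball z0 r" "\<forall>\<^sub>F k in sequentially. w k \<in> ball z0 r"
      using topological_tendstoD[OF zl open_ball, of z0 r] topological_tendstoD[OF wl open_ball, of z0 r] r by simp_all
    moreover have "(\<lambda>k. 8 * L * e k) \<longlonglongrightarrow> 8 * L * 0" by (intro tendsto_intros el)
    then have "\<forall>\<^sub>F k in sequentially. 8 * L * e k < \<gamma>" using \<gamma>(1) by (intro order_tendstoD(2)) auto
    ultimately show ?thesis
    proof eventually_elim
      case (elim k)
      have cb: "z k \<in> cball z0 r" "w k \<in> cball z0 r" using elim by (simp_all add: less_imp_le)
      have in\<Omega>: "z k \<in> \<Omega>" "w k \<in> \<Omega>" using cb r(2) by blast+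
      have "C * (u (z k) - v (w k)) \<le> \<omega> (norm (z k - w k) + 2 * e k) - real CARD('m) * ln (1 - 8 * L * (\<tau> k / 3 * (norm (z k - w k))\<^sup>2) / \<gamma>)"
      proof (rule doubling_estimate[OF op bd \<sigma> K \<gamma>(2,1) u(3) v(3) usc[unfolded S_def] v(2) in\<Omega> \<tau> maxk[unfolded S_def]])
        show "8 * L * (\<tau> k / 3 * (norm (z k - w k))\<^sup>2) < \<gamma>" using elim(3) by (simp add: e_def)
        show "C * (u (z k) - v (w k)) \<le> K (z k) (u (z k)) p X - K (z k) (v (w k)) p X" if "X \<in> sym_mats" for p X
        proof (rule C(2)[OF _ that])
          show "z k \<in> closure \<Omega>" using zS by (simp add: S_def)
          show "- M \<le> v (w k)" "u (z k) \<le> M" using uM[OF zS, of k] vM[OF wS, of k] by (simp_all add: abs_le_iff)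
          show "v (w k) \<le> u (z k)" using gain[of k] e0[of k] m0 by linarith
        qed
        fix X Y :: "real^'n^'n"
        \<comment> \<open>Translation back to the parameter of the structure conditions. The
          quotient of the squared distance by \<epsilon> is exactly \<open>2 * e k\<close>, hence
          the argument of the modulus.\<close>
        define \<epsilon> where "\<epsilon> = 3 / (2 * \<tau> k)"
        have \<epsilon>: "\<epsilon> > 0" "3 / \<epsilon> = 2 * \<tau> k" "1 / \<epsilon> = 2 * \<tau> k / 3" using \<tau>[of k] by (auto simp: \<epsilon>_def)
        have arg: "norm (z k - w k) * (1 + norm (z k - w k) / \<epsilon>) = norm (z k - w k) + 2 * e k"
        proof -
          have n: "norm (z k - w k) / \<epsilon> = 2 * \<tau> k / 3 * norm (z k - w k)" unfolding \<epsilon>(3)[symmetric] by simp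
          show ?thesis unfolding n by (simp add: e_def power2_eq_square algebra_simps)
        qed
        assume XY: "X \<in> sym_mats" "Y \<in> sym_mats"
          "(- (2 * \<tau> k)) *\<^sub>R block_mat (mat 1) 0 0 (mat 1) \<preceq> block_mat X 0 0 (- Y)"
          "block_mat X 0 0 (- Y) \<preceq> (2 * \<tau> k) *\<^sub>R block_mat (mat 1) (- mat 1) (- mat 1) (mat 1)"
        show "K (w k) (v (w k)) ((2 * \<tau> k / 3) *\<^sub>R (z k - w k)) Y - K (z k) (v (w k)) ((2 * \<tau> k / 3) *\<^sub>R (z k - w k)) X \<le> \<omega> (norm (z k - w k) + 2 * e k)"
          using K\<omega>[rule_format, OF \<epsilon>(1) zS[of k, unfolded S_def] wS[of k, unfolded S_def] XY(1,2) conjI[OF XY(3,4)[folded \<epsilon>(2)]], of "v (w k)"]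
          unfolding arg \<epsilon>(3) .
      qed (use L loc[OF cb] in auto)
      moreover have "C * m0 \<le> C * (u (z k) - v (w k))" using gain[of k] e0[of k] C(1) by (intro mult_left_mono) auto
      ultimately show ?case unfolding R_def e_def by linarith
    qed
  qed
  have "R \<longlonglongrightarrow> \<omega> 0 - real CARD('m) * ln (1 - 8 * L * 0 / \<gamma>)"
  proof -
    have "(\<lambda>k. norm (z k - w k) + 2 * e k) \<longlonglongrightarrow> 0 + 2 * 0" by (intro tendsto_intros dl el)
    then have "(\<lambda>k. norm (z k - w k) + 2 * e k) \<longlonglongrightarrow> 0" by simp
    moreover have "continuous_on {0..} \<omega>" using \<omega> by (simp add: modulus_def)
    moreover have "\<forall>\<^sub>F k in sequentially. norm (z k - w k) + 2 * e k \<in> {0..}" using e0 by simp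
    ultimately have "(\<lambda>k. \<omega> (norm (z k - w k) + 2 * e k)) \<longlonglongrightarrow> \<omega> 0"
      using continuous_on_tendsto_compose[of "{0..}" \<omega>] by force
    moreover have "(\<lambda>k. ln (1 - 8 * L * e k / \<gamma>)) \<longlonglongrightarrow> ln (1 - 8 * L * 0 / \<gamma>)"
      using \<gamma>(1) by (intro tendsto_intros el) auto
    ultimately show ?thesis unfolding R_def by (intro tendsto_diff tendsto_mult_left)
  qed
  then have "R \<longlonglongrightarrow> 0" using \<omega> by (simp add: modulus_def)
  then have "C * m0 \<le> 0" using est by (intro tendsto_lowerbound[of R 0 sequentially]) auto
  then show False using C(1) m0(2) by (simp add: mult_le_0_iff)
qed

section \<open>Both assertions from the pointwise comparison\<close>

theorem theorem1p2:
  fixes \<Omega> :: "(real^'n) set"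
    and \<sigma> :: "real^'n \<Rightarrow> real^'m^'n"
    and K :: "real^'n \<Rightarrow> real \<Rightarrow> real^'n \<Rightarrow> real^'n^'n \<Rightarrow> real"
  assumes "open \<Omega>" and "bounded \<Omega>"
    and "\<forall>i j. C11_closure \<Omega> (\<lambda>x. \<sigma> x $ i $ j)"
    and "structure_conditions \<Omega> K"
  shows
    "(\<forall>u v. bounded (u ` closure \<Omega>) \<and> uniformly_X_convex \<Omega> \<sigma> u \<and> viscosity_subsolution \<Omega> \<sigma> K u \<and>
        bounded (v ` closure \<Omega>) \<and> lsc_on (closure \<Omega>) v \<and> viscosity_supersolution \<Omega> \<sigma> K v \<and>
        strictly_increasing_in_r \<Omega> K
          (max (sup_norm_on (closure \<Omega>) u) (sup_norm_on (closure \<Omega>) v)) \<and>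
        \<Omega> \<noteq> {} \<longrightarrow>
        (\<exists>z\<in>frontier \<Omega>.
           (\<forall>y\<in>frontier \<Omega>. max (u y - v y) 0 \<le> max (u z - v z) 0) \<and>
           (SUP x\<in>\<Omega>. u x - v x) \<le> max (u z - v z) 0))
     \<and>
     (\<forall>u\<^sub>1 u\<^sub>2. uniformly_X_convex \<Omega> \<sigma> u\<^sub>1 \<and> viscosity_solution \<Omega> \<sigma> K u\<^sub>1 \<and>
        uniformly_X_convex \<Omega> \<sigma> u\<^sub>2 \<and> viscosity_solution \<Omega> \<sigma> K u\<^sub>2 \<and>
        (\<forall>x\<in>frontier \<Omega>. u\<^sub>1 x = u\<^sub>2 x) \<and>
        strictly_increasing_in_r \<Omega> K
          (max (sup_norm_on (closure \<Omega>) u\<^sub>1) (sup_norm_on (closure \<Omega>) u\<^sub>2)) \<longrightarrow>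
        (\<forall>x\<in>closure \<Omega>. u\<^sub>1 x = u\<^sub>2 x))"
proof (intro conjI allI impI)
  fix u v
  assume "bounded (u ` closure \<Omega>) \<and> uniformly_X_convex \<Omega> \<sigma> u \<and> viscosity_subsolution \<Omega> \<sigma> K u \<and>
        bounded (v ` closure \<Omega>) \<and> lsc_on (closure \<Omega>) v \<and> viscosity_supersolution \<Omega> \<sigma> K v \<and>
        strictly_increasing_in_r \<Omega> K
          (max (sup_norm_on (closure \<Omega>) u) (sup_norm_on (closure \<Omega>) v)) \<and> \<Omega> \<noteq> {}"
  then have u: "bounded (u ` closure \<Omega>)" "uniformly_X_convex \<Omega> \<sigma> u" "viscosity_subsolution \<Omega> \<sigma> K u"
    and v: "bounded (v ` closure \<Omega>)" "lsc_on (closure \<Omega>) v" "viscosity_supersolution \<Omega> \<sigma> K v"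
    and inc: "strictly_increasing_in_r \<Omega> K (max (sup_norm_on (closure \<Omega>) u) (sup_norm_on (closure \<Omega>) v))"
    and ne: "\<Omega> \<noteq> {}" by auto
  \<comment> \<open>A nonempty bounded set has nonempty boundary, so the maximum on the right is
    attained: the boundary is compact and \<open>u - v\<close> is upper semicontinuous on
    it.\<close>
  have "\<Omega> \<noteq> UNIV" using assms(2) not_bounded_UNIV by blast
  then have fne: "frontier \<Omega> \<noteq> {}" using ne by (simp add: frontier_eq_empty)
  have "usc_on (frontier \<Omega>) (\<lambda>x. u x + - v x)"
  proof (rule usc_on_subset[OF usc_on_add])
    show "usc_on (closure \<Omega>) u" using u(2) by (simp add: uniformly_X_convex_def)
    show "usc_on (closure \<Omega>) (\<lambda>x. - v x)" by (rule usc_on_uminus[OF v(2)])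
  qed (simp add: frontier_def)
  from usc_attains_sup[OF compact_frontier_bounded[OF assms(2)] fne this]
  obtain z where z: "z \<in> frontier \<Omega>" "\<And>y. y \<in> frontier \<Omega> \<Longrightarrow> u y + - v y \<le> u z + - v z" by blast
  have "u x - v x \<le> max (u z - v z) 0" if "x \<in> \<Omega>" for x
    by (rule comparison[OF assms u v inc _ _ that]) (use z(2) in \<open>auto simp: le_max_iff_disj\<close>)
  then have "(SUP x\<in>\<Omega>. u x - v x) \<le> max (u z - v z) 0" using ne by (intro cSUP_least)
  then show "\<exists>z\<in>frontier \<Omega>. (\<forall>y\<in>frontier \<Omega>. max (u y - v y) 0 \<le> max (u z - v z) 0) \<and>
           (SUP x\<in>\<Omega>. u x - v x) \<le> max (u z - v z) 0"
  proof (intro bexI[of _ z] conjI ballI z(1))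
    fix y assume "y \<in> frontier \<Omega>"
    from z(2)[OF this] show "max (u y - v y) 0 \<le> max (u z - v z) 0" by simp
  qed
next
  fix u1 u2
  assume "uniformly_X_convex \<Omega> \<sigma> u1 \<and> viscosity_solution \<Omega> \<sigma> K u1 \<and>
        uniformly_X_convex \<Omega> \<sigma> u2 \<and> viscosity_solution \<Omega> \<sigma> K u2 \<and>
        (\<forall>x\<in>frontier \<Omega>. u1 x = u2 x) \<and>
        strictly_increasing_in_r \<Omega> K
          (max (sup_norm_on (closure \<Omega>) u1) (sup_norm_on (closure \<Omega>) u2))"
  then have cv: "uniformly_X_convex \<Omega> \<sigma> u1" "uniformly_X_convex \<Omega> \<sigma> u2"
    and sol: "viscosity_solution \<Omega> \<sigma> K u1" "viscosity_solution \<Omega> \<sigma> K u2"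
    and eq: "\<And>x. x \<in> frontier \<Omega> \<Longrightarrow> u1 x = u2 x"
    and inc: "strictly_increasing_in_r \<Omega> K (max (sup_norm_on (closure \<Omega>) u1) (sup_norm_on (closure \<Omega>) u2))"
    by auto
  have cont: "bounded (u ` closure \<Omega>)" "lsc_on (closure \<Omega>) u" if "viscosity_solution \<Omega> \<sigma> K u" for u
  proof -
    have c: "continuous_on (closure \<Omega>) u" using that by (simp add: viscosity_solution_def)
    then show "bounded (u ` closure \<Omega>)"
      using assms(2) by (intro compact_imp_bounded compact_continuous_image) (auto simp: compact_closure)
    show "lsc_on (closure \<Omega>) u"
      using c unfolding lsc_on_def continuous_on_def by (auto intro: order_tendstoD(1))
  qed
  note s1 = sol(1)[unfolded viscosity_solution_def] and s2 = sol(2)[unfolded viscosity_solution_def]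
  have 1: "u1 x - u2 x \<le> 0" if "x \<in> \<Omega>" for x
    by (rule comparison[OF assms cont(1)[OF sol(1)] cv(1) _ cont[OF sol(2)] _ inc _ _ that]) (use s1 s2 eq in auto)
  \<comment> \<open>The roles of the two solutions are exchanged. The monotonicity hypothesis
    carries over, since the bound in it is symmetric in the two norms.\<close>
  have 2: "u2 x - u1 x \<le> 0" if "x \<in> \<Omega>" for x
    by (rule comparison[OF assms cont(1)[OF sol(2)] cv(2) _ cont[OF sol(1)] _ inc[unfolded max.commute[of "sup_norm_on (closure \<Omega>) u1"]] _ _ that])
      (use s1 s2 eq in auto)
  show "\<forall>x\<in>closure \<Omega>. u1 x = u2 x"
  proof
    fix x assume "x \<in> closure \<Omega>"
    then have "x \<in> \<Omega> \<or> x \<in> frontier \<Omega>" using assms(1) by (auto simp: frontier_def interior_open)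
    then show "u1 x = u2 x" using 1[of x] 2[of x] eq[of x] by force
  qed
qed

end
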